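(* Let $\varepsilon>0$ and assume $n\in\Omega(\varepsilon^{-4})$ is sufficiently large. For any $r\in\Omega(n^{1/3})$, there exists an algorithm that, for the problem of maximizing a monotone submodular function $f$ under a strongly base-orderable matroid constraint $\mathcal{I}(\mathcal{M})$ of rank $r$ given only the noisy value oracle $\tilde f$ (and a membership oracle for $\mathcal{I}(\mathcal{M})$), returns a $\left(1-\frac1e-O(\varepsilon)\right)$-approximation with probability at least $1-O\left(\frac1n\right)$, using at most $O(n^7\varepsilon^{-1})$ queries to $\tilde f$.
   Context: $N$ is a ground set with $|N|=n$. $f:2^N\to\mathbb{R}_{\ge0}$ is monotone, submodular, $f(\varnothing)=0$. A matroid $\mathcal{M}=(N,\mathcal{I}(\mathcal{M}))$ has the usual independence axioms; its rank is the maximum size of an independent set and maximal independent sets are bases. It is assumed all singletons are independent. $\mathcal{M}$ is strongly base-orderable if for any two bases $B_1,B_2$ there is a bijection $\sigma:B_1\to B_2$ such that for every $X\subseteq B_1$, both $(B_1\setminus X)\cup\sigma(X)$ and $(B_2\setminus\sigma(X))\cup X$ are bases. A noise distribution $\mathcal{D}$ has a generalized exponential tail if for $x$ beyond some $x_0$ its density is $e^{-\sum_ic_ix^{\gamma_i}}$ with $\gamma_0\ge\gamma_1\ge\cdots$, $\gamma_0\ge1$, $c_0>0$ (for bounded support: an atom at the supremum or density continuous and nonzero there); $\mathbb{E}[\mathcal{D}]=1$. The noisy oracle satisfies $\tilde f(S)=\xi_Sf(S)$ with $\xi_S$ i.i.d. from $\mathcal{D}$ (one draw per set). A $\beta$-approximation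 is an $S\in\mathcal{I}(\mathcal{M})$ with $f(S)\ge\beta\max_{T\in\mathcal{I}(\mathcal{M})}f(T)$. *)

theory Defs
  imports "HOL-Probability.Probability"
begin

definition matroid :: "'a set \<Rightarrow> 'a set set \<Rightarrow> bool" where
  "matroid N I \<longleftrightarrow> finite N \<and> I \<subseteq> Pow N \<and> {} \<in> I \<and>
     (\<forall>A B. B \<in> I \<and> A \<subseteq> B \<longrightarrow> A \<in> I) \<and>
     (\<forall>A\<in>I. \<forall>B\<in>I. card A < card B \<longrightarrow> (\<exists>x\<in>B - A. insert x A \<in> I))"

definition loopless :: "'a set \<Rightarrow> 'a set set \<Rightarrow> bool" where
  "loopless N I \<longleftrightarrow> (\<forall>x\<in>N. {x} \<in> I)"

definition matroid_rank :: "'a set set \<Rightarrow> nat" where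
  "matroid_rank I = Max (card ` I)"

definition basis :: "'a set set \<Rightarrow> 'a set \<Rightarrow> bool" where
  "basis I B \<longleftrightarrow> B \<in> I \<and> (\<forall>B'\<in>I. B \<subseteq> B' \<longrightarrow> B' = B)"

definition strongly_base_orderable :: "'a set set \<Rightarrow> bool" where
  "strongly_base_orderable I \<longleftrightarrow>
     (\<forall>B1 B2. basis I B1 \<and> basis I B2 \<longrightarrow>
       (\<exists>\<sigma>. bij_betw \<sigma> B1 B2 \<and>
         (\<forall>X\<subseteq>B1. basis I ((B1 - X) \<union> \<sigma> ` X) \<and> basis I ((B2 - \<sigma> ` X) \<union> X))))"

definition submodular_on :: "'a set \<Rightarrow> ('a set \<Rightarrow> real) \<Rightarrow> bool" where
  "submodular_on N f \<longleftrightarrow> (\<forall>A\<subseteq>N. \<forall>B\<subseteq>N. f (A \<union> B) + f (A \<inter> B) \<le> f A + f B)"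

definition monotone_submodular :: "'a set \<Rightarrow> ('a set \<Rightarrow> real) \<Rightarrow> bool" where
  "monotone_submodular N f \<longleftrightarrow>
     (\<forall>S\<subseteq>N. 0 \<le> f S) \<and> f {} = 0 \<and> mono_on (Pow N) f \<and> submodular_on N f"

definition approximates :: "'a set set \<Rightarrow> ('a set \<Rightarrow> real) \<Rightarrow> real \<Rightarrow> 'a set \<Rightarrow> bool" where
  "approximates I f \<beta> S \<longleftrightarrow> S \<in> I \<and> f S \<ge> \<beta> * Max (f ` I)"

text \<open>Only the part of the distribution inside \<open>S\<close> has to be absolutely continuous.\<close>

definition has_density_on :: "real measure \<Rightarrow> real set \<Rightarrow> (real \<Rightarrow> real) \<Rightarrow> bool" where
  "has_density_on D S \<rho> \<longleftrightarrow> set_borel_measurable borel S \<rho> \<and> (\<forall>x\<in>S. 0 \<le> \<rho> x) \<and>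
     (\<forall>A\<in>sets borel. A \<subseteq> S \<longrightarrow> emeasure D A = (\<integral>\<^sup>+x\<in>A. ennreal (\<rho> x) \<partial>lborel))"

text \<open>The exponent may be a finite sum (pad \<open>c\<close> with zeros) or a convergent series. The condition
  \<open>0 \<le> x0\<close> is no restriction, since \<open>x0\<close> may be increased; it keeps the base of \<open>powr\<close> positive.\<close>

definition exponential_tail :: "real measure \<Rightarrow> bool" where
  "exponential_tail D \<longleftrightarrow>
     (\<exists>(x0::real) (c::nat \<Rightarrow> real) (\<gamma>::nat \<Rightarrow> real).
        0 \<le> x0 \<and> decseq \<gamma> \<and> \<gamma> 0 \<ge> 1 \<and> c 0 > 0 \<and>
        (\<forall>x>x0. summable (\<lambda>i. c i * x powr \<gamma> i)) \<and>
        has_density_on D {x0<..} (\<lambda>x. exp (- (\<Sum>i. c i * x powr \<gamma> i))))"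

text \<open>Here \<open>b\<close> is the supremum of the support.\<close>

definition bounded_support_tail :: "real measure \<Rightarrow> bool" where
  "bounded_support_tail D \<longleftrightarrow>
     (\<exists>a b. (AE x in D. a \<le> x \<and> x \<le> b) \<and> (\<forall>y<b. measure D {y<..} > 0) \<and>
        (measure D {b} > 0 \<or>
         (\<exists>\<rho> \<delta>. \<delta> > 0 \<and> has_density_on D {b - \<delta><..b} \<rho> \<and>
            continuous (at b within {b - \<delta><..b}) \<rho> \<and> \<rho> b \<noteq> 0)))"

definition generalized_exponential_tail :: "real measure \<Rightarrow> bool" where
  "generalized_exponential_tail D \<longleftrightarrow> exponential_tail D \<or> bounded_support_tail D"

definition noise_distribution :: "real measure \<Rightarrow> bool" where
  "noise_distribution D \<longleftrightarrow> prob_space D \<and> sets D = sets borel \<and>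
     generalized_exponential_tail D \<and> integrable D (\<lambda>x. x) \<and> (LINT x|D. x) = 1"

definition noise_space :: "'a set \<Rightarrow> real measure \<Rightarrow> ('a set \<Rightarrow> real) measure" where
  "noise_space N D = Pi\<^sub>M (Pow N) (\<lambda>_. D)"

definition noisy_oracle ::
  "'a set \<Rightarrow> ('a set \<Rightarrow> real) \<Rightarrow> ('a set \<Rightarrow> real) \<Rightarrow> 'a set \<Rightarrow> real" where
  "noisy_oracle N f \<xi> S = (if S \<subseteq> N then \<xi> S * f S else 0)"

text \<open>Adaptive, possibly randomized oracle algorithms as well-founded decision trees: the only access
  to the objective and to the matroid is through the answers handed to the continuations, and
  \<open>Sample\<close> is internal randomness. Local computation is free.\<close>

datatype 'a oracle_algorithm =
    Return "'a set"
  | Value_Query "'a set" "real \<Rightarrow> 'a oracle_algorithm"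
  | Member_Query "'a set" "bool \<Rightarrow> 'a oracle_algorithm"
  | Sample "nat pmf" "nat \<Rightarrow> 'a oracle_algorithm"

text \<open>Joint distribution, over the internal randomness, of the returned set and the number of value
  queries made (repetitions counted), for fixed value oracle \<open>F\<close> and membership oracle \<open>M\<close>.\<close>

primrec run ::
  "('a set \<Rightarrow> real) \<Rightarrow> ('a set \<Rightarrow> bool) \<Rightarrow> 'a oracle_algorithm \<Rightarrow> ('a set \<times> nat) pmf" where
  "run F M (Return S) = return_pmf (S, 0)"
| "run F M (Value_Query X k) = map_pmf (map_prod id Suc) (run F M (k (F X)))"
| "run F M (Member_Query X k) = run F M (k (M X))"
| "run F M (Sample p k) = bind_pmf p (\<lambda>i. run F M (k i))"

definition run_noisy ::
  "'a set \<Rightarrow> 'a set set \<Rightarrow> ('a set \<Rightarrow> real) \<Rightarrow> 'a oracle_algorithm \<Rightarrow> ('a set \<Rightarrow> real) \<Rightarrow>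
   ('a set \<times> nat) pmf" where
  "run_noisy N I f alg \<xi> = run (noisy_oracle N f \<xi>) (\<lambda>S. S \<in> I) alg"

text \<open>Probability over both the noise and the internal randomness. A non-integrable integrand makes
  this 0, so a positive lower bound on it includes measurability of the success probability.\<close>

definition success_prob ::
  "'a set \<Rightarrow> 'a set set \<Rightarrow> ('a set \<Rightarrow> real) \<Rightarrow> real measure \<Rightarrow> real \<Rightarrow> 'a oracle_algorithm \<Rightarrow> real" where
  "success_prob N I f D \<beta> alg =
     (LINT \<xi>|noise_space N D.
        measure_pmf.prob (run_noisy N I f alg \<xi>) {(S, q). approximates I f \<beta> S})"

definition queries_at_most ::
  "'a set \<Rightarrow> 'a set set \<Rightarrow> ('a set \<Rightarrow> real) \<Rightarrow> real measure \<Rightarrow> real \<Rightarrow> 'a oracle_algorithm \<Rightarrow> bool" where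
  "queries_at_most N I f D b alg \<longleftrightarrow>
     (\<forall>\<xi>\<in>space (noise_space N D). \<forall>(S, q)\<in>set_pmf (run_noisy N I f alg \<xi>). real q \<le> b)"

end

theory Submission
  imports Defs "HOL-Real_Asymp.Real_Asymp"
begin

text \<open>The algorithm is a non-oblivious local search over bases. Its potential at a base \<open>S\<close> is a
  weighted average of \<open>f T\<close> over all subsets \<open>T\<close> of \<open>S\<close> of size between \<open>t\<close> and \<open>r - t\<close>. The weights
  are such that an approximate local optimum for single swaps is already a
  \<open>1 - 1/e - O(1/r)\<close> approximation. Because the potential averages over very many sets, it
  can be estimated by sampling subsets of \<open>S\<close>: distinct samples carry independent noise. The same
  random positions are used for every base, so a union bound over the at most \<open>2 ^ n\<close> bases removes
  all dependence on the adaptive course of the search. Failure probabilities of order \<open>2 ^ -n\<close> are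
  obtained from a finite second moment alone by taking the median of \<open>4 n\<close> independent sample
  means. The noise scale \<open>E (max 0 \<xi>)\<close> is unknown to the algorithm but only multiplies the potential,
  which does not affect comparisons.\<close>

section \<open>The potential and its local optima\<close>

text \<open>One draw per set makes repeating a query useless, so no single value of \<open>f\<close>
  can be learnt; only averages over many sets can, and the search has to be steered by such an
  average. Subsets near the empty set or near \<open>S\<close> are few and samples there would often
  coincide, hence the cuts at \<open>t\<close> and \<open>r - t\<close>.

  In the limit the weight has density e^p / p in the sampling rate p. Summed over the swaps of a
  bijection onto an optimal base, submodularity gives the optimum times the integral of e^p over
  [0, 1], e - 1, against \<open>f S\<close> times the boundary value e; the terms in between cancel.
  The quotient is 1 - 1/e. The pole at p = 0 costs a factor ln r.

  With \<open>M\<close> rounds and groups of \<open>M^2\<close> samples, the least gain per round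
  and the estimation error are both of order optimum / \<open>M\<close>, and turning them into a
  loss of value costs a factor r ln r. The queries number at most \<open>M\<close> rounds times r n
  neighbours times 4 n groups times \<open>M^2\<close> samples. With \<open>M\<close> about n^(4/3)
  this is of order n^7, and the loss is of order n^(-1/3) ln n times the optimum, where large n
  \<ge> \<epsilon>^(-4) makes the factor O(\<epsilon>).\<close>

lemma basis_in: "basis I B \<Longrightarrow> B \<in> I" by (simp add: basis_def)

lemma matroid_subset: "matroid N I \<Longrightarrow> A \<in> I \<Longrightarrow> A \<subseteq> N"
  by (auto simp: matroid_def)

lemma matroid_finite: "matroid N I \<Longrightarrow> finite N" "matroid N I \<Longrightarrow> finite I"
  unfolding matroid_def by (blast, meson finite_Pow_iff finite_subset)

lemma basis_card:
  assumes "matroid N I" "basis I B"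
  shows "card B = matroid_rank I"
proof -
  have fin: "finite I" and B: "B \<in> I"
    using matroid_finite(2)[OF assms(1)] basis_in[OF assms(2)] .
  have "Max (card ` I) \<in> card ` I" using fin B by (intro Max_in) auto
  then obtain A where A: "A \<in> I" "card A = matroid_rank I"
    unfolding matroid_rank_def by (metis imageE)
  have "card B \<le> card A" using A B fin by (simp add: matroid_rank_def)
  moreover have "\<not> card B < card A"
  proof
    assume "card B < card A"
    then obtain x where x: "x \<in> A - B" "insert x B \<in> I"
      using assms(1) A B unfolding matroid_def by metis
    then show False using assms(2) unfolding basis_def by blast
  qed
  ultimately show ?thesis using A by simp
qed

lemma extend_to_basis:
  assumes "matroid N I" "A \<in> I"
  shows "\<exists>B. basis I B \<and> A \<subseteq> B"
  using finite_has_maximal2[OF matroid_finite(2)[OF assms(1)] assms(2)]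
  unfolding basis_def by metis

lemma monotone_submodular_mono:
  "monotone_submodular N f \<Longrightarrow> A \<subseteq> B \<Longrightarrow> B \<subseteq> N \<Longrightarrow> f A \<le> f B"
  unfolding monotone_submodular_def by (rule mono_onD[of "Pow N" f]) auto

lemma optimal_basis:
  assumes "matroid N I" "monotone_submodular N f"
  shows "\<exists>B. basis I B \<and> f B = Max (f ` I)"
proof -
  have fin: "finite I" "I \<noteq> {}" using matroid_finite(2)[OF assms(1)] assms(1) by (auto simp: matroid_def)
  then have "Max (f ` I) \<in> f ` I" by (intro Max_in) auto
  then obtain A where A: "A \<in> I" "f A = Max (f ` I)" by (metis imageE)
  obtain B where B: "basis I B" "A \<subseteq> B" using extend_to_basis[OF assms(1) A(1)] by blast
  have "f A \<le> f B"
    using B(2) matroid_subset[OF assms(1) basis_in[OF B(1)]] by (rule monotone_submodular_mono[OF assms(2)])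
  moreover have "f B \<le> Max (f ` I)" using fin basis_in[OF B(1)] by auto
  ultimately show ?thesis using A B by auto
qed

lemma diminishing_returns:
  assumes "monotone_submodular N f" "T \<subseteq> U" "U \<subseteq> N" "b \<in> N"
  shows "f (insert b U) - f U \<le> f (insert b T) - f T"
proof (cases "b \<in> U")
  case True
  have "f T \<le> f (insert b T)"
    using assms by (intro monotone_submodular_mono[OF assms(1)]) auto
  then show ?thesis using True by (simp add: insert_absorb)
next
  case False
  have "f (insert b T \<union> U) + f (insert b T \<inter> U) \<le> f (insert b T) + f U"
    using assms unfolding monotone_submodular_def submodular_on_def
    by (metis insert_subset order_trans)
  moreover have "insert b T \<union> U = insert b U" "insert b T \<inter> U = T" using assms False by auto
  ultimately show ?thesis by simp
qed

lemma sum_marginals_ge: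
  assumes "monotone_submodular N f" "U \<subseteq> N" "A \<subseteq> N" "finite A"
  shows "f A - f U \<le> (\<Sum>b\<in>A. f (insert b U) - f U)"
proof -
  have "f (A \<union> U) - f U \<le> (\<Sum>b\<in>A. f (insert b U) - f U)"
    using assms(4,3)
  proof (induction A rule: finite_induct)
    case (insert x A)
    have "f (insert x (A \<union> U)) - f (A \<union> U) \<le> f (insert x U) - f U"
      using insert assms by (intro diminishing_returns[OF assms(1)]) auto
    with insert show ?case by simp
  qed simp
  moreover have "f A \<le> f (A \<union> U)"
    using assms by (intro monotone_submodular_mono[OF assms(1)]) auto
  ultimately show ?thesis by simp
qed

section \<open>Change of a subset-weighted potential under swaps\<close>

definition potential :: "(nat \<Rightarrow> real) \<Rightarrow> ('a set \<Rightarrow> real) \<Rightarrow> 'a set \<Rightarrow> real" where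
  "potential w f S = (\<Sum>T\<in>Pow S. w (card T) * f T)"

lemma sum_Pow_insert:
  assumes "finite R" "b \<notin> R"
  shows "(\<Sum>T\<in>Pow (insert b R). g T) = (\<Sum>T\<in>Pow R. g T) + (\<Sum>T\<in>Pow R. (g (insert b T) :: real))"
proof -
  have inj: "inj_on (insert b) (Pow R)" by (rule inj_onI) (use assms in \<open>auto simp: set_eq_iff\<close>)
  have "(\<Sum>T\<in>Pow (insert b R). g T) = sum g (Pow R) + sum g (insert b ` Pow R)"
    unfolding Pow_insert using assms by (intro sum.union_disjoint) auto
  then show ?thesis using sum.reindex[OF inj] by simp
qed

text \<open>Double counting: both sides visit each pair of sets \<open>T\<close> and
  \<open>insert x T\<close> in the subset lattice of \<open>R\<close> exactly once.\<close>

lemma sum_Pow_removal: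
  assumes "finite R"
  shows "(\<Sum>U\<in>Pow R. \<Sum>x\<in>U. g x (U - {x})) = (\<Sum>T\<in>Pow R. \<Sum>x\<in>R - T. (g x T :: real))"
proof -
  have "(\<Sum>U\<in>Pow R. \<Sum>x\<in>U. g x (U - {x})) = (\<Sum>(U,x)\<in>Sigma (Pow R) (\<lambda>U. U). g x (U - {x}))"
    using assms finite_subset by (subst sum.Sigma) auto
  also have "\<dots> = (\<Sum>(T,x)\<in>Sigma (Pow R) (\<lambda>T. R - T). g x T)"
    by (rule sum.reindex_bij_witness[where j = "\<lambda>(U,x). (U - {x}, x)" and i = "\<lambda>(T,x). (insert x T, x)"]) auto
  also have "\<dots> = (\<Sum>T\<in>Pow R. \<Sum>x\<in>R - T. g x T)"
    using assms by (subst sum.Sigma) auto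
  finally show ?thesis .
qed

lemma sum_Pow_avoiding:
  assumes "finite R"
  shows "(\<Sum>a\<in>R. \<Sum>T\<in>Pow (R - {a}). g a T) = (\<Sum>T\<in>Pow R. \<Sum>a\<in>R - T. (g a T :: real))"
proof -
  have "(\<Sum>a\<in>R. \<Sum>T\<in>Pow (R - {a}). g a T) = (\<Sum>(a,T)\<in>Sigma R (\<lambda>a. Pow (R - {a})). g a T)"
    using assms by (subst sum.Sigma) auto
  also have "\<dots> = (\<Sum>(T,a)\<in>Sigma (Pow R) (\<lambda>T. R - T). g a T)"
    by (rule sum.reindex_bij_witness[where j = "\<lambda>(a,T). (T,a)" and i = "\<lambda>(T,a). (a,T)"]) auto
  also have "\<dots> = (\<Sum>T\<in>Pow R. \<Sum>a\<in>R - T. g a T)"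
    using assms by (subst sum.Sigma) auto
  finally show ?thesis .
qed

lemma potential_swap:
  assumes "finite S" "a \<in> S" "b \<notin> S - {a}"
  shows "potential w f (insert b (S - {a})) - potential w f S =
    (\<Sum>T\<in>Pow (S - {a}). w (Suc (card T)) * (f (insert b T) - f (insert a T)))"
proof -
  define R where "R = S - {a}"
  have R: "finite R" "a \<notin> R" "b \<notin> R" "S = insert a R" using assms by (auto simp: R_def)
  have c: "card (insert x T) = Suc (card T)" if "x \<notin> R" "T \<in> Pow R" for x T
    using that R(1) finite_subset[of T R] by (subst card_insert_disjoint) auto
  have "potential w f (insert x R) = potential w f R + (\<Sum>T\<in>Pow R. w (Suc (card T)) * f (insert x T))"
    if "x \<notin> R" for x
    unfolding potential_def sum_Pow_insert[OF R(1) that] using c[OF that] by simp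
  from this[OF R(3)] this[OF R(2)] show ?thesis
    unfolding R_def[symmetric] R(4)
    using R(2) by (simp add: right_diff_distrib sum_subtractf)
qed

text \<open>Moves mass down the subset lattice, where the antitone \<open>F\<close> can only grow.
  With r = card S, a set containing \<open>a\<close> passes its mass to \<open>U - {a}\<close>; any
  other \<open>U\<close> splits it evenly among the sets \<open>U - {x}\<close>. A set
  \<open>T\<close> avoiding \<open>a\<close> receives the fraction (card T + 1) / r of
  \<open>w (Suc (card T))\<close> from \<open>insert a T\<close> and 1 / r from each of the r - 1 -
  card T other sets \<open>insert x T\<close>, in total exactly \<open>w (Suc (card T))\<close>. The
  left-hand side does not depend on \<open>a\<close>, so the bounds of all swaps can be summed
  against one family of sets \<open>U\<close>.\<close>

lemma potential_swap_gain_part: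
  fixes w :: "nat \<Rightarrow> real"
  assumes "finite S" "a \<in> S" "\<And>k. 0 \<le> w k"
    and F: "\<And>T U. T \<subseteq> U \<Longrightarrow> U \<subseteq> S \<Longrightarrow> F U \<le> F T"
  shows "(\<Sum>U\<in>Pow S. (w (card U) * card U / card S) * F U)
    \<le> (\<Sum>T\<in>Pow (S - {a}). w (Suc (card T)) * (F T :: real))"
proof -
  define R where "R = S - {a}"
  define r where "r = real (card S)"
  have R: "finite R" "a \<notin> R" "S = insert a R" using assms by (auto simp: R_def)
  have r: "r > 0" "real (card R) = r - 1" using assms R by (auto simp: r_def card_gt_0_iff)
  have fT: "finite T" if "T \<in> Pow R" for T using that R(1) finite_subset by auto
  have "(\<Sum>U\<in>Pow S. (w (card U) * card U / r) * F U) =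
      (\<Sum>U\<in>Pow R. (w (card U) * card U / r) * F U)
      + (\<Sum>T\<in>Pow R. (w (Suc (card T)) * (card T + 1) / r) * F (insert a T))"
    unfolding R(3) sum_Pow_insert[OF R(1,2)] using fT R(2)
    by (intro arg_cong2[where f="(+)"] sum.cong refl) (auto simp: card_insert_if subset_iff)
  also have "(\<Sum>U\<in>Pow R. (w (card U) * card U / r) * F U) =
      (\<Sum>U\<in>Pow R. \<Sum>x\<in>U. w (card U) / r * F U)" by simp (simp add: mult_ac)
  also have "\<dots> \<le> (\<Sum>U\<in>Pow R. \<Sum>x\<in>U. w (Suc (card (U - {x}))) / r * F (U - {x}))"
  proof (intro sum_mono)
    fix U x assume "U \<in> Pow R" "x \<in> U"
    then have "Suc (card (U - {x})) = card U" using fT by (metis card_Suc_Diff1)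
    moreover have "F U \<le> F (U - {x})" using \<open>U \<in> Pow R\<close> R by (intro F) auto
    ultimately show "w (card U) / r * F U \<le> w (Suc (card (U - {x}))) / r * F (U - {x})"
      using assms(3) r by (simp add: mult_left_mono divide_right_mono)
  qed
  also have "\<dots> = (\<Sum>T\<in>Pow R. \<Sum>x\<in>R - T. w (Suc (card T)) / r * F T)"
    by (rule sum_Pow_removal[OF R(1), of "\<lambda>x T. w (Suc (card T)) / r * F T"])
  also have "\<dots> = (\<Sum>T\<in>Pow R. (r - 1 - card T) * (w (Suc (card T)) / r * F T))"
  proof (intro sum.cong refl)
    fix T assume T: "T \<in> Pow R"
    then have "real (card (R - T)) = r - 1 - card T"
      using R(1) r fT by (simp add: card_Diff_subset card_mono of_nat_diff)
    then show "(\<Sum>x\<in>R - T. w (Suc (card T)) / r * F T) = (r - 1 - card T) * (w (Suc (card T)) / r * F T)"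
      by simp
  qed
  also have "(\<Sum>T\<in>Pow R. (w (Suc (card T)) * (card T + 1) / r) * F (insert a T))
      \<le> (\<Sum>T\<in>Pow R. (w (Suc (card T)) * (card T + 1) / r) * F T)"
    using R r assms(3) by (intro sum_mono mult_left_mono F) auto
  finally have "(\<Sum>U\<in>Pow S. (w (card U) * card U / r) * F U) \<le>
     (\<Sum>T\<in>Pow R. (r - 1 - card T) * (w (Suc (card T)) / r * F T)) +
     (\<Sum>T\<in>Pow R. (w (Suc (card T)) * (card T + 1) / r) * F T)" by simp
  also have "\<dots> = (\<Sum>T\<in>Pow R. w (Suc (card T)) * F T)"
    unfolding sum.distrib[symmetric] using r by (intro sum.cong refl) (simp add: field_simps)
  finally show ?thesis by (simp add: r_def R_def)
qed

text \<open>Each \<open>U\<close> occurs card U times as \<open>insert a T\<close> and card S - card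
  U times as \<open>T\<close>. The total loss is thus an exact linear form in the values of
  \<open>f\<close>, whose coefficients can be controlled by the choice of \<open>w\<close>.\<close>

lemma potential_swap_loss_part:
  fixes w :: "nat \<Rightarrow> real"
  assumes "finite S"
  shows "(\<Sum>a\<in>S. \<Sum>T\<in>Pow (S - {a}). w (Suc (card T)) * (f (insert a T) - f T)) =
    (\<Sum>U\<in>Pow S. (card U * w (card U) - (real (card S) - card U) * w (Suc (card U))) * (f U :: real))"
proof -
  have fT: "finite T" if "T \<in> Pow S" for T using that assms finite_subset by auto
  have "(\<Sum>a\<in>S. \<Sum>T\<in>Pow (S - {a}). w (Suc (card T)) * (f (insert a T) - f T)) =
     (\<Sum>T\<in>Pow S. \<Sum>a\<in>S - T. w (Suc (card T)) * (f (insert a T) - f T))"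
    by (rule sum_Pow_avoiding[OF assms])
  also have "\<dots> = (\<Sum>T\<in>Pow S. \<Sum>a\<in>S - T. w (Suc (card T)) * f (insert a T))
      - (\<Sum>T\<in>Pow S. \<Sum>a\<in>S - T. w (Suc (card T)) * f T)"
    by (simp add: right_diff_distrib sum_subtractf)
  also have "(\<Sum>T\<in>Pow S. \<Sum>a\<in>S - T. w (Suc (card T)) * f (insert a T)) =
     (\<Sum>U\<in>Pow S. \<Sum>a\<in>U. w (Suc (card (U - {a}))) * f (insert a (U - {a})))"
    by (rule sum_Pow_removal[OF assms, symmetric])
  also have "\<dots> = (\<Sum>U\<in>Pow S. \<Sum>a\<in>U. w (card U) * f U)"
  proof (intro sum.cong refl)
    fix U a assume "U \<in> Pow S" "a \<in> U"
    then have "Suc (card (U - {a})) = card U" "insert a (U - {a}) = U"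
      using fT by (metis card_Suc_Diff1, auto)
    then show "w (Suc (card (U - {a}))) * f (insert a (U - {a})) = w (card U) * f U" by simp
  qed
  also have "(\<Sum>T\<in>Pow S. \<Sum>a\<in>S - T. w (Suc (card T)) * f T) =
     (\<Sum>T\<in>Pow S. (real (card S) - card T) * w (Suc (card T)) * f T)"
    using assms fT by (intro sum.cong refl) (simp add: card_Diff_subset card_mono of_nat_diff)
  also have "(\<Sum>U\<in>Pow S. \<Sum>a\<in>U. w (card U) * f U) - \<dots> =
     (\<Sum>U\<in>Pow S. (card U * w (card U) - (real (card S) - card U) * w (Suc (card U))) * f U)"
    by (simp add: sum_subtractf[symmetric] algebra_simps)
  finally show ?thesis .
qed

text \<open>A swap changes the potential by marginals of \<open>\<sigma> a\<close> minus marginals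
  of \<open>a\<close>, over the same sets \<open>T\<close>. The former are bounded below through
  submodularity by \<open>f Opt - f U\<close>; the latter are evaluated exactly. The second
  assumption on \<open>\<sigma>\<close> leaves either a genuine exchange or the trivial one with
  \<sigma> a = a, the two cases covered by \<open>potential_swap\<close>.\<close>

lemma potential_local_search:
  fixes w :: "nat \<Rightarrow> real"
  assumes f: "monotone_submodular N f" and N: "finite N" "S \<subseteq> N" "Opt \<subseteq> N"
    and w: "\<And>k. 0 \<le> w k"
    and \<sigma>: "bij_betw \<sigma> S Opt" "\<And>a. a \<in> S \<Longrightarrow> \<sigma> a \<notin> S - {a}"
  shows "(\<Sum>U\<in>Pow S. w (card U) * card U / card S) * f Opt
      - (\<Sum>U\<in>Pow S. (w (card U) * card U / card S + card U * w (card U)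
           - (real (card S) - card U) * w (Suc (card U))) * f U)
    \<le> (\<Sum>a\<in>S. potential w f (insert (\<sigma> a) (S - {a})) - potential w f S)"
proof -
  have fS: "finite S" "finite Opt" using N finite_subset by blast+
  define \<kappa> where "\<kappa> U = w (card U) * card U / card S" for U :: "'a set"
  have \<kappa>: "0 \<le> \<kappa> U" for U using w by (simp add: \<kappa>_def)
  have "(\<Sum>U\<in>Pow S. \<kappa> U * (f Opt - f U)) \<le> (\<Sum>U\<in>Pow S. \<kappa> U * (\<Sum>b\<in>Opt. f (insert b U) - f U))"
    using N fS by (intro sum_mono mult_left_mono \<kappa> sum_marginals_ge[OF f]) auto
  also have "\<dots> = (\<Sum>U\<in>Pow S. \<kappa> U * (\<Sum>a\<in>S. f (insert (\<sigma> a) U) - f U))"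
    by (subst sum.reindex_bij_betw[OF \<sigma>(1), symmetric]) simp
  also have "\<dots> = (\<Sum>a\<in>S. \<Sum>U\<in>Pow S. \<kappa> U * (f (insert (\<sigma> a) U) - f U))"
    unfolding sum_distrib_left by (rule sum.swap)
  also have "\<dots> \<le> (\<Sum>a\<in>S. \<Sum>T\<in>Pow (S - {a}). w (Suc (card T)) * (f (insert (\<sigma> a) T) - f T))"
    unfolding \<kappa>_def
  proof (rule sum_mono)
    fix a assume a: "a \<in> S"
    then have "\<sigma> a \<in> N" using \<sigma>(1) N by (auto simp: bij_betw_def)
    then show "(\<Sum>U\<in>Pow S. w (card U) * card U / card S * (f (insert (\<sigma> a) U) - f U))
        \<le> (\<Sum>T\<in>Pow (S - {a}). w (Suc (card T)) * (f (insert (\<sigma> a) T) - f T))"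
      using N by (intro potential_swap_gain_part[OF fS(1) a w] diminishing_returns[OF f]) auto
  qed
  finally have 1: "(\<Sum>U\<in>Pow S. \<kappa> U * (f Opt - f U)) \<le>
    (\<Sum>a\<in>S. \<Sum>T\<in>Pow (S - {a}). w (Suc (card T)) * (f (insert (\<sigma> a) T) - f T))" .
  have "(\<Sum>a\<in>S. potential w f (insert (\<sigma> a) (S - {a})) - potential w f S) =
    (\<Sum>a\<in>S. \<Sum>T\<in>Pow (S - {a}). w (Suc (card T)) * (f (insert (\<sigma> a) T) - f (insert a T)))"
    using \<sigma>(2) fS by (intro sum.cong refl potential_swap) auto
  also have "\<dots> = (\<Sum>a\<in>S. \<Sum>T\<in>Pow (S - {a}). w (Suc (card T)) * (f (insert (\<sigma> a) T) - f T))
    - (\<Sum>a\<in>S. \<Sum>T\<in>Pow (S - {a}). w (Suc (card T)) * (f (insert a T) - f T))"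
    by (simp add: sum_subtractf[symmetric] algebra_simps)
  also have "\<dots> \<ge> (\<Sum>U\<in>Pow S. \<kappa> U * (f Opt - f U)) -
     (\<Sum>U\<in>Pow S. (card U * w (card U) - (real (card S) - card U) * w (Suc (card U))) * f U)"
    using 1 potential_swap_loss_part[OF fS(1), of w f] by simp
  also have "(\<Sum>U\<in>Pow S. \<kappa> U * (f Opt - f U)) -
     (\<Sum>U\<in>Pow S. (card U * w (card U) - (real (card S) - card U) * w (Suc (card U))) * f U)
   = (\<Sum>U\<in>Pow S. \<kappa> U) * f Opt - (\<Sum>U\<in>Pow S. (\<kappa> U + card U * w (card U)
           - (real (card S) - card U) * w (Suc (card U))) * f U)"
    unfolding sum_distrib_right sum_subtractf[symmetric]
    by (rule sum.cong) (simp_all add: algebra_simps)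
  finally show ?thesis unfolding \<kappa>_def .
qed

lemma sum_Pow_card:
  fixes g :: "nat \<Rightarrow> real"
  assumes "finite S"
  shows "(\<Sum>U\<in>Pow S. g (card U)) = (\<Sum>k\<le>card S. real (card S choose k) * g k)"
proof -
  have "(\<Sum>U\<in>Pow S. g (card U)) = (\<Sum>k\<le>card S. \<Sum>U\<in>{U \<in> Pow S. card U = k}. g (card U))"
    using assms by (intro sum.group[symmetric]) (auto intro: card_mono)
  also have "\<dots> = (\<Sum>k\<le>card S. real (card S choose k) * g k)"
    using n_subsets[OF assms] by (intro sum.cong refl) auto
  finally show ?thesis .
qed

section \<open>Exponential weights and the ratio 1 - 1/e\<close>

definition growth :: "nat \<Rightarrow> nat \<Rightarrow> real" where
  "growth r k = (1 + 1 / real r) ^ k"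

text \<open>The weights discretise the density \<open>e\<^sup>p / p\<close> on sampling rates \<open>p = k / r\<close>, trimmed by \<open>t\<close> at both
  ends. They are chosen so that in \<open>potential_local_search\<close> the coefficients of all \<open>f U\<close> with
  \<open>t \<le> card U < r - t\<close> cancel, see \<open>weight_telescopes\<close>.\<close>

definition weight_sum :: "nat \<Rightarrow> nat \<Rightarrow> real" where
  "weight_sum t r = (\<Sum>k\<in>{t..r - t}. real r / real k * growth r k)"

definition weight :: "nat \<Rightarrow> nat \<Rightarrow> nat \<Rightarrow> real" where
  "weight t r k = (if t \<le> k \<and> k \<le> r - t
     then real r / real k * growth r k / (weight_sum t r * real (r choose k)) else 0)"

lemma growth_pos: "growth r k > 0"
  by (auto simp: growth_def intro!: zero_less_power add_pos_nonneg)

lemma growth_ge_1: "growth r k \<ge> 1"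
  by (simp add: growth_def one_le_power)

text \<open>Discrete form of y' = y with step 1 / r. Both telescoping arguments rest on it: the one
  for the mass multiplying \<open>f Opt\<close> and the one for the loss coefficients.\<close>

lemma growth_Suc: "r > 0 \<Longrightarrow> real r * growth r (Suc k) = (real r + 1) * growth r k"
  by (simp add: growth_def field_simps)

lemma weight_sum_pos:
  assumes "1 \<le> t" "2 * t \<le> r"
  shows "weight_sum t r > 0"
  unfolding weight_sum_def using assms growth_pos by (intro sum_pos mult_pos_pos divide_pos_pos) auto

lemma weight_nonneg: "weight t r k \<ge> 0"
  unfolding weight_def weight_sum_def
  by (auto intro!: divide_nonneg_nonneg mult_nonneg_nonneg sum_nonneg simp: growth_pos less_imp_le)

lemma sum_weight_trim:
  fixes g :: "nat \<Rightarrow> real"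
  assumes "1 \<le> t" "2 * t \<le> r"
  shows "(\<Sum>k\<le>r. real (r choose k) * (weight t r k * g k)) =
    (\<Sum>k\<in>{t..r - t}. real r / real k * growth r k * g k) / weight_sum t r"
proof -
  have "(\<Sum>k\<le>r. real (r choose k) * (weight t r k * g k)) =
     (\<Sum>k\<in>{t..r - t}. real (r choose k) * (weight t r k * g k))"
    by (rule sum.mono_neutral_right) (auto simp: weight_def)
  also have "\<dots> = (\<Sum>k\<in>{t..r - t}. real r / real k * growth r k * g k / weight_sum t r)"
    by (intro sum.cong refl) (auto simp: weight_def)
  finally show ?thesis by (simp add: sum_divide_distrib)
qed

lemma sum_weight:
  assumes "1 \<le> t" "2 * t \<le> r" "finite S" "card S = r"
  shows "(\<Sum>U\<in>Pow S. weight t r (card U)) = 1"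
  using sum_weight_trim[OF assms(1,2), of "\<lambda>_. 1"] weight_sum_pos[OF assms(1,2)] assms(4)
  by (subst sum_Pow_card[OF assms(3)]) (simp add: weight_sum_def)

lemma sum_weight_card:
  assumes "1 \<le> t" "2 * t \<le> r" "finite S" "card S = r"
  shows "(\<Sum>U\<in>Pow S. weight t r (card U) * card U / card S) =
    real r * (growth r (Suc (r - t)) - growth r t) / weight_sum t r"
proof -
  have r: "r > 0" using assms by simp
  have "(\<Sum>U\<in>Pow S. weight t r (card U) * card U / card S) =
     (\<Sum>k\<le>r. real (r choose k) * (weight t r k * (k / r)))"
    using sum_Pow_card[OF assms(3), of "\<lambda>k. weight t r k * (k / r)"] assms(4) by simp
  also have "\<dots> = (\<Sum>k\<in>{t..r - t}. real r / real k * growth r k * (k / r)) / weight_sum t r"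
    by (rule sum_weight_trim[OF assms(1,2)])
  also have "(\<Sum>k\<in>{t..r - t}. real r / real k * growth r k * (k / r)) = 
     (\<Sum>k\<in>{t..r - t}. real r * growth r (Suc k) - real r * growth r k)"
  proof (intro sum.cong refl)
    fix k assume "k \<in> {t..r - t}"
    then show "real r / real k * growth r k * (k / r) = real r * growth r (Suc k) - real r * growth r k"
      unfolding growth_Suc[OF r] using assms by (simp add: field_simps)
  qed
  also have "\<dots> = real r * growth r (Suc (r - t)) - real r * growth r t"
    using assms by (intro sum_Suc_diff) auto
  finally show ?thesis by (simp add: right_diff_distrib)
qed

lemma weight_telescopes:
  assumes "1 \<le> t" "2 * t \<le> r" "k \<le> r"
  shows "weight t r k * k / r + k * weight t r k - (real r - k) * weight t r (Suc k)
    \<le> (if k = r - t then real r * growth r (Suc k) / (weight_sum t r * (r choose k)) else 0)"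
proof -
  let ?W = "weight_sum t r"
  have W: "?W > 0" by (rule weight_sum_pos[OF assms(1,2)])
  have r: "r > 0" using assms by simp
  have ch: "real (Suc k) * (r choose Suc k) = (real r - k) * (r choose k)"
  proof -
    have "Suc k * (r choose Suc k) = (r - k) * (r choose k)"
      by (simp only: binomial_absorption binomial_absorb_comp)
    then have "real (Suc k) * real (r choose Suc k) = real (r - k) * real (r choose k)"
      by (simp only: of_nat_mult[symmetric])
    then show ?thesis using assms(3) by (simp only: of_nat_diff)
  qed
  have ck: "real (r choose k) > 0" using assms(3) by simp
  have 1: "k * weight t r k = real r * growth r k / (?W * (r choose k))" if "t \<le> k" "k \<le> r - t"
    using that assms(1) by (simp add: weight_def field_simps)
  have 2: "(real r - k) * weight t r (Suc k) = real r * growth r (Suc k) / (?W * (r choose k))"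
    if "t \<le> Suc k" "Suc k \<le> r - t"
  proof -
    have ck': "real (r choose Suc k) > 0" using that assms by simp
    have rk: "real r - k > 0" using that assms by (simp add: of_nat_less_iff)
    have "(real r - k) * weight t r (Suc k) = (real r - k) * real r * growth r (Suc k) / (?W * (real (Suc k) * (r choose Suc k)))"
      using that by (simp add: weight_def mult_ac)
    also have "\<dots> = real r * growth r (Suc k) / (?W * (r choose k))"
      unfolding ch using rk by simp
    finally show ?thesis .
  qed
  have nonneg: "(real r - k) * weight t r (Suc k) \<ge> 0"
    using weight_nonneg assms(3) by (intro mult_nonneg_nonneg) auto
  consider "t \<le> k" "k < r - t" | "k = r - t" | "k < t" | "k > r - t" by linarith
  then show ?thesis
  proof cases
    case 1
    then have "weight t r k * k / r + k * weight t r k - (real r - k) * weight t r (Suc k)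
       = (growth r k + real r * growth r k - real r * growth r (Suc k)) / (?W * (r choose k))"
      using \<open>_ \<Longrightarrow> _ \<Longrightarrow> k * weight t r k = _\<close> 2 r
      by (simp add: mult.commute[of "weight t r k"] add_divide_distrib diff_divide_distrib)
    also have "\<dots> = 0" unfolding growth_Suc[OF r] by (simp add: algebra_simps)
    finally show ?thesis using 1 by simp
  next
    \<comment> \<open>At the upper cut the level r - t + 1, which would compensate, has weight 0;
      this leaves the boundary term.\<close>
    case 2
    have "weight t r (Suc k) = 0" using 2 by (simp add: weight_def)
    moreover have "k * weight t r k = real r * growth r k / (?W * (r choose k))"
      using 1 2 assms by simp
    ultimately have "weight t r k * k / r + k * weight t r k - (real r - k) * weight t r (Suc k)
       = (growth r k + real r * growth r k) / (?W * (r choose k))"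
      using r by (simp add: mult.commute[of "weight t r k"] add_divide_distrib)
    also have "\<dots> = real r * growth r (Suc k) / (?W * (r choose k))"
      unfolding growth_Suc[OF r] by (simp add: algebra_simps)
    finally show ?thesis using 2 by simp
  next
    \<comment> \<open>For k = t - 1 the next level already has positive weight, so the coefficient
      is negative rather than 0.\<close>
    case 3
    then have "weight t r k = 0" by (simp add: weight_def)
    then show ?thesis using nonneg 3 assms by auto
  next
    case 4
    then show ?thesis by (simp add: weight_def)
  qed
qed

text \<open>Up to nonpositive terms only the level r - t survives, and there
  \<open>f U \<le> f S\<close> by monotonicity. This level supplies the whole coefficient of
  \<open>f S\<close>.\<close>

lemma weight_loss_sum:
  assumes "monotone_submodular N f" "finite S" "S \<subseteq> N" "1 \<le> t" "2 * t \<le> r" "card S = r"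
  shows "(\<Sum>U\<in>Pow S. (weight t r (card U) * card U / card S + card U * weight t r (card U)
           - (real (card S) - card U) * weight t r (Suc (card U))) * f U)
     \<le> real r * growth r (Suc (r - t)) / weight_sum t r * f S"
proof -
  let ?W = "weight_sum t r"
  let ?b = "\<lambda>k. (if k = r - t then real r * growth r (Suc k) / (?W * (r choose k)) else 0)"
  have W: "?W > 0" by (rule weight_sum_pos[OF assms(4,5)])
  have b: "?b k \<ge> 0" for k using W growth_pos[of r "Suc k"]
    by (auto intro!: divide_nonneg_nonneg mult_nonneg_nonneg simp: less_imp_le)
  have f0: "0 \<le> f U" if "U \<subseteq> S" for U using that assms(1,3) by (auto simp: monotone_submodular_def)
  have cU: "card U \<le> r" if "U \<subseteq> S" for U using card_mono[OF assms(2) that] assms(6) by simp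
  have "(\<Sum>U\<in>Pow S. (weight t r (card U) * card U / card S + card U * weight t r (card U)
           - (real (card S) - card U) * weight t r (Suc (card U))) * f U)
      \<le> (\<Sum>U\<in>Pow S. ?b (card U) * f U)"
    unfolding assms(6) using cU f0
    by (intro sum_mono mult_right_mono weight_telescopes[OF assms(4,5)]) auto
  also have "\<dots> \<le> (\<Sum>U\<in>Pow S. ?b (card U) * f S)"
    using assms(3) b by (intro sum_mono mult_left_mono monotone_submodular_mono[OF assms(1)]) auto
  also have "\<dots> = (\<Sum>U\<in>Pow S. ?b (card U)) * f S" by (simp only: sum_distrib_right)
  also have "(\<Sum>U\<in>Pow S. ?b (card U)) = (\<Sum>k\<le>r. real (r choose k) * ?b k)"
    by (subst sum_Pow_card[OF assms(2)]) (simp only: assms(6))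
  also have "\<dots> = (\<Sum>k\<in>{r - t}. real (r choose k) * ?b k)"
    by (rule sum.mono_neutral_right) auto
  also have "\<dots> = real r * growth r (Suc (r - t)) / ?W" by simp
  finally show ?thesis .
qed

lemma growth_le_exp: "k \<le> r \<Longrightarrow> growth r k \<le> exp 1"
proof -
  assume k: "k \<le> r"
  have "growth r k \<le> exp (1 / real r) ^ k"
    unfolding growth_def by (intro power_mono) (auto simp: exp_ge_add_one_self)
  also have "\<dots> = exp (real k / real r)" by (simp add: exp_of_nat_mult[symmetric])
  also have "\<dots> \<le> exp 1" using k by (cases "r = 0") (auto simp: field_simps)
  finally show ?thesis .
qed

lemma harm_le_one_plus_ln:
  assumes "n > 0"
  shows "harm n \<le> 1 + ln (real n)"
proof -
  have "harm (Suc (n - 1)) - ln (real (Suc (n - 1))) \<le> harm (Suc 0) - ln (real (Suc 0))"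
    using decseq_harm_diff_ln unfolding decseq_def by blast
  then show ?thesis using assms by (simp add: harm_def)
qed

lemma weight_sum_le:
  assumes "1 \<le> t" "2 * t \<le> r"
  shows "weight_sum t r \<le> exp 1 * real r * (1 + ln (real r))"
proof -
  have "weight_sum t r \<le> (\<Sum>k\<in>{t..r - t}. real r / real k * exp 1)"
    unfolding weight_sum_def by (intro sum_mono mult_left_mono growth_le_exp) auto
  also have "\<dots> \<le> (\<Sum>k\<in>{1..r}. real r / real k * exp 1)"
    using assms by (intro sum_mono2) auto
  also have "\<dots> = exp 1 * real r * harm r"
    by (simp add: harm_def sum_distrib_left divide_inverse mult_ac)
  also have "\<dots> \<le> exp 1 * real r * (1 + ln (real r))"
    using harm_le_one_plus_ln[of r] assms by (intro mult_left_mono) auto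
  finally show ?thesis .
qed

text \<open>Chord of the convex function (1 + x)^m over [0, 1]. The slope is exponential in m, which
  is harmless because m = 2 t for a trimming t that stays constant in the end.\<close>

lemma one_plus_power_le:
  fixes x :: real
  assumes "0 \<le> x" "x \<le> 1"
  shows "(1 + x) ^ m \<le> 1 + (2 ^ m - 1) * x"
proof (induction m)
  case (Suc m)
  have "(1 + x) ^ Suc m \<le> (1 + x) * (1 + (2 ^ m - 1) * x)" using Suc assms by simp
  also have "\<dots> = 1 + 2 ^ m * x + ((2 ^ m - 1) * x) * x" by (simp add: algebra_simps)
  also have "((2 ^ m - 1) * x) * x \<le> ((2 ^ m - 1) * x) * 1"
    using assms by (intro mult_left_mono mult_nonneg_nonneg) (auto simp: one_le_power)
  finally show ?case by (simp add: algebra_simps)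
qed simp

text \<open>As \<open>growth\<close> is a power, the quotient equals
  \<open>growth r (2 * t) / growth r (Suc r)\<close>: the cuts affect only the numerator, and the
  denominator supplies 1/e.\<close>

lemma growth_ratio_le:
  assumes "1 \<le> t" "2 * t \<le> r"
  shows "growth r t / growth r (Suc (r - t)) \<le> 1 / exp 1 + 4 ^ t / real r"
proof -
  have r: "r > 0" using assms by simp
  have "growth r (2 * t) * growth r (Suc (r - t)) = growth r t * growth r (Suc r)"
    unfolding growth_def power_add[symmetric] using assms by simp
  then have "growth r t / growth r (Suc (r - t)) = growth r (2 * t) * (1 / growth r (Suc r))"
    using growth_pos[of r "Suc r"] growth_pos[of r "Suc (r - t)"] by (simp add: field_simps)
  \<comment> \<open>1 / (1 + 1 / r) is 1 - 1 / (r + 1), so exponent r + 1 gives a value of at most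
    1/e without error term. Exponent r would stay above 1/e.\<close>
  also have "1 / growth r (Suc r) = (1 + - 1 / real (Suc r)) ^ Suc r"
    using r unfolding growth_def power_one_over[symmetric]
    by (simp add: field_simps del: power_Suc)
  also have "\<dots> \<le> exp (- 1)"
    by (rule exp_ge_one_plus_x_over_n_power_n) auto
  also have "growth r (2 * t) \<le> 1 + (2 ^ (2 * t) - 1) * (1 / real r)"
    unfolding growth_def using r by (intro one_plus_power_le) auto
  also have "\<dots> \<le> 1 + 4 ^ t * (1 / real r)"
    by (intro add_left_mono mult_right_mono) (auto simp: power_mult)
  also have "(1 + 4 ^ t * (1 / real r)) * exp (- 1) = 1 / exp 1 + (4 ^ t / real r) * exp (-1)"
    by (simp add: exp_minus field_simps)
  also have "(4 ^ t / real r) * exp (-1) \<le> (4 ^ t / real r) * 1"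
    by (intro mult_left_mono) auto
  finally show ?thesis using growth_pos[of r "2 * t"] by (simp add: mult_right_mono mult_left_mono)
qed

text \<open>The choice b = a is allowed and makes a nonempty base its own neighbour, so a best swap
  exists and never has negative estimated gain. A choice of b in \<open>S - {a}\<close> gives a set
  too small to be a base.\<close>

definition neighbours :: "'a set \<Rightarrow> 'a set set \<Rightarrow> 'a set \<Rightarrow> 'a set set" where
  "neighbours N I S = {B. basis I B \<and> (\<exists>a\<in>S. \<exists>b\<in>N. B = insert b (S - {a}))}"

text \<open>Strong base-orderability on singletons yields one bijection all of whose single
  exchanges are bases, hence neighbours. Dividing the summed swap inequality by
  \<open>growth r (Suc (r - t))\<close> isolates \<open>f S\<close>. The normalisation
  \<open>weight_sum t r\<close>, of order r ln r, is the price for turning a potential gain into a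
  difference of values of \<open>f\<close>.\<close>

lemma potential_approx_local_optimum:
  assumes m: "matroid N I" "strongly_base_orderable I" "matroid_rank I = r"
    and f: "monotone_submodular N f" and t: "1 \<le> t" "2 * t \<le> r"
    and S: "basis I S" and Opt: "basis I Opt"
    and g: "0 \<le> g" "\<And>B. B \<in> neighbours N I S \<Longrightarrow>
      potential (weight t r) f B - potential (weight t r) f S \<le> g"
  shows "(1 - 1 / exp 1 - 4 ^ t / real r) * f Opt - f S \<le> exp 1 * real r * (1 + ln (real r)) * g"
proof -
  obtain \<sigma> where bij: "bij_betw \<sigma> S Opt"
    and ex: "\<And>X. X \<subseteq> S \<Longrightarrow> basis I ((S - X) \<union> \<sigma> ` X)"
    using m(2)[unfolded strongly_base_orderable_def, rule_format, OF conjI[OF S Opt]] by blast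
  have N: "S \<subseteq> N" "Opt \<subseteq> N" using matroid_subset[OF m(1) basis_in] S Opt by simp_all
  have finN: "finite N" using matroid_finite(1)[OF m(1)] .
  have fin: "finite S" using N finN finite_subset by blast
  have cS: "card S = r" using basis_card[OF m(1) S] m(3) by simp
  have r: "r > 0" using t by simp
  have ba: "basis I (insert (\<sigma> a) (S - {a}))" if "a \<in> S" for a
    using ex[of "{a}"] that by simp
  \<comment> \<open>Otherwise the exchange would lose an element and could not be a base.\<close>
  have ni: "\<sigma> a \<notin> S - {a}" if "a \<in> S" for a
  proof
    assume "\<sigma> a \<in> S - {a}"
    then have "card (insert (\<sigma> a) (S - {a})) = card (S - {a})" by (simp add: insert_absorb)
    then have "r = r - 1" using basis_card[OF m(1) ba[OF that]] m(3) cS that fin by simp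
    then show False using r by simp
  qed
  let ?W = "weight_sum t r" and ?v = "growth r (Suc (r - t))"
  have W: "?W > 0" by (rule weight_sum_pos[OF t])
  have v: "?v \<ge> 1" by (rule growth_ge_1)
  have O0: "0 \<le> f Opt" using f N by (simp add: monotone_submodular_def)
  have "real r * (?v - growth r t) / ?W * f Opt - real r * ?v / ?W * f S
    \<le> (\<Sum>a\<in>S. potential (weight t r) f (insert (\<sigma> a) (S - {a})) - potential (weight t r) f S)"
    using potential_local_search[where w = "weight t r", OF f finN N weight_nonneg bij ni]
      sum_weight_card[OF t fin cS]
      weight_loss_sum[OF f fin N(1) t cS] by simp
  also have "\<dots> \<le> (\<Sum>a\<in>S. g)"
  proof (intro sum_mono g(2))
    fix a assume a: "a \<in> S"
    then have "\<sigma> a \<in> N" using bij N by (auto simp: bij_betw_def)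
    then show "insert (\<sigma> a) (S - {a}) \<in> neighbours N I S"
      using ba[OF a] a unfolding neighbours_def by blast
  qed
  also have "\<dots> = real r * g" using cS by simp
  also have "real r * (?v - growth r t) / ?W * f Opt - real r * ?v / ?W * f S =
      real r * ((?v - growth r t) * f Opt - ?v * f S) / ?W"
    by (simp add: algebra_simps diff_divide_distrib add_divide_distrib)
  finally have "real r * ((?v - growth r t) * f Opt - ?v * f S) \<le> real r * (?W * g)"
    using W by (simp only: pos_divide_le_eq mult_ac)
  then have "(?v - growth r t) * f Opt - ?v * f S \<le> ?W * g"
    using r by (simp only: mult_le_cancel_left_pos of_nat_0_less_iff)
  then have "((?v - growth r t) * f Opt - ?v * f S) / ?v \<le> ?W * g / ?v"
    using v by (intro divide_right_mono) auto
  also have "((?v - growth r t) * f Opt - ?v * f S) / ?v = (1 - growth r t / ?v) * f Opt - f S"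
    using v by (simp add: field_simps)
  also have "?W * g / ?v \<le> ?W * g / 1" using v W g(1) by (intro divide_left_mono) auto
  also have "?W * g / 1 = ?W * g" by simp
  also have "?W * g \<le> exp 1 * real r * (1 + ln (real r)) * g"
    using weight_sum_le[OF t] g(1) by (rule mult_right_mono)
  finally have "(1 - growth r t / ?v) * f Opt - f S \<le> exp 1 * real r * (1 + ln (real r)) * g" .
  moreover have "(1 - 1 / exp 1 - 4 ^ t / real r) * f Opt \<le> (1 - growth r t / ?v) * f Opt"
    using growth_ratio_le[OF t] O0 by (intro mult_right_mono) auto
  ultimately show ?thesis by linarith
qed

section \<open>Moments of the noise\<close>

lemma abel_partial_sum_bound:
  fixes a b :: "nat \<Rightarrow> real"
  assumes "decseq b" "\<And>j. 0 \<le> b j" "\<And>n. \<bar>\<Sum>j<n. a j\<bar> \<le> M"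
  shows "\<bar>\<Sum>j<n. a j * b j\<bar> \<le> M * b 0"
proof -
  define A where "A n = (\<Sum>j<n. a j)" for n
  have eq: "(\<Sum>j<n. a j * b j) = (\<Sum>j<n. A (Suc j) * (b j - b (Suc j))) + A n * b n"
    by (induction n) (auto simp: A_def algebra_simps)
  have d: "0 \<le> b j - b (Suc j)" for j using assms(1) by (simp add: decseq_SucD)
  have "\<bar>\<Sum>j<n. a j * b j\<bar> \<le> (\<Sum>j<n. \<bar>A (Suc j)\<bar> * (b j - b (Suc j))) + \<bar>A n\<bar> * b n"
    unfolding eq using d assms(2)
    by (intro order_trans[OF abs_triangle_ineq] add_mono order_trans[OF sum_abs])
       (auto simp: abs_mult intro!: sum_mono)
  also have "\<dots> \<le> (\<Sum>j<n. M * (b j - b (Suc j))) + M * b n"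
    using d assms(2) assms(3)[folded A_def] by (intro add_mono sum_mono mult_right_mono)
  also have "\<dots> = M * b 0"
    unfolding sum_distrib_left[symmetric] by (subst sum_lessThan_telescope') (simp add: algebra_simps)
  finally show ?thesis .
qed

text \<open>Abel summation against the convergent series at a fixed point \<open>y\<close> makes the tail of a
  power series with decreasing real exponents of the order of its first term.\<close>

lemma power_series_tail_bound:
  fixes c \<gamma> :: "nat \<Rightarrow> real"
  assumes "decseq \<gamma>" "y > 0" "summable (\<lambda>i. c i * y powr \<gamma> i)"
  shows "\<exists>M. \<forall>x\<ge>y. summable (\<lambda>i. c i * x powr \<gamma> i) \<longrightarrow>
     \<bar>\<Sum>i. c (i + k) * x powr \<gamma> (i + k)\<bar> \<le> M * x powr \<gamma> k"
proof -
  define a where "a i = c (i + k) * y powr \<gamma> (i + k)" for i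
  have "summable a" unfolding a_def using assms(3) by (subst summable_iff_shift)
  then have "Bseq (\<lambda>n. \<Sum>j<n. a j)"
    by (intro convergent_imp_Bseq) (simp add: summable_iff_convergent)
  then obtain M where M: "\<And>n. \<bar>\<Sum>j<n. a j\<bar> \<le> M" unfolding Bseq_def by auto
  have "\<bar>\<Sum>i. c (i + k) * x powr \<gamma> (i + k)\<bar> \<le> M * y powr (- \<gamma> k) * x powr \<gamma> k"
    if x: "x \<ge> y" and s: "summable (\<lambda>i. c i * x powr \<gamma> i)" for x
  proof -
    define b where "b i = (x / y) powr \<gamma> (i + k)" for i
    have ab: "c (i + k) * x powr \<gamma> (i + k) = a i * b i" for i
      using x assms(2) by (simp add: a_def b_def powr_divide)
    have b: "decseq b" unfolding b_def decseq_def using assms(1,2) x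
      by (auto intro!: powr_mono simp: decseq_def)
    have "summable (\<lambda>i. a i * b i)"
      unfolding ab[symmetric] using s by (subst summable_iff_shift)
    then have "(\<lambda>n. \<bar>\<Sum>j<n. a j * b j\<bar>) \<longlonglongrightarrow> \<bar>\<Sum>i. a i * b i\<bar>"
      by (intro tendsto_rabs summable_LIMSEQ)
    then have "\<bar>\<Sum>i. a i * b i\<bar> \<le> M * b 0"
    proof (rule LIMSEQ_le_const2, intro exI allI impI)
      fix n show "\<bar>\<Sum>j<n. a j * b j\<bar> \<le> M * b 0"
        by (rule abel_partial_sum_bound[OF b _ M]) (simp add: b_def)
    qed
    also have "b 0 = y powr (- \<gamma> k) * x powr \<gamma> k"
      using x assms(2) by (simp add: b_def powr_divide powr_minus_divide)
    finally show ?thesis unfolding ab by (simp add: mult_ac)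
  qed
  then show ?thesis by blast
qed

text \<open>Equal exponents may cancel, so the leading term need not be the one with index \<open>0\<close>; but the
  sum still has a leading power, and is otherwise bounded above.\<close>

lemma power_series_dichotomy:
  fixes c \<gamma> :: "nat \<Rightarrow> real"
  assumes dec: "decseq \<gamma>" and x0: "0 \<le> x0"
    and sm: "\<And>x. x > x0 \<Longrightarrow> summable (\<lambda>i. c i * x powr \<gamma> i)"
  defines "h \<equiv> \<lambda>x. \<Sum>i. c i * x powr \<gamma> i"
  shows "(\<exists>C v. C > 0 \<and> v > 0 \<and> (\<forall>\<^sub>F x in at_top. h x \<ge> C * x powr v)) \<or>
         (\<exists>K. \<forall>\<^sub>F x in at_top. h x \<le> K)" (is "?grow \<or> ?bdd")
proof -
  \<comment> \<open>A leading term C x^v with a remainder of lower order decides the alternative.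
    For C > 0 and v > 0 there is growth; for C > 0 and v \<le> 0 the bound 2 C works, and for C < 0
    the bound 0.\<close>
  have lead: "?grow \<or> ?bdd"
    if ev: "\<forall>\<^sub>F x in at_top. \<bar>h x - C * x powr v\<bar> \<le> M * x powr w" and w: "w < v" and C: "C \<noteq> 0" for C v M w
  proof -
    have "((\<lambda>x::real. x powr (w - v)) \<longlongrightarrow> 0) at_top"
      using w by (intro tendsto_neg_powr filterlim_ident) auto
    then have "((\<lambda>x::real. M * x powr (w - v)) \<longlongrightarrow> 0) at_top" by (rule tendsto_mult_right_zero)
    then have "\<forall>\<^sub>F x in at_top. M * x powr (w - v) < \<bar>C\<bar> / 2"
      using C by (intro order_tendstoD) auto
    then have le: "\<forall>\<^sub>F x in at_top. M * x powr w \<le> \<bar>C\<bar> / 2 * x powr v"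
      using eventually_gt_at_top[of 0]
    proof eventually_elim
      case (elim x)
      have "M * x powr w = M * x powr (w - v) * x powr v" using elim by (simp add: powr_diff)
      also have "\<dots> \<le> \<bar>C\<bar> / 2 * x powr v" using elim by (intro mult_right_mono) auto
      finally show ?case .
    qed
    show ?thesis
    proof (cases "C > 0")
      case True
      show ?thesis
      proof (cases "v > 0")
        case v: True
        have "\<forall>\<^sub>F x in at_top. h x \<ge> C / 2 * x powr v"
          using ev le by eventually_elim (use True in \<open>auto simp: field_simps\<close>)
        then show ?thesis using True v by (intro disjI1 exI[of _ "C/2"] exI[of _ v]) auto
      next
        case False
        have "\<forall>\<^sub>F x in at_top. h x \<le> 2 * C"
          using ev le eventually_ge_at_top[of 1]
        proof eventually_elim
          case (elim x)
          have "h x \<le> 3 / 2 * C * x powr v" using elim True by (simp add: field_simps)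
          also have "\<dots> \<le> 3/2 * C * 1"
            using True False elim powr_mono[of v 0 x] by (intro mult_left_mono) auto
          finally show ?case using True by simp
        qed
        then show ?thesis by blast
      qed
    next
      case False
      have "\<forall>\<^sub>F x in at_top. h x \<le> 0"
        using ev le
      proof eventually_elim
        case (elim x)
        have "C * x powr v \<le> 0" using False by (simp add: mult_nonpos_nonneg)
        then show ?case using elim False by (simp add: abs_if split: if_splits)
      qed
      then show ?thesis by blast
    qed
  qed
  define s where "s k x = (\<Sum>j<k. c j * x powr \<gamma> j)" for k x
  \<comment> \<open>Marks the start of a run of equal exponents. The terms of a run add up to one
    power of x, whose coefficient may vanish although the single \<open>c j\<close> do not.\<close>
  define brk where "brk k \<longleftrightarrow> k = 0 \<or> \<gamma> k < \<gamma> (k - 1)" for k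
  have cancelled: "s k x = x powr v * (\<Sum>j\<in>{j0..<k}. c j)"
    if "j0 \<le> k" "s j0 x = 0" "\<And>j. j0 \<le> j \<Longrightarrow> j < k \<Longrightarrow> \<gamma> j = v" for j0 k x v
  proof -
    have "s k x = s j0 x + (\<Sum>j\<in>{j0..<k}. c j * x powr \<gamma> j)"
      unfolding s_def lessThan_atLeast0 using that(1)
      by (intro sum.atLeastLessThan_concat[symmetric]) auto
    also have "(\<Sum>j\<in>{j0..<k}. c j * x powr \<gamma> j) = (\<Sum>j\<in>{j0..<k}. c j * x powr v)"
      using that(3) by (intro sum.cong) auto
    finally show ?thesis using that(2) by (simp add: sum_distrib_left mult.commute)
  qed
  have start: "\<exists>j0\<le>k. brk j0 \<and> (\<forall>j. j0 \<le> j \<longrightarrow> j \<le> k \<longrightarrow> \<gamma> j = \<gamma> k)" for k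
  proof -
    define j0 where "j0 = (LEAST j. \<gamma> j = \<gamma> k)"
    have 1: "\<gamma> j0 = \<gamma> k" unfolding j0_def by (rule LeastI) simp
    have 2: "j0 \<le> k" unfolding j0_def by (rule Least_le) simp
    have "brk j0"
    proof (cases "j0 = 0")
      case False
      have "\<gamma> (j0 - 1) \<noteq> \<gamma> k"
        using not_less_Least[of "j0 - 1" "\<lambda>j. \<gamma> j = \<gamma> k", folded j0_def] False by simp
      moreover have "\<gamma> j0 \<le> \<gamma> (j0 - 1)" using dec by (simp add: decseq_def)
      ultimately show ?thesis using 1 by (simp add: brk_def)
    qed (simp add: brk_def)
    moreover have "\<gamma> j = \<gamma> k" if "j0 \<le> j" "j \<le> k" for j
      using 1 that dec unfolding decseq_def by (metis order_antisym)
    ultimately show ?thesis using 2 by blast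
  qed
  show ?thesis
  proof (cases "\<exists>k. brk k \<and> (\<exists>x>0. s k x \<noteq> 0)")
    case True
    \<comment> \<open>At the first break with nonvanishing initial sum, the run that ends there
      supplies the leading power; everything before that run has cancelled.\<close>
    define k where "k = (LEAST k. brk k \<and> (\<exists>x>0. s k x \<noteq> 0))"
    have k: "brk k" "\<exists>x>0. s k x \<noteq> 0" using LeastI_ex[OF True] unfolding k_def by auto
    have min: "s j x = 0" if "brk j" "j < k" "x > 0" for j x
      using not_less_Least[of j] that unfolding k_def by blast
    have k0: "k > 0" using k(2) by (cases k) (auto simp: s_def)
    obtain j0 where j0: "j0 \<le> k - 1" "brk j0" "\<And>j. j0 \<le> j \<Longrightarrow> j \<le> k - 1 \<Longrightarrow> \<gamma> j = \<gamma> (k-1)"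
      using start[of "k-1"] by blast
    define v C where "v = \<gamma> (k - 1)" and "C = (\<Sum>j\<in>{j0..<k}. c j)"
    have sk: "s k x = x powr v * C" if "x > 0" for x
      unfolding v_def C_def
    proof (rule cancelled)
      show "s j0 x = 0" using j0(1,2) k0 that by (intro min) auto
      show "j0 \<le> k" using j0(1) by simp
      show "\<gamma> j = \<gamma> (k - 1)" if "j0 \<le> j" "j < k" for j
        using that by (intro j0(3)) auto
    qed
    have C: "C \<noteq> 0" using k(2) sk by auto
    obtain y where y: "y > x0" by (metis gt_ex)
    obtain M where M: "\<And>x. x \<ge> y \<Longrightarrow> summable (\<lambda>i. c i * x powr \<gamma> i) \<Longrightarrow>
       \<bar>\<Sum>i. c (i + k) * x powr \<gamma> (i + k)\<bar> \<le> M * x powr \<gamma> k"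
      using power_series_tail_bound[OF dec _ sm[OF y], of k] y x0 by auto
    have "\<forall>\<^sub>F x in at_top. \<bar>h x - C * x powr v\<bar> \<le> M * x powr \<gamma> k"
      using eventually_ge_at_top[of y]
    proof eventually_elim
      case (elim x)
      then have x: "x > x0" "x > 0" using y x0 by auto
      have "h x = (\<Sum>i. c (i + k) * x powr \<gamma> (i + k)) + s k x"
        unfolding h_def s_def using sm[OF x(1)] by (rule suminf_split_initial_segment)
      then show ?case using M[OF elim sm[OF x(1)]] sk[OF x(2)] by (simp add: mult.commute)
    qed
    then show ?thesis
    proof (rule lead)
      show "\<gamma> k < v" using k(1) k0 by (simp add: brk_def v_def)
    qed (rule C)
  next
    case False
    \<comment> \<open>Every completed run cancels. Either the last run is infinite and
      \<open>h\<close> is its single power, or there are infinitely many breaks and the partial sums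
      vanish along a subsequence.\<close>
    then have z: "s k x = 0" if "brk k" "x > 0" for k x using that by blast
    show ?thesis
    proof (cases "finite {k. brk k}")
      case True
      define k where "k = Max {k. brk k}"
      have "brk 0" by (simp add: brk_def)
      then have "k \<in> {k. brk k}" unfolding k_def using True by (intro Max_in) auto
      then have k: "brk k" by simp
      have const: "\<gamma> j = \<gamma> k" if "k \<le> j" for j
      proof -
        obtain j0 where j0: "j0 \<le> j" "brk j0" "\<And>i. j0 \<le> i \<Longrightarrow> i \<le> j \<Longrightarrow> \<gamma> i = \<gamma> j"
          using start[of j] by blast
        have "j0 \<le> k" using True j0(2) unfolding k_def by simp
        then show ?thesis using j0(3)[of k] that by simp
      qed
      have const: "\<gamma> (i + k) = \<gamma> k" for i by (rule const) simp
      define y where "y = x0 + 1"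
      have y: "y > x0" "y > 0" using x0 by (auto simp: y_def)
      have eq: "h x = x powr \<gamma> k * (\<Sum>i. c (i + k))" if x: "x > x0" "x > 0" for x
      proof -
        have "h x = (\<Sum>i. c (i + k) * x powr \<gamma> (i + k)) + s k x"
          unfolding h_def s_def using sm[OF x(1)] by (rule suminf_split_initial_segment)
        also have "\<dots> = (\<Sum>i. x powr \<gamma> k * c (i + k))"
          using z[OF k x(2)] const by (simp add: mult.commute)
        also have "\<dots> = x powr \<gamma> k * (\<Sum>i. c (i + k))"
        proof (rule suminf_mult)
          have "summable (\<lambda>i. c (i + k) * x powr \<gamma> (i + k))"
            using sm[OF x(1)] by (subst summable_iff_shift)
          then show "summable (\<lambda>i. c (i + k))"
            using x(2) unfolding const mult.commute[of _ "x powr _"] summable_cmult_iff by simp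
        qed
        finally show ?thesis .
      qed
      show ?thesis
      proof (cases "(\<Sum>i. c (i + k)) = 0")
        case True
        have "\<forall>\<^sub>F x in at_top. h x \<le> 0"
          using eventually_gt_at_top[of y] by eventually_elim (use eq True y in auto)
        then show ?thesis by blast
      next
        case False
        have "\<forall>\<^sub>F x in at_top. \<bar>h x - (\<Sum>i. c (i + k)) * x powr \<gamma> k\<bar> \<le> 0 * x powr (\<gamma> k - 1)"
          using eventually_gt_at_top[of y] by eventually_elim (use eq y in auto)
        then show ?thesis by (rule lead) (use False in auto)
      qed
    next
      case inf: False
      have hz: "h x = 0" if x: "x > x0" for x
      proof (rule ccontr)
        assume "h x \<noteq> 0"
        have "(\<lambda>k. s k x) \<longlonglongrightarrow> h x" unfolding s_def h_def using sm[OF x] by (rule summable_LIMSEQ)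
        then have "\<forall>\<^sub>F k in sequentially. s k x \<noteq> 0" using \<open>h x \<noteq> 0\<close>
          by (metis tendsto_imp_eventually_ne)
        then obtain K where K: "\<And>k. k \<ge> K \<Longrightarrow> s k x \<noteq> 0" by (auto simp: eventually_sequentially)
        obtain k where k: "k \<ge> K" "brk k" using inf by (metis infinite_nat_iff_unbounded_le mem_Collect_eq)
        show False using K[OF k(1)] z[OF k(2), of x] x x0 by simp
      qed
      have "\<forall>\<^sub>F x in at_top. h x \<le> 0"
        using eventually_gt_at_top[of x0] by eventually_elim (simp add: hz)
      then show ?thesis by blast
    qed
  qed
qed

section \<open>Second moment of the positive part of the noise\<close>

lemma summable_square_stretched_exponential:
  fixes C v :: real
  assumes "C > 0" "v > 0"
  shows "summable (\<lambda>k. (real k + 1)^2 * exp (- (C * real k powr v)))"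
proof (rule summable_comparison_test_ev)
  have "((\<lambda>k::nat. (real k + 1)^2 * exp (- (C * real k powr v)) * real k ^ 2) \<longlongrightarrow> 0) sequentially"
    using assms by real_asymp
  then have "\<forall>\<^sub>F k in sequentially. (real k + 1)^2 * exp (- (C * real k powr v)) * real k ^ 2 < 1"
    by (rule order_tendstoD) auto
  then show "\<forall>\<^sub>F k in sequentially. norm ((real k + 1)^2 * exp (- (C * real k powr v))) \<le> inverse (real k ^ 2)"
    using eventually_gt_at_top[of 0] by eventually_elim (auto simp: field_simps)
  show "summable (\<lambda>k. inverse (real k ^ 2))" using inverse_power_summable[of 2] by simp
qed

text \<open>An exponent bounded above would keep the density away from 0 on a ray, contradicting
  total mass 1. By the dichotomy the exponent then eventually exceeds C x^v with C, v > 0, so the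
  tail decays faster than any power.\<close>

lemma exponential_tail_square_integrable:
  assumes "prob_space M" and [measurable_cong]: "sets M = sets borel" and "exponential_tail M"
  shows "integrable M (\<lambda>x. (max 0 x)\<^sup>2)"
proof -
  interpret prob_space M by fact
  obtain x0 c \<gamma> where x0: "0 \<le> x0" and dec: "decseq \<gamma>"
    and sm: "\<And>x. x > x0 \<Longrightarrow> summable (\<lambda>i. c i * x powr \<gamma> i)"
    and dens: "has_density_on M {x0<..} (\<lambda>x. exp (- (\<Sum>i. c i * x powr \<gamma> i)))"
    using assms(3) unfolding exponential_tail_def by auto
  define h where "h x = (\<Sum>i. c i * x powr \<gamma> i)" for x
  have em: "emeasure M A = (\<integral>\<^sup>+x\<in>A. ennreal (exp (- h x)) \<partial>lborel)"
    if "A \<in> sets borel" "A \<subseteq> {x0<..}" for A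
    using dens that unfolding has_density_on_def h_def by blast
  have "\<not> (\<exists>K. \<forall>\<^sub>F x in at_top. h x \<le> K)"
  proof
    assume "\<exists>K. \<forall>\<^sub>F x in at_top. h x \<le> K"
    then obtain K y where Ky: "\<And>x. x \<ge> y \<Longrightarrow> h x \<le> K" by (auto simp: eventually_at_top_linorder)
    define z where "z = max y (x0 + 1)"
    \<comment> \<open>At density at least exp (- K), an interval of length 2 exp K alone would carry
      mass 2.\<close>
    define A where "A = {z..z + 2 * exp K}"
    have "ennreal (2 * exp K) * ennreal (exp (- K)) = (\<integral>\<^sup>+x\<in>A. ennreal (exp (- K)) \<partial>lborel)"
      by (simp add: A_def nn_integral_cmult_indicator mult.commute)
    also have "\<dots> \<le> (\<integral>\<^sup>+x\<in>A. ennreal (exp (- h x)) \<partial>lborel)"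
      using Ky by (intro nn_integral_mono) (auto simp: A_def z_def indicator_def intro!: ennreal_leI)
    also have "\<dots> = emeasure M A" by (rule em[symmetric]) (auto simp: A_def z_def)
    also have "\<dots> \<le> 1" by (rule emeasure_le_1)
    finally have "ennreal (2 * exp K * exp (- K)) \<le> 1" by (simp add: ennreal_mult)
    moreover have "2 * exp K * exp (- K) = (2::real)" by (simp add: exp_minus)
    ultimately show False by simp
  qed
  then obtain C v where Cv: "C > 0" "v > 0" and "\<forall>\<^sub>F x in at_top. h x \<ge> C * x powr v"
    using power_series_dichotomy[OF dec x0 sm] unfolding h_def by blast
  then obtain y where y: "\<And>x. x \<ge> y \<Longrightarrow> h x \<ge> C * x powr v" by (auto simp: eventually_at_top_linorder)
  obtain k0 :: nat where k0: "real k0 \<ge> max y x0" using real_arch_simple by blast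
  \<comment> \<open>Step function dominating the square above k0. The intervals are open on the
    left, so even the one starting at k0 lies where the density formula is valid, also if k0 =
    x0.\<close>
  define g where "g k x = (if k0 \<le> k then (real k + 1)^2 * indicator {real k<..real k + 1} x else 0)" for k :: nat and x :: real
  have "(\<integral>\<^sup>+x. ennreal ((max 0 x)\<^sup>2) \<partial>M) \<le> (\<integral>\<^sup>+x. ennreal ((real k0)\<^sup>2) + (\<Sum>k. ennreal (g k x)) \<partial>M)"
  proof (rule nn_integral_mono)
    fix x
    show "ennreal ((max 0 x)\<^sup>2) \<le> ennreal ((real k0)\<^sup>2) + (\<Sum>k. ennreal (g k x))"
    proof (cases "x \<le> real k0")
      case True
      then have "(max 0 x)\<^sup>2 \<le> (real k0)\<^sup>2" by (intro power_mono) auto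
      then have "ennreal ((max 0 x)\<^sup>2) \<le> ennreal ((real k0)\<^sup>2)" by (rule ennreal_leI)
      then show ?thesis by (rule add_increasing2[OF zero_le])
    next
      case False
      define k where "k = nat (\<lceil>x\<rceil> - 1)"
      have x: "x > 0" using False of_nat_0_le_iff[of k0, where ?'a=real] by linarith
      have k: "real k < x" "x \<le> real k + 1"
        unfolding k_def using x by (auto simp: of_nat_diff nat_diff_distrib) linarith+
      have "k0 \<le> k" using False k by linarith
      then have gk: "g k x = (real k + 1)^2" using k by (simp add: g_def)
      have "(max 0 x)\<^sup>2 \<le> g k x" unfolding gk using k x by (intro power_mono) auto
      then have "ennreal ((max 0 x)\<^sup>2) \<le> ennreal (g k x)" by (rule ennreal_leI)
      also have "\<dots> \<le> (\<Sum>k. ennreal (g k x))"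
        using sum_le_suminf[of "\<lambda>k. ennreal (g k x)" "{k}"] by simp
      finally show ?thesis by (simp add: add_increasing)
    qed
  qed
  also have "\<dots> = ennreal ((real k0)\<^sup>2) + (\<integral>\<^sup>+x. (\<Sum>k. ennreal (g k x)) \<partial>M)"
    by (subst nn_integral_add) (auto simp: g_def emeasure_space_1)
  also have "(\<integral>\<^sup>+x. (\<Sum>k. ennreal (g k x)) \<partial>M) = (\<Sum>k. \<integral>\<^sup>+x. ennreal (g k x) \<partial>M)"
    by (intro nn_integral_suminf) (auto simp: g_def)
  also have "\<dots> \<le> (\<Sum>k. ennreal ((real k + 1)^2 * exp (- (C * real k powr v))))"
  proof (intro suminf_le allI)
    fix k
    show "(\<integral>\<^sup>+x. ennreal (g k x) \<partial>M) \<le> ennreal ((real k + 1)^2 * exp (- (C * real k powr v)))"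
    proof (cases "k0 \<le> k")
      case True
      define A where "A = {real k<..real k + 1}"
      have "(\<integral>\<^sup>+x. ennreal (g k x) \<partial>M) = (\<integral>\<^sup>+x. ennreal ((real k + 1)^2) * indicator A x \<partial>M)"
        using True by (intro nn_integral_cong) (auto simp: g_def A_def indicator_def)
      also have "\<dots> = ennreal ((real k + 1)^2) * emeasure M A"
        by (rule nn_integral_cmult_indicator) (auto simp: A_def assms(2))
      also have "emeasure M A = (\<integral>\<^sup>+x\<in>A. ennreal (exp (- h x)) \<partial>lborel)"
        using k0 True by (intro em) (auto simp: A_def)
      also have "\<dots> \<le> (\<integral>\<^sup>+x\<in>A. ennreal (exp (- (C * real k powr v))) \<partial>lborel)"
      proof (intro nn_integral_mono)
        fix x
        have "exp (- h x) \<le> exp (- (C * real k powr v))" if "x \<in> A"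
        proof -
          have "C * real k powr v \<le> C * x powr v"
            using that Cv by (intro mult_left_mono powr_mono2) (auto simp: A_def)
          also have "\<dots> \<le> h x" using that k0 True by (intro y) (auto simp: A_def)
          finally show ?thesis by simp
        qed
        then show "ennreal (exp (- h x)) * indicator A x \<le> ennreal (exp (- (C * real k powr v))) * indicator A x"
          by (auto simp: indicator_def intro!: ennreal_leI)
      qed
      also have "\<dots> = ennreal (exp (- (C * real k powr v)))"
        by (simp add: A_def nn_integral_cmult_indicator)
      finally show ?thesis by (simp add: ennreal_mult mult_left_mono)
    qed (simp add: g_def)
  qed auto
  also have "\<dots> < \<infinity>"
    using summable_square_stretched_exponential[OF Cv]
    by (subst suminf_ennreal2) auto
  finally have "(\<integral>\<^sup>+x. ennreal ((max 0 x)\<^sup>2) \<partial>M) < \<infinity>" by simp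
  then show ?thesis by (intro integrableI_nonneg) auto
qed

lemma noise_square_integrable:
  assumes "noise_distribution D"
  shows "integrable D (\<lambda>x. (max 0 x)\<^sup>2)"
proof -
  interpret prob_space D using assms by (simp add: noise_distribution_def)
  have [measurable_cong]: "sets D = sets borel" using assms by (simp add: noise_distribution_def)
  consider "exponential_tail D" | "bounded_support_tail D"
    using assms by (auto simp: noise_distribution_def generalized_exponential_tail_def)
  then show ?thesis
  proof cases
    case 1
    with prob_space_axioms \<open>sets D = sets borel\<close> show ?thesis by (rule exponential_tail_square_integrable)
  next
    case 2
    then obtain a b where "AE x in D. a \<le> x \<and> x \<le> b" unfolding bounded_support_tail_def by blast
    then have "AE x in D. norm ((max 0 x)\<^sup>2) \<le> b\<^sup>2 + 0" 
      by eventually_elim (auto simp: max_def intro!: power_mono)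
    then show ?thesis by (intro integrable_const_bound) auto
  qed
qed

section \<open>The algorithm\<close>

primrec ask_values ::
  "'a set list \<Rightarrow> ('a set \<Rightarrow> real) \<Rightarrow> (('a set \<Rightarrow> real) \<Rightarrow> 'a oracle_algorithm) \<Rightarrow> 'a oracle_algorithm" where
  "ask_values [] g k = k g"
| "ask_values (X # Xs) g k = Value_Query X (\<lambda>v. ask_values Xs (g(X := v)) k)"

primrec ask_members ::
  "'a set list \<Rightarrow> 'a set set \<Rightarrow> ('a set set \<Rightarrow> 'a oracle_algorithm) \<Rightarrow> 'a oracle_algorithm" where
  "ask_members [] A k = k A"
| "ask_members (X # Xs) A k = Member_Query X (\<lambda>b. ask_members Xs (if b then insert X A else A) k)"

lemma run_ask_values:
  "run F M (ask_values Xs g k) = map_pmf (map_prod id ((+) (length Xs)))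
     (run F M (k (\<lambda>X. if X \<in> set Xs then F X else g X)))"
proof (induction Xs arbitrary: g)
  case (Cons X Xs)
  have "(\<lambda>Y. if Y \<in> set Xs then F Y else (g(X := F X)) Y) =
      (\<lambda>Y. if Y \<in> set (X # Xs) then F Y else g Y)" by auto
  then show ?case
    by (simp add: Cons pmf.map_comp comp_def prod.map_comp map_prod_def case_prod_beta)
qed (simp add: map_prod_def case_prod_beta)

lemma run_ask_members:
  "run F M (ask_members Xs A k) = run F M (k (A \<union> {X \<in> set Xs. M X}))"
proof (induction Xs arbitrary: A)
  case (Cons X Xs)
  have "(if M X then insert X A else A) \<union> {X \<in> set Xs. M X} = A \<union> {Y \<in> set (X # Xs). M Y}" by auto
  then show ?case by (simp add: Cons)
qed simp

definition list_of :: "'b set \<Rightarrow> 'b list" where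
  "list_of A = (SOME xs. set xs = A \<and> distinct xs)"

lemma list_of: "finite A \<Longrightarrow> set (list_of A) = A" "finite A \<Longrightarrow> length (list_of A) = card A"
proof -
  assume "finite A"
  have "set (list_of A) = A \<and> distinct (list_of A)"
    unfolding list_of_def by (rule someI_ex[OF finite_distinct_list[OF \<open>finite A\<close>]])
  then show "set (list_of A) = A" "length (list_of A) = card A" using distinct_card[of "list_of A"] by simp_all
qed

section \<open>Medians of sample means\<close>

definition median :: "nat \<Rightarrow> (nat \<Rightarrow> real) \<Rightarrow> real" where
  "median G X = Min {y \<in> X ` {..<G}. G \<le> 2 * card {g. g < G \<and> X g \<le> y}}"

text \<open>The median is taken as the least sample value that at least half of the samples do not
  exceed, so comparing it with a threshold amounts to counting. Measurability and concentration are
  both read off from this equivalence.\<close>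

lemma median_le_iff:
  assumes "G > 0"
  shows "median G X \<le> x \<longleftrightarrow> G \<le> 2 * card {g. g < G \<and> X g \<le> x}"
proof -
  let ?Y = "{y \<in> X ` {..<G}. G \<le> 2 * card {g. g < G \<and> X g \<le> y}}"
  have fin: "finite ?Y" by simp
  have in_Y: "\<exists>y\<in>?Y. y \<le> x" if x: "G \<le> 2 * card {g. g < G \<and> X g \<le> x}" for x
  proof -
    let ?A = "{g. g < G \<and> X g \<le> x}"
    have "?A \<noteq> {}"
    proof
      assume "?A = {}"
      then have "card ?A = 0" by (simp only: card.empty)
      with x assms show False by simp
    qed
    then have A: "finite ?A" "?A \<noteq> {}" by simp_all
    define y where "y = Max (X ` ?A)"
    have y: "y \<in> X ` ?A" unfolding y_def using A by (intro Max_in) auto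
    have "{g. g < G \<and> X g \<le> y} = ?A"
      using y A(1) by (auto simp: y_def intro!: Max_ge)
    then show ?thesis using y x by (intro bexI[of _ y]) auto
  qed
  have "{g. g < G \<and> X g \<le> Max (X ` {..<G})} = {..<G}" using assms by auto
  then have "?Y \<noteq> {}" using in_Y[of "Max (X ` {..<G})"] by auto
  then have med: "median G X \<in> ?Y" unfolding median_def using fin by (rule Min_in[rotated])
  show ?thesis
  proof
    assume "median G X \<le> x"
    then have "card {g. g < G \<and> X g \<le> median G X} \<le> card {g. g < G \<and> X g \<le> x}"
      by (intro card_mono) auto
    then show "G \<le> 2 * card {g. g < G \<and> X g \<le> x}" using med by auto
  next
    assume "G \<le> 2 * card {g. g < G \<and> X g \<le> x}"
    then obtain y where y: "y \<in> ?Y" "y \<le> x" using in_Y by blast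
    show "median G X \<le> x" unfolding median_def using order_trans[OF Min_le[OF fin y(1)] y(2)] .
  qed
qed

text \<open>A median outside the interval drags at least half of the samples out on the same
  side.\<close>

lemma median_close:
  assumes "2 * card {g. g < G \<and> \<bar>X g - c\<bar> > d} < G"
  shows "\<bar>median G X - c\<bar> \<le> d"
proof -
  have G: "G > 0" using assms by simp
  let ?B = "{g. g < G \<and> \<bar>X g - c\<bar> > d}"
  have "card {..<G} \<le> card ({g. g < G \<and> X g \<le> c + d} \<union> ?B)" by (intro card_mono) auto
  also have "\<dots> \<le> card {g. g < G \<and> X g \<le> c + d} + card ?B" by (rule card_Un_le)
  finally have "median G X \<le> c + d" using assms by (subst median_le_iff[OF G]) simp
  moreover have "\<not> median G X < c - d"
  proof
    assume "median G X < c - d"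
    then have "card {g. g < G \<and> X g \<le> median G X} \<le> card ?B" by (intro card_mono) auto
    moreover have "G \<le> 2 * card {g. g < G \<and> X g \<le> median G X}"
      using median_le_iff[OF G, of X "median G X"] by simp
    ultimately show False using assms by simp
  qed
  ultimately show ?thesis by linarith
qed

text \<open>Negative answers are replaced by 0: since \<open>f \<ge> 0\<close>, this multiplies \<open>f\<close> by the positive part of
  the noise, which unlike the noise itself always has a finite second moment.\<close>

definition sample_mean :: "nat \<Rightarrow> (nat \<Rightarrow> nat set) \<Rightarrow> ('a set \<Rightarrow> real) \<Rightarrow> 'a set \<Rightarrow> real" where
  "sample_mean s \<theta> F B = (\<Sum>i<s. max 0 (F (from_nat_into B ` \<theta> i))) / real s"

text \<open>The sets \<open>\<omega> g i\<close> are templates, that is sets of positions; the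
  enumeration of \<open>B\<close> turns them into subsets of \<open>B\<close>, so one
  \<open>\<omega>\<close> serves all bases. The index \<open>g\<close> numbers the groups whose
  means enter the median.\<close>

definition estimate ::
  "nat \<Rightarrow> nat \<Rightarrow> (nat \<Rightarrow> nat \<Rightarrow> nat set) \<Rightarrow> ('a set \<Rightarrow> real) \<Rightarrow> 'a set \<Rightarrow> real" where
  "estimate G s \<omega> F B = median G (\<lambda>g. sample_mean s (\<omega> g) F B)"

definition sampled_sets :: "nat \<Rightarrow> nat \<Rightarrow> (nat \<Rightarrow> nat \<Rightarrow> nat set) \<Rightarrow> 'a set \<Rightarrow> 'a set set" where
  "sampled_sets G s \<omega> B = (\<lambda>(g, i). from_nat_into B ` \<omega> g i) ` ({..<G} \<times> {..<s})"

text \<open>The algorithm knows the oracle only on the sets it asked for; its estimates nevertheless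
  agree with those formed from the full oracle.\<close>

lemma estimate_cong:
  assumes "\<And>X. X \<in> sampled_sets G s \<omega> B \<Longrightarrow> F X = F' X"
  shows "estimate G s \<omega> F B = estimate G s \<omega> F' B"
proof -
  have "sample_mean s (\<omega> g) F B = sample_mean s (\<omega> g) F' B" if "g < G" for g
    unfolding sample_mean_def using that assms
    by (intro arg_cong2[where f="(/)"] sum.cong refl arg_cong2[where f=max]) (auto simp: sampled_sets_def)
  then have 1: "(\<lambda>g. sample_mean s (\<omega> g) F B) ` {..<G} = (\<lambda>g. sample_mean s (\<omega> g) F' B) ` {..<G}"
    and 2: "\<And>y. {g. g < G \<and> sample_mean s (\<omega> g) F B \<le> y} = {g. g < G \<and> sample_mean s (\<omega> g) F' B \<le> y}"
    by auto
  show ?thesis unfolding estimate_def median_def 1 2 ..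
qed

lemma card_sampled_sets: "card (sampled_sets G s \<omega> B) \<le> G * s" "finite (sampled_sets G s \<omega> B)"
  unfolding sampled_sets_def
  using card_image_le[of "{..<G} \<times> {..<s}" "\<lambda>(g, i). from_nat_into B ` \<omega> g i"] by simp_all

text \<open>\<open>arg_min_on\<close> is a Hilbert choice from the set of minimisers, so functions
  that agree on \<open>A\<close> also break ties in the same way.\<close>

lemma arg_min_on_cong:
  assumes "\<And>x. x \<in> A \<Longrightarrow> f x = g x"
  shows "arg_min_on f A = arg_min_on g A"
proof -
  have "is_arg_min f (\<lambda>x. x \<in> A) = is_arg_min g (\<lambda>x. x \<in> A)"
    using assms by (auto simp: is_arg_min_def fun_eq_iff)
  then show ?thesis by (simp add: arg_min_on_def arg_min_def)
qed

section \<open>Local search over bases\<close>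

definition best_swap :: "'a set \<Rightarrow> 'a set set \<Rightarrow> ('a set \<Rightarrow> real) \<Rightarrow> 'a set \<Rightarrow> 'a set" where
  "best_swap N I e S = arg_min_on (\<lambda>B. - e B) (neighbours N I S)"

definition swap_gain :: "'a set \<Rightarrow> 'a set set \<Rightarrow> ('a set \<Rightarrow> real) \<Rightarrow> 'a set \<Rightarrow> real" where
  "swap_gain N I e S = e (best_swap N I e S) - e S"

definition search_path :: "'a set \<Rightarrow> 'a set set \<Rightarrow> ('a set \<Rightarrow> real) \<Rightarrow> 'a set \<Rightarrow> nat \<Rightarrow> 'a set" where
  "search_path N I e S j = (best_swap N I e ^^ j) S"

text \<open>A small estimated gain certifies approximate local optimality; the last base visited
  need not have one, so the base with the least gain is returned.\<close>

definition search_result :: "'a set \<Rightarrow> 'a set set \<Rightarrow> nat \<Rightarrow> ('a set \<Rightarrow> real) \<Rightarrow> 'a set \<Rightarrow> 'a set" where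
  "search_result N I J e S = search_path N I e S
     (arg_min_on (\<lambda>j. swap_gain N I e (search_path N I e S j)) {..<J})"

definition least_gain :: "('a set \<times> real) list \<Rightarrow> 'a set" where
  "least_gain h = fst (h ! arg_min_on (\<lambda>j. snd (h ! j)) {..<length h})"

text \<open>\<open>h\<close> records the bases visited with their estimated gains. Queries for the
  neighbours also provide the estimate of \<open>S\<close> itself, since \<open>S\<close> is one of
  them.\<close>

fun search_rounds ::
  "'a set \<Rightarrow> 'a set set \<Rightarrow> nat \<Rightarrow> nat \<Rightarrow> (nat \<Rightarrow> nat \<Rightarrow> nat set) \<Rightarrow> nat \<Rightarrow> 'a set \<Rightarrow> ('a set \<times> real) list \<Rightarrow>
   'a oracle_algorithm" where
  "search_rounds N I G s \<omega> 0 S h = Return (least_gain h)"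
| "search_rounds N I G s \<omega> (Suc j) S h =
     ask_values (list_of (\<Union>B\<in>neighbours N I S. sampled_sets G s \<omega> B)) (\<lambda>_. 0) (\<lambda>F.
       search_rounds N I G s \<omega> j (best_swap N I (estimate G s \<omega> F) S)
         (h @ [(S, swap_gain N I (estimate G s \<omega> F) S)]))"

lemma finite_neighbours:
  assumes "finite N" "S \<subseteq> N"
  shows "finite (neighbours N I S)" "card (neighbours N I S) \<le> card S * card N"
proof -
  have sub: "neighbours N I S \<subseteq> (\<lambda>(a, b). insert b (S - {a})) ` (S \<times> N)" by (auto simp: neighbours_def)
  have fin: "finite (S \<times> N)" using assms finite_subset by blast
  show "finite (neighbours N I S)" using sub fin finite_surj by blast
  show "card (neighbours N I S) \<le> card S * card N"
    using surj_card_le[OF fin sub] by (simp add: card_cartesian_product)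
qed

lemma self_neighbour:
  assumes "basis I S" "S \<noteq> {}" "S \<subseteq> N"
  shows "S \<in> neighbours N I S"
proof -
  obtain a where "a \<in> S" using assms(2) by blast
  then have "a \<in> N" "S = insert a (S - {a})" using assms(3) by auto
  then show ?thesis using assms(1) \<open>a \<in> S\<close> unfolding neighbours_def by blast
qed

lemma best_swap:
  assumes "finite N" "S \<subseteq> N" "basis I S" "S \<noteq> {}"
  shows "best_swap N I e S \<in> neighbours N I S"
    "\<And>B. B \<in> neighbours N I S \<Longrightarrow> e B \<le> e (best_swap N I e S)"
proof -
  have fin: "finite (neighbours N I S)" "neighbours N I S \<noteq> {}"
    using finite_neighbours[OF assms(1,2)] self_neighbour[OF assms(3,4,2)] by auto
  show "best_swap N I e S \<in> neighbours N I S"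
    unfolding best_swap_def using fin by (rule arg_min_if_finite)
  show "e B \<le> e (best_swap N I e S)" if "B \<in> neighbours N I S" for B
    using arg_min_if_finite(2)[OF fin, of "\<lambda>B. - e B"] that unfolding best_swap_def by force
qed

lemma search_path_Suc: "search_path N I e S (Suc j) = best_swap N I e (search_path N I e S j)"
  "search_path N I e (best_swap N I e S) j = search_path N I e S (Suc j)"
  by (simp_all add: search_path_def funpow_swap1)

lemma basis_search_path:
  assumes m: "matroid N I" and r: "matroid_rank I > 0" and S: "basis I S"
  shows "basis I (search_path N I e S j)"
proof (induction j)
  case 0
  then show ?case using S by (simp add: search_path_def)
next
  case (Suc j)
  have "search_path N I e S j \<subseteq> N" "search_path N I e S j \<noteq> {}"
    using matroid_subset[OF m basis_in[OF Suc]] basis_card[OF m Suc] r by auto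
  from best_swap(1)[OF matroid_finite(1)[OF m] this(1) Suc this(2), of e] show ?case
    unfolding search_path_Suc(1) by (simp add: neighbours_def)
qed

text \<open>For a fixed oracle function equal queries get equal answers, so the adaptive run follows
  the path computed from the single function \<open>estimate G s \<omega> F\<close>. Adaptivity is
  thereby removed from the probabilistic analysis.\<close>

lemma run_search_rounds:
  assumes m: "matroid N I" and S: "basis I S" and r: "matroid_rank I > 0"
  shows "\<exists>q \<le> j * (matroid_rank I * card N * (G * s)).
    run F M (search_rounds N I G s \<omega> j S h) = return_pmf (least_gain
      (h @ map (\<lambda>i. (search_path N I (estimate G s \<omega> F) S i,
         swap_gain N I (estimate G s \<omega> F) (search_path N I (estimate G s \<omega> F) S i))) [0..<j]), q)"
  using S
proof (induction j arbitrary: S h)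
  case (Suc j)
  let ?e = "estimate G s \<omega> F" and ?L = "matroid_rank I * card N * (G * s)"
  let ?nb = "neighbours N I S"
  define Q where "Q = (\<Union>B\<in>?nb. sampled_sets G s \<omega> B)"
  have finN: "finite N" and SN: "S \<subseteq> N" and cS: "card S = matroid_rank I"
    using matroid_finite(1)[OF m] matroid_subset[OF m basis_in[OF Suc.prems]] basis_card[OF m Suc.prems] .
  have Sne: "S \<noteq> {}" using cS r by auto
  note nb = finite_neighbours[OF finN SN, of I]
  have finQ: "finite Q" unfolding Q_def using nb(1) card_sampled_sets(2) by blast
  have "card Q \<le> (\<Sum>B\<in>?nb. card (sampled_sets G s \<omega> B))" unfolding Q_def by (rule card_UN_le[OF nb(1)])
  also have "\<dots> \<le> card ?nb * (G * s)" using card_sampled_sets(1) sum_bounded_above[of ?nb] by (metis of_nat_id)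
  also have "\<dots> \<le> ?L" using nb(2) cS by (intro mult_right_mono) auto
  finally have cQ: "card Q \<le> ?L" .
  define F' where "F' = (\<lambda>X. if X \<in> set (list_of Q) then F X else 0)"
  have e: "estimate G s \<omega> F' B = ?e B" if "B \<in> ?nb" for B
    using that finQ by (intro estimate_cong) (auto simp: F'_def list_of Q_def)
  have bs: "best_swap N I (estimate G s \<omega> F') S = best_swap N I ?e S"
    unfolding best_swap_def using e by (intro arg_min_on_cong) simp
  have sg: "swap_gain N I (estimate G s \<omega> F') S = swap_gain N I ?e S"
    unfolding swap_gain_def bs
    using e[OF best_swap(1)[OF finN SN Suc.prems Sne]] e[OF self_neighbour[OF Suc.prems Sne SN]] by simp
  have "basis I (best_swap N I ?e S)"
    using best_swap(1)[OF finN SN Suc.prems Sne] by (simp add: neighbours_def)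
  from Suc.IH[OF this, of "h @ [(S, swap_gain N I ?e S)]"] obtain q where q: "q \<le> j * ?L"
    "run F M (search_rounds N I G s \<omega> j (best_swap N I ?e S) (h @ [(S, swap_gain N I ?e S)])) =
     return_pmf (least_gain ((h @ [(S, swap_gain N I ?e S)]) @
       map (\<lambda>i. (search_path N I ?e S (Suc i), swap_gain N I ?e (search_path N I ?e S (Suc i)))) [0..<j]), q)"
    unfolding search_path_Suc(2) by blast
  have "(h @ [(S, swap_gain N I ?e S)]) @
       map (\<lambda>i. (search_path N I ?e S (Suc i), swap_gain N I ?e (search_path N I ?e S (Suc i)))) [0..<j] =
     h @ map (\<lambda>i. (search_path N I ?e S i, swap_gain N I ?e (search_path N I ?e S i))) [0..<Suc j]"
    by (simp add: upt_conv_Cons map_Suc_upt[symmetric] comp_def search_path_def del: upt_Suc)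
  with q(2) have "run F M (search_rounds N I G s \<omega> (Suc j) S h) = return_pmf (least_gain
      (h @ map (\<lambda>i. (search_path N I ?e S i, swap_gain N I ?e (search_path N I ?e S i))) [0..<Suc j]),
      card Q + q)"
    by (simp add: run_ask_values Q_def[symmetric] F'_def[symmetric] bs sg list_of(2)[OF finQ] del: upt_Suc)
  moreover have "card Q + q \<le> Suc j * ?L" using cQ q(1) by simp
  ultimately show ?case by blast
qed simp

lemma least_gain_search:
  "least_gain (map (\<lambda>i. (search_path N I e S i, swap_gain N I e (search_path N I e S i))) [0..<J]) =
   search_result N I J e S" if "J > 0"
proof -
  let ?h = "map (\<lambda>i. (search_path N I e S i, swap_gain N I e (search_path N I e S i))) [0..<J]"
  have eq: "arg_min_on (\<lambda>j. snd (?h ! j)) {..<length ?h} =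
     arg_min_on (\<lambda>j. swap_gain N I e (search_path N I e S j)) {..<J}"
    by (simp, rule arg_min_on_cong) simp
  have "arg_min_on (\<lambda>j. swap_gain N I e (search_path N I e S j)) {..<J} \<in> {..<J}"
    using that by (intro arg_min_if_finite) auto
  then show ?thesis unfolding least_gain_def search_result_def eq by simp
qed

text \<open>Internal randomness is supplied as natural numbers, so an outcome of \<open>P\<close> is
  encoded by its index in the support. The matroid is read off completely by membership queries,
  which the query count does not include.\<close>

definition noisy_local_search ::
  "'a set \<Rightarrow> nat \<Rightarrow> nat \<Rightarrow> nat \<Rightarrow> (nat \<Rightarrow> nat \<Rightarrow> nat set) pmf \<Rightarrow> 'a oracle_algorithm" where
  "noisy_local_search N J G s P = ask_members (list_of (Pow N)) {} (\<lambda>I.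
     Sample (map_pmf (to_nat_on (set_pmf P)) P) (\<lambda>k.
       search_rounds N I G s (from_nat_into (set_pmf P) k) J (SOME B. basis I B) []))"

lemma some_basis:
  assumes "matroid N I"
  shows "basis I (SOME B. basis I B)"
proof -
  have "{} \<in> I" using assms by (simp add: matroid_def)
  from extend_to_basis[OF assms this] show ?thesis by (auto intro: someI)
qed

lemma run_noisy_local_search:
  assumes m: "matroid N I" and r: "matroid_rank I > 0" and J: "J > 0"
  shows "\<exists>q. (\<forall>\<omega>. q \<omega> \<le> J * (matroid_rank I * card N * (G * s))) \<and>
    run F (\<lambda>S. S \<in> I) (noisy_local_search N J G s P) =
    map_pmf (\<lambda>\<omega>. (search_result N I J (estimate G s \<omega> F) (SOME B. basis I B), q \<omega>)) P"
proof -
  let ?B = "SOME B. basis I B"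
  have I: "{} \<union> {X \<in> set (list_of (Pow N)). X \<in> I} = I"
    using m by (auto simp: list_of matroid_def)
  have "\<exists>q. \<forall>\<omega>. q \<omega> \<le> J * (matroid_rank I * card N * (G * s)) \<and>
     run F (\<lambda>S. S \<in> I) (search_rounds N I G s \<omega> J ?B []) =
     return_pmf (search_result N I J (estimate G s \<omega> F) ?B, q \<omega>)"
  proof (intro choice allI)
    fix \<omega>
    show "\<exists>q \<le> J * (matroid_rank I * card N * (G * s)).
      run F (\<lambda>S. S \<in> I) (search_rounds N I G s \<omega> J ?B []) =
      return_pmf (search_result N I J (estimate G s \<omega> F) ?B, q)"
      using run_search_rounds[OF m some_basis[OF m] r, of J G s F "\<lambda>S. S \<in> I" \<omega> "[]"]
      unfolding append.simps least_gain_search[OF J] .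
  qed
  then obtain q where q: "\<And>\<omega>. q \<omega> \<le> J * (matroid_rank I * card N * (G * s))"
    "\<And>\<omega>. run F (\<lambda>S. S \<in> I) (search_rounds N I G s \<omega> J ?B []) =
     return_pmf (search_result N I J (estimate G s \<omega> F) ?B, q \<omega>)" by blast
  have "run F (\<lambda>S. S \<in> I) (noisy_local_search N J G s P) =
     bind_pmf P (\<lambda>\<omega>. run F (\<lambda>S. S \<in> I) (search_rounds N I G s
       (from_nat_into (set_pmf P) (to_nat_on (set_pmf P) \<omega>)) J ?B []))"
    unfolding noisy_local_search_def run_ask_members I by (simp add: bind_map_pmf)
  also have "\<dots> = bind_pmf P (\<lambda>\<omega>. run F (\<lambda>S. S \<in> I) (search_rounds N I G s \<omega> J ?B []))"
    by (intro bind_pmf_cong refl) simp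
  also have "\<dots> = map_pmf (\<lambda>\<omega>. (search_result N I J (estimate G s \<omega> F) ?B, q \<omega>)) P"
    unfolding q(2) map_pmf_def ..
  finally show ?thesis using q(1) by blast
qed

section \<open>Measurability and concentration\<close>

text \<open>The choice depends on x only through the set of minimisers, which takes finitely many
  values, each described by finitely many comparisons.\<close>

lemma measurable_arg_min_on:
  fixes X :: "'b \<Rightarrow> 'c \<Rightarrow> real"
  assumes "finite A" "A \<noteq> {}" and "\<And>a. a \<in> A \<Longrightarrow> (\<lambda>x. X x a) \<in> borel_measurable M"
  shows "(\<lambda>x. arg_min_on (X x) A) \<in> measurable M (count_space A)"
proof -
  define mins where "mins x = {a \<in> A. \<forall>b\<in>A. X x a \<le> X x b}" for x
  have eq: "arg_min_on (X x) A = (SOME a. a \<in> mins x)" for x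
    by (auto simp: arg_min_on_def arg_min_def is_arg_min_def mins_def not_less Ball_def)
  have mins: "mins \<in> measurable M (count_space (Pow A))"
  proof (subst measurable_count_space_eq2, use assms(1) in simp, intro conjI ballI)
    show "mins \<in> space M \<rightarrow> Pow A" by (auto simp: mins_def)
    fix B assume "B \<in> Pow A"
    then have Q: "{a \<in> A. Q a} = B \<longleftrightarrow> (\<forall>a\<in>A. (a \<in> B) = Q a)" for Q by blast
    have "mins -` {B} \<inter> space M = {x \<in> space M. mins x = B}" by auto
    also have "\<dots> = {x \<in> space M. \<forall>a\<in>A. (a \<in> B) = (\<forall>b\<in>A. X x a \<le> X x b)}"
      unfolding mins_def Q ..
    also have "\<dots> \<in> sets M"
    proof (intro sets.sets_Collect_finite_All assms(1))
      fix a assume a: "a \<in> A"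
      have "{x \<in> space M. X x a \<le> X x b} \<in> sets M" if "b \<in> A" for b
        by (rule borel_measurable_le[OF assms(3)[OF a] assms(3)[OF that]])
      then have *: "{x \<in> space M. \<forall>b\<in>A. X x a \<le> X x b} \<in> sets M"
        by (intro sets.sets_Collect_finite_All assms(1))
      then show "{x \<in> space M. (a \<in> B) = (\<forall>b\<in>A. X x a \<le> X x b)} \<in> sets M"
        using * sets.sets_Collect_neg[OF *] by (cases "a \<in> B") (simp_all only: simp_thms)
    qed
    finally show "mins -` {B} \<inter> space M \<in> sets M" .
  qed
  have "(\<lambda>B. SOME a. a \<in> B) \<in> measurable (count_space (Pow A)) (count_space UNIV)"
    unfolding measurable_count_space_eq1 by (rule Pi_I) simp
  from measurable_compose[OF mins this]
  have "(\<lambda>x. arg_min_on (X x) A) \<in> measurable M (count_space UNIV)" unfolding eq .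
  moreover have "(\<lambda>x. arg_min_on (X x) A) \<in> space M \<rightarrow> A"
    using arg_min_if_finite(1)[OF assms(1,2)] by blast
  ultimately show ?thesis using measurable_count_space_extend[OF subset_UNIV] by blast
qed

lemma measurable_median:
  assumes "G > 0" and [measurable]: "\<And>g. g < G \<Longrightarrow> X g \<in> borel_measurable M"
  shows "(\<lambda>x. median G (\<lambda>g. X g x)) \<in> borel_measurable M"
proof (subst borel_measurable_iff_le, intro allI)
  fix a
  have card_eq: "real (card {g. g < G \<and> X g x \<le> a}) = (\<Sum>g<G. if X g x \<le> a then 1 else 0)" for x
    by (subst sum.If_cases) (auto intro!: arg_cong[where f=card])
  have "{x \<in> space M. median G (\<lambda>g. X g x) \<le> a} =
     {x \<in> space M. real G \<le> 2 * (\<Sum>g<G. if X g x \<le> a then 1 else 0)}"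
    unfolding median_le_iff[OF assms(1)] card_eq[symmetric] by (rule Collect_cong) linarith
  also have "\<dots> \<in> sets M" by measurable
  finally show "{x \<in> space M. median G (\<lambda>g. X g x) \<le> a} \<in> sets M" .
qed

lemma measurable_noisy_oracle:
  assumes "sets D = sets borel"
  shows "(\<lambda>\<xi>. noisy_oracle N f \<xi> T) \<in> borel_measurable (noise_space N D)"
proof (cases "T \<subseteq> N")
  case True
  then have "(\<lambda>\<xi>. \<xi> T) \<in> measurable (noise_space N D) D"
    unfolding noise_space_def by (intro measurable_component_singleton) auto
  then have [measurable]: "(\<lambda>\<xi>. \<xi> T) \<in> borel_measurable (noise_space N D)"
    using measurable_cong_sets[OF refl assms] by blast
  show ?thesis using True unfolding noisy_oracle_def by simp
qed (simp add: noisy_oracle_def)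

lemma measurable_sample_mean:
  assumes "sets D = sets borel"
  shows "(\<lambda>\<xi>. sample_mean s \<theta> (noisy_oracle N f \<xi>) B) \<in> borel_measurable (noise_space N D)"
  unfolding sample_mean_def
  by (intro borel_measurable_divide borel_measurable_sum borel_measurable_max
      borel_measurable_const measurable_noisy_oracle assms)

lemma measurable_estimate:
  assumes "sets D = sets borel" "G > 0"
  shows "(\<lambda>\<xi>. estimate G s \<omega> (noisy_oracle N f \<xi>) B) \<in> borel_measurable (noise_space N D)"
  unfolding estimate_def by (rule measurable_median[OF assms(2) measurable_sample_mean[OF assms(1)]])

text \<open>The next base depends on the noise directly and through the current base. The latter
  ranges over a finite set, so it is enough that the step is measurable for each fixed base.\<close>

lemma measurable_search_path:
  assumes m: "matroid N I" and r: "matroid_rank I > 0" and S: "basis I S"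
    and e: "\<And>B. (\<lambda>x. e x B) \<in> borel_measurable M"
  shows "(\<lambda>x. search_path N I (e x) S j) \<in> measurable M (count_space {B. basis I B})"
proof (induction j)
  case 0
  then show ?case using S by (simp add: search_path_def)
next
  case (Suc j)
  have fin: "finite {B. basis I B}"
    using matroid_finite(2)[OF m] by (rule finite_subset[rotated]) (auto dest: basis_in)
  show ?case unfolding search_path_Suc(1)
  proof (rule measurable_compose_countable'[OF _ Suc])
    fix B assume "B \<in> {B. basis I B}"
    then have B: "basis I B" by simp
    then have BN: "B \<subseteq> N" "B \<noteq> {}"
      using matroid_subset[OF m basis_in] basis_card[OF m B] r by auto
    note nb = finite_neighbours(1)[OF matroid_finite(1)[OF m] BN(1)] self_neighbour[OF B BN(2,1)]
    have "(\<lambda>x. best_swap N I (e x) B) \<in> measurable M (count_space (neighbours N I B))"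
      unfolding best_swap_def using nb e by (intro measurable_arg_min_on) auto
    from measurable_compose[OF this, of "\<lambda>B. B" "count_space {B. basis I B}"]
    show "(\<lambda>x. best_swap N I (e x) B) \<in> measurable M (count_space {B. basis I B})"
      by (auto simp: neighbours_def)
  qed (use fin in \<open>rule countable_finite\<close>)
qed

lemma measurable_search_result:
  assumes m: "matroid N I" and r: "matroid_rank I > 0" and S: "basis I S" and J: "J > 0"
    and e: "\<And>B. (\<lambda>x. e x B) \<in> borel_measurable M"
  shows "(\<lambda>x. search_result N I J (e x) S) \<in> measurable M (count_space {B. basis I B})"
proof -
  have fin: "finite {B. basis I B}"
    using matroid_finite(2)[OF m] by (rule finite_subset[rotated]) (auto dest: basis_in)
  have ms: "(\<lambda>x. search_path N I (e x) S j) \<in> measurable M (count_space {B. basis I B})" for j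
    by (rule measurable_search_path[OF m r S e])
  have path: "(\<lambda>x. e x (search_path N I (e x) S j)) \<in> borel_measurable M" for j
    by (rule measurable_compose_countable'[OF e ms countable_finite[OF fin]])
  have gain: "(\<lambda>x. swap_gain N I (e x) (search_path N I (e x) S j)) \<in> borel_measurable M" for j
    unfolding swap_gain_def search_path_Suc(1)[symmetric]
    by (intro borel_measurable_diff path)
  have "(\<lambda>x. arg_min_on (\<lambda>j. swap_gain N I (e x) (search_path N I (e x) S j)) {..<J})
      \<in> measurable M (count_space {..<J})"
    using J gain by (intro measurable_arg_min_on) auto
  from measurable_compose_countable'[OF ms this] show ?thesis
    unfolding search_result_def by simp
qed

text \<open>Bias-variance decomposition: \<open>c\<close> is the bias, and the cross terms vanish by
  centring and independence. It serves both the noise, where the bias stems from the templates, and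
  the drawing of templates, where c = 0.\<close>

lemma (in prob_space) indep_sum_second_moment:
  fixes Y :: "'i \<Rightarrow> 'a \<Rightarrow> real"
  assumes A: "finite A" and ind: "indep_vars (\<lambda>_. borel) Y A"
    and sq: "\<And>i. i \<in> A \<Longrightarrow> integrable M (\<lambda>x. (Y i x)\<^sup>2)"
    and mean: "\<And>i. i \<in> A \<Longrightarrow> expectation (Y i) = 0"
  shows "integrable M (\<lambda>x. (c + (\<Sum>i\<in>A. a i * Y i x))\<^sup>2)"
    and "expectation (\<lambda>x. (c + (\<Sum>i\<in>A. a i * Y i x))\<^sup>2) = c\<^sup>2 + (\<Sum>i\<in>A. (a i)\<^sup>2 * expectation (\<lambda>x. (Y i x)\<^sup>2))"
proof -
  have rv: "Y i \<in> borel_measurable M" if "i \<in> A" for i using ind that by (auto simp: indep_vars_def)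
  have int: "integrable M (Y i)" if "i \<in> A" for i
    using square_integrable_imp_integrable[OF rv[OF that] sq[OF that]] .
  have cross: "integrable M (\<lambda>x. Y i x * Y j x)" "i \<noteq> j \<Longrightarrow> expectation (\<lambda>x. Y i x * Y j x) = 0"
    if ij: "i \<in> A" "j \<in> A" for i j
  proof -
    show "integrable M (\<lambda>x. Y i x * Y j x)"
    proof (cases "i = j")
      case True
      then show ?thesis using sq[OF ij(1)] by (simp add: power2_eq_square)
    next
      case False
      then show ?thesis
        using indep_vars_integrable[of "{i, j}" Y] indep_vars_subset[OF ind, of "{i, j}"] ij int by auto
    qed
    show "expectation (\<lambda>x. Y i x * Y j x) = 0" if "i \<noteq> j"
      using indep_vars_lebesgue_integral[of "{i, j}" Y] indep_vars_subset[OF ind, of "{i, j}"] ij int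
        mean[OF ij(1)] that by auto
  qed
  have eq: "(c + (\<Sum>i\<in>A. a i * Y i x))\<^sup>2 =
     c\<^sup>2 + 2 * c * (\<Sum>i\<in>A. a i * Y i x) + (\<Sum>i\<in>A. \<Sum>j\<in>A. a i * a j * (Y i x * Y j x))" for x
    by (simp add: power2_sum power2_eq_square[of "sum _ _"] sum_product mult_ac)
  show "integrable M (\<lambda>x. (c + (\<Sum>i\<in>A. a i * Y i x))\<^sup>2)"
    unfolding eq using int cross(1) by (intro Bochner_Integration.integrable_add Bochner_Integration.integrable_sum
      integrable_mult_right integrable_const) auto
  have "expectation (\<lambda>x. (c + (\<Sum>i\<in>A. a i * Y i x))\<^sup>2) =
     c\<^sup>2 + 2 * c * (\<Sum>i\<in>A. a i * expectation (Y i)) + (\<Sum>i\<in>A. \<Sum>j\<in>A. a i * a j * expectation (\<lambda>x. Y i x * Y j x))"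
    unfolding eq using int cross(1) by (simp add: prob_space Bochner_Integration.integral_sum)
  also have "(\<Sum>i\<in>A. \<Sum>j\<in>A. a i * a j * expectation (\<lambda>x. Y i x * Y j x)) =
     (\<Sum>i\<in>A. \<Sum>j\<in>A. if j = i then (a i)\<^sup>2 * expectation (\<lambda>x. (Y i x)\<^sup>2) else 0)"
    by (intro sum.cong refl) (auto simp: cross(2) power2_eq_square)
  also have "\<dots> = (\<Sum>i\<in>A. (a i)\<^sup>2 * expectation (\<lambda>x. (Y i x)\<^sup>2))"
    using A by (simp add: sum.delta')
  finally show "expectation (\<lambda>x. (c + (\<Sum>i\<in>A. a i * Y i x))\<^sup>2) =
      c\<^sup>2 + (\<Sum>i\<in>A. (a i)\<^sup>2 * expectation (\<lambda>x. (Y i x)\<^sup>2))"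
    using mean by simp
qed

lemma (in prob_space) second_moment_bound:
  fixes Z :: "'a \<Rightarrow> real"
  assumes [measurable]: "Z \<in> borel_measurable M" and "integrable M (\<lambda>x. (Z x)\<^sup>2)" "d > 0"
  shows "prob {x \<in> space M. \<bar>Z x\<bar> > d} \<le> expectation (\<lambda>x. (Z x)\<^sup>2) / d\<^sup>2"
proof -
  have "prob {x \<in> space M. \<bar>Z x\<bar> > d} \<le> prob {x \<in> space M. d\<^sup>2 \<le> (Z x)\<^sup>2}"
    using assms(3) by (intro finite_measure_mono) (auto simp: abs_le_square_iff[symmetric])
  also have "\<dots> \<le> expectation (\<lambda>x. (Z x)\<^sup>2) / d\<^sup>2"
    using assms by (intro integral_Markov_inequality_measure[where A="{}"]) auto
  finally show ?thesis .
qed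

section \<open>Noise moments and deviation of sample means\<close>

definition positive_mean :: "real measure \<Rightarrow> real" where
  "positive_mean D = (LINT x|D. max 0 x)"

definition positive_moment :: "real measure \<Rightarrow> real" where
  "positive_moment D = (LINT x|D. (max 0 x)\<^sup>2)"

text \<open>The positive part has mean at least that of the noise, which is 1. This lower bound on
  the unknown scale later allows additive errors to be absorbed into it.\<close>

lemma noise_positive_part:
  assumes "noise_distribution D"
  shows "integrable D (max 0)" "positive_mean D \<ge> 1" "positive_moment D \<ge> 0"
    "integrable D (\<lambda>x. (max 0 x - positive_mean D)\<^sup>2)"
    "(LINT x|D. (max 0 x - positive_mean D)\<^sup>2) \<le> positive_moment D"
proof -
  interpret prob_space D using assms by (simp add: noise_distribution_def)
  have D: "sets D = sets borel" "integrable D (\<lambda>x. x)" "(LINT x|D. x) = 1"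
    using assms by (auto simp: noise_distribution_def)
  note [measurable_cong] = D(1)
  have sq: "integrable D (\<lambda>x. (max 0 x)\<^sup>2)" by (rule noise_square_integrable[OF assms])
  show int: "integrable D (max 0)"
    by (rule square_integrable_imp_integrable[OF _ sq]) measurable
  have "(LINT x|D. x) \<le> (LINT x|D. max 0 x)"
    using int D(2) by (intro integral_mono) auto
  then show "positive_mean D \<ge> 1" using D(3) by (simp add: positive_mean_def)
  show "positive_moment D \<ge> 0" by (simp add: positive_moment_def)
  have eq: "(max 0 x - positive_mean D)\<^sup>2 = (max 0 x)\<^sup>2 - 2 * positive_mean D * max 0 x + (positive_mean D)\<^sup>2" for x
    by (simp add: power2_diff)
  show "integrable D (\<lambda>x. (max 0 x - positive_mean D)\<^sup>2)"
    unfolding eq using int sq by (intro Bochner_Integration.integrable_add Bochner_Integration.integrable_diff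
      integrable_mult_right integrable_const)
  have "(LINT x|D. (max 0 x - positive_mean D)\<^sup>2) = positive_moment D - (positive_mean D)\<^sup>2"
    using variance_eq[OF int sq] by (simp add: positive_mean_def positive_moment_def)
  then show "(LINT x|D. (max 0 x - positive_mean D)\<^sup>2) \<le> positive_moment D" by simp
qed

lemma noise_space_prob: "noise_distribution D \<Longrightarrow> prob_space (noise_space N D)"
  unfolding noise_space_def by (intro prob_space_PiM) (simp add: noise_distribution_def)

lemma noise_component:
  assumes "noise_distribution D" "T \<subseteq> N"
  shows "distr (noise_space N D) D (\<lambda>\<xi>. \<xi> T) = D" "(\<lambda>\<xi>. \<xi> T) \<in> measurable (noise_space N D) D"
  using assms unfolding noise_space_def
  by (auto intro!: distr_PiM_component simp: noise_distribution_def)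

lemma noise_indep:
  assumes D: "noise_distribution D"
  shows "prob_space.indep_vars (noise_space N D) (\<lambda>_. D) (\<lambda>T \<xi>. \<xi> T) (Pow N)"
proof -
  interpret prob_space "noise_space N D" by (rule noise_space_prob[OF D])
  \<comment> \<open>Points of the product space are extensional, so restriction to
    \<open>Pow N\<close> is the identity there.\<close>
  have "distr (noise_space N D) (Pi\<^sub>M (Pow N) (\<lambda>_. D)) (\<lambda>\<xi>. \<lambda>T\<in>Pow N. \<xi> T) =
     distr (noise_space N D) (noise_space N D) (\<lambda>\<xi>. \<xi>)"
    unfolding noise_space_def
    by (rule distr_cong) (auto simp: space_PiM PiE_def extensional_def restrict_def)
  also have "\<dots> = noise_space N D" by (rule distr_id)
  also have "\<dots> = Pi\<^sub>M (Pow N) (\<lambda>T. distr (noise_space N D) D (\<lambda>\<xi>. \<xi> T))"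
    unfolding noise_space_def[of N D] using noise_component(1)[OF D, of _ N]
    by (intro PiM_cong refl) (simp add: noise_space_def)
  finally show ?thesis
    using noise_component(2)[OF D] by (subst indep_vars_iff_distr_eq_PiM') auto
qed

lemma inj_on_template_image:
  assumes "finite B"
  shows "inj_on ((`) (from_nat_into B)) (Pow {..<card B})"
    "\<tau> \<subseteq> {..<card B} \<Longrightarrow> from_nat_into B ` \<tau> \<subseteq> B"
  using bij_betw_from_nat_into_finite[OF assms]
  by (auto simp: bij_betw_def inj_on_image_Pow)

text \<open>For fixed distinct templates the error splits into a bias, the gap between the template
  average of \<open>f\<close> and \<Phi>, and a sum of independent centred noise terms; Chebyshev's
  inequality bounds the total. The bias stays explicit because the templates are averaged over
  later.\<close>

lemma sample_mean_deviation:
  assumes D: "noise_distribution D" and N: "finite N" "B \<subseteq> N"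
    and \<theta>: "inj_on \<theta> {..<s}" "\<And>i. i < s \<Longrightarrow> \<theta> i \<subseteq> {..<card B}" and s: "s > 0" and d: "d > 0"
    and f: "\<And>T. T \<subseteq> B \<Longrightarrow> 0 \<le> f T \<and> f T \<le> V"
  shows "measure (noise_space N D)
     {\<xi> \<in> space (noise_space N D). \<bar>sample_mean s \<theta> (noisy_oracle N f \<xi>) B - positive_mean D * \<Phi>\<bar> > d}
     \<le> (positive_moment D * V\<^sup>2 / s
         + (positive_mean D)\<^sup>2 * ((\<Sum>i<s. f (from_nat_into B ` \<theta> i)) / s - \<Phi>)\<^sup>2) / d\<^sup>2"
proof -
  interpret prob_space "noise_space N D" by (rule noise_space_prob[OF D])
  let ?\<mu> = "positive_mean D"
  have sD: "sets D = sets borel" using D by (simp add: noise_distribution_def)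
  define T where "T i = from_nat_into B ` \<theta> i" for i
  have finB: "finite B" using N finite_subset by blast
  have TB: "T i \<subseteq> B" if "i < s" for i
    unfolding T_def using inj_on_template_image(2)[OF finB \<theta>(2)[OF that]] .
  have injT: "inj_on T {..<s}"
    unfolding T_def using comp_inj_on[OF \<theta>(1) inj_on_subset[OF inj_on_template_image(1)[OF finB]]] \<theta>(2)
    by (auto simp: comp_def)
  define A where "A = T ` {..<s}"
  have A: "finite A" "A \<subseteq> Pow N" "card A = s" using TB N card_image[OF injT] by (auto simp: A_def)
  define Y where "Y U \<xi> = max 0 (\<xi> U) - ?\<mu>" for U and \<xi> :: "'a set \<Rightarrow> real"
  define a where "a U = f U / real s" for U
  define c where "c = ?\<mu> * ((\<Sum>i<s. f (T i)) / s - \<Phi>)"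
  have g: "(\<lambda>x. max 0 x - ?\<mu>) \<in> borel_measurable D"
    unfolding measurable_cong_sets[OF sD refl] by measurable
  have "indep_vars (\<lambda>_. borel) Y (Pow N)"
    unfolding Y_def by (rule indep_vars_compose2[OF noise_indep[OF D] g])
  then have ind: "indep_vars (\<lambda>_. borel) Y A" by (rule indep_vars_subset[OF _ A(2)])
  have transfer: "integrable (noise_space N D) (\<lambda>\<xi>. h (\<xi> U)) \<longleftrightarrow> integrable D h"
      "expectation (\<lambda>\<xi>. h (\<xi> U)) = (LINT x|D. h x)"
    if "h \<in> borel_measurable D" "U \<in> A" for h :: "real \<Rightarrow> real" and U
    using integrable_distr_eq[OF noise_component(2)[OF D] that(1), of U N]
      integral_distr[OF noise_component(2)[OF D] that(1), of U N]
      noise_component(1)[OF D, of U N] that(2) A(2) by auto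
  have mean: "expectation (Y U) = 0" if "U \<in> A" for U
  proof -
    have "expectation (Y U) = (LINT x|D. max 0 x - ?\<mu>)"
      unfolding Y_def by (rule transfer(2)[OF g that])
    also have "\<dots> = (LINT x|D. max 0 x) - (LINT x|D. ?\<mu>)"
      using noise_positive_part(1)[OF D] D
      by (intro Bochner_Integration.integral_diff) (auto simp: noise_distribution_def prob_space_def intro!: finite_measure.integrable_const)
    also have "\<dots> = 0"
      using prob_space.prob_space[of D] D by (simp add: positive_mean_def noise_distribution_def)
    finally show ?thesis .
  qed
  have g2: "(\<lambda>x. (max 0 x - ?\<mu>)\<^sup>2) \<in> borel_measurable D" using g by simp
  have sq: "integrable (noise_space N D) (\<lambda>\<xi>. (Y U \<xi>)\<^sup>2)"
    and var: "expectation (\<lambda>\<xi>. (Y U \<xi>)\<^sup>2) \<le> positive_moment D" if "U \<in> A" for U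
    using noise_positive_part(4,5)[OF D] transfer[OF g2 that] unfolding Y_def by auto
  have eq: "sample_mean s \<theta> (noisy_oracle N f \<xi>) B - ?\<mu> * \<Phi> = c + (\<Sum>U\<in>A. a U * Y U \<xi>)" for \<xi>
  proof -
    have "max 0 (noisy_oracle N f \<xi> (T i)) = f (T i) * max 0 (\<xi> (T i))" if "i < s" for i
      using f[OF TB[OF that]] TB[OF that] N(2)
      by (auto simp: noisy_oracle_def max_def zero_le_mult_iff mult_le_0_iff)
    then have "sample_mean s \<theta> (noisy_oracle N f \<xi>) B = (\<Sum>i<s. f (T i) * max 0 (\<xi> (T i))) / s"
      by (simp add: sample_mean_def T_def)
    moreover have "(\<Sum>U\<in>A. a U * Y U \<xi>) = (\<Sum>i<s. a (T i) * Y (T i) \<xi>)"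
      unfolding A_def by (rule sum.reindex_cong[OF injT]) auto
    moreover have "\<dots> = (\<Sum>i<s. f (T i) * max 0 (\<xi> (T i))) / s - ?\<mu> * ((\<Sum>i<s. f (T i)) / s)"
      unfolding a_def Y_def by (simp add: sum_divide_distrib sum_distrib_left sum_subtractf[symmetric] field_simps)
    ultimately show ?thesis by (simp add: c_def algebra_simps)
  qed
  have "prob {\<xi> \<in> space (noise_space N D). \<bar>c + (\<Sum>U\<in>A. a U * Y U \<xi>)\<bar> > d} \<le>
     expectation (\<lambda>\<xi>. (c + (\<Sum>U\<in>A. a U * Y U \<xi>))\<^sup>2) / d\<^sup>2"
    using ind by (intro second_moment_bound indep_sum_second_moment(1)[OF A(1) ind sq mean] d)
      (auto simp: indep_vars_def intro!: borel_measurable_add borel_measurable_sum borel_measurable_times)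
  also have "expectation (\<lambda>\<xi>. (c + (\<Sum>U\<in>A. a U * Y U \<xi>))\<^sup>2) =
     c\<^sup>2 + (\<Sum>U\<in>A. (a U)\<^sup>2 * expectation (\<lambda>x. (Y U x)\<^sup>2))"
    by (rule indep_sum_second_moment(2)[OF A(1) ind sq mean])
  also have "(\<Sum>U\<in>A. (a U)\<^sup>2 * expectation (\<lambda>x. (Y U x)\<^sup>2)) \<le> (\<Sum>U\<in>A. (V / s)\<^sup>2 * positive_moment D)"
  proof (intro sum_mono mult_mono var)
    fix U assume "U \<in> A"
    then have "U \<subseteq> B" using TB by (auto simp: A_def)
    then show "(a U)\<^sup>2 \<le> (V / s)\<^sup>2"
      unfolding a_def using f[of U] s by (intro power_mono divide_right_mono) auto
  qed (auto intro!: integral_nonneg_AE)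
  also have "\<dots> = positive_moment D * V\<^sup>2 / s"
    using A(3) s by (simp add: power2_eq_square)
  finally show ?thesis
    unfolding eq using d by (simp add: c_def T_def power_mult_distrib divide_right_mono add.commute)
qed

text \<open>Kept as a function of the templates: the noise is integrated out first, products over
  groups are formed, and only then is the expectation over the templates taken.\<close>

definition mean_error_bound ::
  "real measure \<Rightarrow> nat \<Rightarrow> real \<Rightarrow> real \<Rightarrow> ('a set \<Rightarrow> real) \<Rightarrow> 'a set \<Rightarrow> real \<Rightarrow> (nat \<Rightarrow> nat set) \<Rightarrow> real" where
  "mean_error_bound D s V d f B \<Phi> \<theta> = (positive_moment D * V\<^sup>2 / s
     + (positive_mean D)\<^sup>2 * ((\<Sum>i<s. f (from_nat_into B ` \<theta> i)) / s - \<Phi>)\<^sup>2) / d\<^sup>2"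

definition majorities :: "nat \<Rightarrow> nat set set" where
  "majorities G = {J. J \<subseteq> {..<G} \<and> G \<le> 2 * card J}"

lemma majorities: "finite (majorities G)" "card (majorities G) \<le> 2 ^ G"
proof -
  have sub: "majorities G \<subseteq> Pow {..<G}" by (auto simp: majorities_def)
  then show "finite (majorities G)" by (rule finite_subset) simp
  show "card (majorities G) \<le> 2 ^ G" using card_mono[OF _ sub] by (simp add: card_Pow)
qed

text \<open>Distinct templates give distinct subsets of \<open>B\<close>, so different groups read
  disjoint sets of noise coordinates.\<close>

lemma indep_sample_means:
  assumes D: "noise_distribution D" and N: "finite N" "B \<subseteq> N"
    and \<omega>: "inj_on (\<lambda>(g, i). \<omega> g i) ({..<G} \<times> {..<s})"
      "\<And>g i. g < G \<Longrightarrow> i < s \<Longrightarrow> \<omega> g i \<subseteq> {..<card B}"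
  shows "prob_space.indep_vars (noise_space N D) (\<lambda>_. borel)
    (\<lambda>g \<xi>. sample_mean s (\<omega> g) (noisy_oracle N f \<xi>) B) {..<G}"
proof -
  interpret prob_space "noise_space N D" by (rule noise_space_prob[OF D])
  have sD: "sets D = sets borel" using D by (simp add: noise_distribution_def)
  have finB: "finite B" using N finite_subset by blast
  define T where "T g i = from_nat_into B ` \<omega> g i" for g i
  define K where "K g = T g ` {..<s}" for g
  have TN: "T g i \<subseteq> N" if "g < G" "i < s" for g i
    using inj_on_template_image(2)[OF finB \<omega>(2)[OF that]] N(2) unfolding T_def by blast
  have "T g i \<noteq> T g' i'" if "g < G" "g' < G" "g \<noteq> g'" "i < s" "i' < s" for g g' i i'
  proof
    assume "T g i = T g' i'"
    then have "\<omega> g i = \<omega> g' i'"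
      unfolding T_def using inj_onD[OF inj_on_template_image(1)[OF finB]] \<omega>(2) that by simp
    then show False using inj_onD[OF \<omega>(1), of "(g, i)" "(g', i')"] that by simp
  qed
  then have disj: "disjoint_family_on K {..<G}"
    unfolding disjoint_family_on_def K_def by (auto simp: lessThan_def)
  have KN: "K g \<subseteq> Pow N" if "g \<in> {..<G}" for g using TN that by (auto simp: K_def)
  define Y where "Y g \<rho> = (\<Sum>i<s. max 0 (\<rho> (T g i) * f (T g i))) / real s" for g and \<rho> :: "'a set \<Rightarrow> real"
  have Y: "Y g \<in> measurable (PiM (K g) (\<lambda>_. D)) borel" for g
  proof -
    have "(\<lambda>\<rho>. \<rho> (T g i)) \<in> borel_measurable (PiM (K g) (\<lambda>_. D))" if "i < s" for i
    proof -
      have "(\<lambda>\<rho>. \<rho> (T g i)) \<in> measurable (PiM (K g) (\<lambda>_. D)) D"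
        using that by (intro measurable_component_singleton) (auto simp: K_def)
      then show ?thesis using measurable_cong_sets[OF refl sD] by blast
    qed
    then show ?thesis unfolding Y_def
      by (intro borel_measurable_divide borel_measurable_sum borel_measurable_max
          borel_measurable_times borel_measurable_const) auto
  qed
  have "indep_vars (\<lambda>_. borel) (\<lambda>g \<xi>. Y g (restrict (\<lambda>U. \<xi> U) (K g))) {..<G}"
    by (rule indep_vars_compose2[OF indep_vars_restrict[OF noise_indep[OF D] KN disj] Y])
  then show ?thesis
  proof (rule iffD1[OF indep_vars_cong, rotated -1])
    fix g assume g: "g \<in> {..<G}"
    show "(\<lambda>\<xi>. Y g (restrict (\<lambda>U. \<xi> U) (K g))) = (\<lambda>\<xi>. sample_mean s (\<omega> g) (noisy_oracle N f \<xi>) B)"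
    proof
      fix \<xi>
      have "(\<Sum>i<s. max 0 (restrict (\<lambda>U. \<xi> U) (K g) (T g i) * f (T g i))) =
         (\<Sum>i<s. max 0 (noisy_oracle N f \<xi> (T g i)))"
        using TN g by (intro sum.cong refl) (auto simp: K_def noisy_oracle_def)
      then show "Y g (restrict (\<lambda>U. \<xi> U) (K g)) = sample_mean s (\<omega> g) (noisy_oracle N f \<xi>) B"
        unfolding Y_def sample_mean_def T_def by simp
    qed
  qed auto
qed

text \<open>A bad median forces at least half of the independent group means to be bad.\<close>

lemma estimate_deviation:
  assumes D: "noise_distribution D" and N: "finite N" "B \<subseteq> N"
    and \<omega>: "inj_on (\<lambda>(g, i). \<omega> g i) ({..<G} \<times> {..<s})"
      "\<And>g i. g < G \<Longrightarrow> i < s \<Longrightarrow> \<omega> g i \<subseteq> {..<card B}"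
    and s: "s > 0" and G: "G > 0" and d: "d > 0"
    and f: "\<And>T. T \<subseteq> B \<Longrightarrow> 0 \<le> f T \<and> f T \<le> V"
  shows "measure (noise_space N D)
     {\<xi> \<in> space (noise_space N D). \<bar>estimate G s \<omega> (noisy_oracle N f \<xi>) B - positive_mean D * \<Phi>\<bar> > d}
     \<le> (\<Sum>J\<in>majorities G. \<Prod>g\<in>J. mean_error_bound D s V d f B \<Phi> (\<omega> g))"
proof -
  let ?M = "noise_space N D"
  interpret prob_space ?M by (rule noise_space_prob[OF D])
  have sD: "sets D = sets borel" using D by (simp add: noise_distribution_def)
  define c where "c = positive_mean D * \<Phi>"
  define X where "X g \<xi> = sample_mean s (\<omega> g) (noisy_oracle N f \<xi>) B" for g \<xi>
  have X: "X g \<in> borel_measurable ?M" for g unfolding X_def by (rule measurable_sample_mean[OF sD])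
  define E where "E g = {\<xi> \<in> space ?M. \<bar>X g \<xi> - c\<bar> > d}" for g
  have E: "E g \<in> sets ?M" for g unfolding E_def using X by measurable
  have vim: "X g -` {x. \<bar>x - c\<bar> > d} \<inter> space ?M = E g" for g unfolding E_def by auto
  have Jne: "J \<noteq> {}" "finite J" "J \<subseteq> {..<G}" if "J \<in> majorities G" for J
    using that G finite_subset[of J "{..<G}"] by (auto simp: majorities_def)
  have sub: "{\<xi> \<in> space ?M. \<bar>estimate G s \<omega> (noisy_oracle N f \<xi>) B - c\<bar> > d}
      \<subseteq> (\<Union>J\<in>majorities G. \<Inter>g\<in>J. E g)"
  proof
    fix \<xi> assume \<xi>: "\<xi> \<in> {\<xi> \<in> space ?M. \<bar>estimate G s \<omega> (noisy_oracle N f \<xi>) B - c\<bar> > d}"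
    define J where "J = {g. g < G \<and> \<bar>X g \<xi> - c\<bar> > d}"
    have "\<not> 2 * card J < G"
      using median_close[where G = G and X = "\<lambda>g. X g \<xi>" and c = c and d = d] \<xi> unfolding J_def X_def estimate_def by auto
    then have "J \<in> majorities G" by (auto simp: majorities_def J_def)
    moreover have "\<xi> \<in> E g" if "g \<in> J" for g using that \<xi> by (auto simp: J_def E_def)
    ultimately show "\<xi> \<in> (\<Union>J\<in>majorities G. \<Inter>g\<in>J. E g)" by blast
  qed
  have "prob {\<xi> \<in> space ?M. \<bar>estimate G s \<omega> (noisy_oracle N f \<xi>) B - c\<bar> > d}
      \<le> prob (\<Union>J\<in>majorities G. \<Inter>g\<in>J. E g)"
    using sub E Jne majorities(1) by (intro finite_measure_mono sets.finite_UN sets.finite_INT) auto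
  also have "\<dots> \<le> (\<Sum>J\<in>majorities G. prob (\<Inter>g\<in>J. E g))"
    using E Jne majorities(1) by (intro finite_measure_subadditive_finite) (auto intro!: sets.finite_INT)
  also have "\<dots> \<le> (\<Sum>J\<in>majorities G. \<Prod>g\<in>J. mean_error_bound D s V d f B \<Phi> (\<omega> g))"
  proof (rule sum_mono)
    fix J assume J: "J \<in> majorities G"
    have "prob (\<Inter>g\<in>J. X g -` {x. \<bar>x - c\<bar> > d} \<inter> space ?M) = (\<Prod>g\<in>J. prob (X g -` {x. \<bar>x - c\<bar> > d} \<inter> space ?M))"
      unfolding X_def using Jne[OF J]
      by (intro indep_varsD[OF indep_sample_means[OF D N \<omega>]]) auto
    then have "prob (\<Inter>g\<in>J. E g) = (\<Prod>g\<in>J. prob (E g))" unfolding vim .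
    also have "\<dots> \<le> (\<Prod>g\<in>J. mean_error_bound D s V d f B \<Phi> (\<omega> g))"
    proof (intro prod_mono conjI)
      fix g assume "g \<in> J"
      then have g: "g < G" using Jne[OF J] by auto
      have inj: "inj_on (\<omega> g) {..<s}"
      proof (rule inj_onI)
        fix i j assume "i \<in> {..<s}" "j \<in> {..<s}" "\<omega> g i = \<omega> g j"
        then show "i = j" using inj_onD[OF \<omega>(1), of "(g, i)" "(g, j)"] g by simp
      qed
      show "prob (E g) \<le> mean_error_bound D s V d f B \<Phi> (\<omega> g)"
        unfolding E_def X_def c_def mean_error_bound_def
        by (rule sample_mean_deviation[OF D N inj \<omega>(2)[OF g] s d f])
    qed simp
    finally show "prob (\<Inter>g\<in>J. E g) \<le> (\<Prod>g\<in>J. mean_error_bound D s V d f B \<Phi> (\<omega> g))" .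
  qed
  finally show ?thesis unfolding c_def .
qed

section \<open>Random templates\<close>

definition template_pmf :: "nat \<Rightarrow> nat \<Rightarrow> nat set pmf" where
  "template_pmf t r = embed_pmf (\<lambda>\<tau>. if \<tau> \<subseteq> {..<r} then weight t r (card \<tau>) else 0)"

lemma pmf_template:
  assumes "1 \<le> t" "2 * t \<le> r"
  shows "pmf (template_pmf t r) \<tau> = (if \<tau> \<subseteq> {..<r} then weight t r (card \<tau>) else 0)"
  unfolding template_pmf_def
proof (rule pmf_embed_pmf)
  have "(\<integral>\<^sup>+\<tau>. ennreal (if \<tau> \<subseteq> {..<r} then weight t r (card \<tau>) else 0) \<partial>count_space UNIV) =
     (\<Sum>\<tau>\<in>Pow {..<r}. ennreal (if \<tau> \<subseteq> {..<r} then weight t r (card \<tau>) else 0))"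
    by (rule nn_integral_count_space'[of "Pow {..<r}"]) auto
  also have "\<dots> = ennreal (\<Sum>\<tau>\<in>Pow {..<r}. weight t r (card \<tau>))"
    by (subst sum_ennreal[symmetric]) (auto simp: weight_nonneg intro!: sum.cong)
  also have "\<dots> = 1" using sum_weight[OF assms, of "{..<r}"] by simp
  finally show "(\<integral>\<^sup>+\<tau>. ennreal (if \<tau> \<subseteq> {..<r} then weight t r (card \<tau>) else 0) \<partial>count_space UNIV) = 1" .
qed (simp add: weight_nonneg)

lemma set_template:
  assumes "1 \<le> t" "2 * t \<le> r"
  shows "set_pmf (template_pmf t r) \<subseteq> Pow {..<r}" "finite (set_pmf (template_pmf t r))"
proof -
  show sub: "set_pmf (template_pmf t r) \<subseteq> Pow {..<r}"
    by (auto simp: set_pmf_iff pmf_template[OF assms] split: if_splits)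
  show "finite (set_pmf (template_pmf t r))" by (rule finite_subset[OF sub]) simp
qed

text \<open>A level has mass at most 1, spread evenly over its sets, and by unimodality a level
  between t and r - t has at least \<open>r choose t\<close> of them. This is what the cuts at both
  ends achieve.\<close>

lemma pmf_template_le:
  assumes "1 \<le> t" "2 * t \<le> r"
  shows "pmf (template_pmf t r) \<tau> \<le> 1 / real (r choose t)"
proof (cases "\<tau> \<subseteq> {..<r} \<and> t \<le> card \<tau> \<and> card \<tau> \<le> r - t")
  case True
  let ?k = "card \<tau>"
  have W: "weight_sum t r > 0" by (rule weight_sum_pos[OF assms])
  have "real r / real ?k * growth r ?k \<le> weight_sum t r"
    unfolding weight_sum_def using True
    by (intro member_le_sum[where f = "\<lambda>k. real r / real k * growth r k"]
        mult_nonneg_nonneg less_imp_le[OF growth_pos]) auto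
  then have "real r / real ?k * growth r ?k / weight_sum t r \<le> 1"
    by (simp only: pos_divide_le_eq[OF W] mult_1)
  moreover have "(r choose t) \<le> (r choose ?k)"
  proof (cases "2 * ?k \<le> r")
    case False
    have "(r choose t) \<le> (r choose (r - ?k))" using True False by (intro binomial_mono) auto
    also have "\<dots> = (r choose ?k)" using True by (intro binomial_symmetric[symmetric]) auto
    finally show ?thesis .
  qed (use True in \<open>intro binomial_mono, auto\<close>)
  moreover have "0 < (r choose t)" using assms by simp
  ultimately have "real r / real ?k * growth r ?k / weight_sum t r / real (r choose ?k) \<le> 1 / real (r choose t)"
    by (intro frac_le) auto
  then show ?thesis using True by (simp add: pmf_template[OF assms] weight_def)
qed (auto simp: pmf_template[OF assms] weight_def)

lemma expectation_template:
  assumes "1 \<le> t" "2 * t \<le> r" "finite B" "card B = r"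
  shows "measure_pmf.expectation (template_pmf t r) (\<lambda>\<tau>. f (from_nat_into B ` \<tau>)) = potential (weight t r) f B"
proof -
  let ?e = "from_nat_into B"
  have bij: "bij_betw ?e {..<r} B" using bij_betw_from_nat_into_finite[OF assms(3)] assms(4) by simp
  have "measure_pmf.expectation (template_pmf t r) (\<lambda>\<tau>. f (?e ` \<tau>)) =
     (\<Sum>\<tau>\<in>Pow {..<r}. f (?e ` \<tau>) * pmf (template_pmf t r) \<tau>)"
    using set_template[OF assms(1,2)] by (intro integral_measure_pmf_real) auto
  also have "\<dots> = (\<Sum>\<tau>\<in>Pow {..<r}. weight t r (card (?e ` \<tau>)) * f (?e ` \<tau>))"
  proof (intro sum.cong refl)
    fix \<tau> assume "\<tau> \<in> Pow {..<r}"
    then have "card (?e ` \<tau>) = card \<tau>"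
      using bij by (intro card_image) (auto simp: bij_betw_def intro: inj_on_subset)
    then show "f (?e ` \<tau>) * pmf (template_pmf t r) \<tau> = weight t r (card (?e ` \<tau>)) * f (?e ` \<tau>)"
      using \<open>\<tau> \<in> Pow {..<r}\<close> by (simp add: pmf_template[OF assms(1,2)])
  qed
  also have "\<dots> = potential (weight t r) f B"
    unfolding potential_def by (rule sum.reindex_bij_betw[OF bij_betw_Pow[OF bij]])
  finally show ?thesis .
qed

lemma prob_bind_pmf:
  "measure_pmf.prob (bind_pmf p f) A = measure_pmf.expectation p (\<lambda>x. measure_pmf.prob (f x) A)"
proof -
  have int: "integrable p (\<lambda>x. measure_pmf.prob (f x) A)"
    by (intro measure_pmf.integrable_const_bound[of _ 1]) auto
  have "ennreal (measure_pmf.prob (bind_pmf p f) A) = (\<integral>\<^sup>+x. ennreal (measure_pmf.prob (f x) A) \<partial>p)"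
    by (simp add: measure_pmf.emeasure_eq_measure[symmetric])
  also have "\<dots> = ennreal (measure_pmf.expectation p (\<lambda>x. measure_pmf.prob (f x) A))"
    using int by (intro nn_integral_eq_integral) auto
  finally show ?thesis by (subst (asm) ennreal_inj) (auto intro!: integral_nonneg_AE)
qed

text \<open>Deferred decisions: coordinate \<open>x\<close> is drawn last, with all others fixed,
  and a bound uniform in the others survives averaging.\<close>

lemma prob_Pi_pmf_resample_le:
  assumes A: "finite A" "x \<in> A"
    and le: "\<And>\<omega>. measure_pmf.prob (p x) {y. fun_upd \<omega> x y \<in> S} \<le> q"
  shows "measure_pmf.prob (Pi_pmf A dflt p) S \<le> q"
proof -
  define A' where "A' = A - {x}"
  have A': "finite A'" "x \<notin> A'" "A = insert x A'" using A by (auto simp: A'_def)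
  have "Pi_pmf A dflt p = bind_pmf (Pi_pmf A' dflt p) (\<lambda>\<omega>. map_pmf (\<lambda>y. fun_upd \<omega> x y) (p x))"
    unfolding A'(3) Pi_pmf_insert'[OF A'(1,2)] map_pmf_def by (rule bind_commute_pmf)
  then have "measure_pmf.prob (Pi_pmf A dflt p) S =
     measure_pmf.expectation (Pi_pmf A' dflt p) (\<lambda>\<omega>. measure_pmf.prob (p x) {y. fun_upd \<omega> x y \<in> S})"
    by (simp add: prob_bind_pmf vimage_def)
  also have "\<dots> \<le> measure_pmf.expectation (Pi_pmf A' dflt p) (\<lambda>_. q)"
  proof (rule integral_mono)
    show "integrable (Pi_pmf A' dflt p) (\<lambda>\<omega>. measure_pmf.prob (p x) {y. fun_upd \<omega> x y \<in> S})"
      by (intro measure_pmf.integrable_const_bound[of _ 1]) auto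
  qed (rule measure_pmf.integrable_const, rule le)
  finally show ?thesis by simp
qed

definition samples_pmf :: "nat \<Rightarrow> nat \<Rightarrow> nat \<Rightarrow> nat \<Rightarrow> (nat \<Rightarrow> nat \<Rightarrow> nat set) pmf" where
  "samples_pmf t r G s =
     Pi_pmf {..<G} (\<lambda>_. {}) (\<lambda>_. Pi_pmf {..<s} {} (\<lambda>_. template_pmf t r))"

lemma finite_set_Pi_pmf:
  assumes "finite A" "\<And>x. x \<in> A \<Longrightarrow> finite (set_pmf (p x))"
  shows "finite (set_pmf (Pi_pmf A dflt p))"
  using assms by (auto simp: set_Pi_pmf intro!: finite_PiE_dflt)

lemma samples_pmf:
  assumes t: "1 \<le> t" "2 * t \<le> r"
  shows "finite (set_pmf (samples_pmf t r G s))"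
    "\<omega> \<in> set_pmf (samples_pmf t r G s) \<Longrightarrow> g < G \<Longrightarrow> i < s \<Longrightarrow> \<omega> g i \<subseteq> {..<r}"
proof -
  show "finite (set_pmf (samples_pmf t r G s))"
    unfolding samples_pmf_def using set_template[OF t] by (intro finite_set_Pi_pmf) auto
  assume "\<omega> \<in> set_pmf (samples_pmf t r G s)" "g < G" "i < s"
  then have "\<omega> g \<in> set_pmf (Pi_pmf {..<s} {} (\<lambda>_. template_pmf t r))"
    unfolding samples_pmf_def by (simp add: set_Pi_pmf PiE_dflt_def)
  then have "\<omega> g i \<in> set_pmf (template_pmf t r)" using \<open>i < s\<close>
    by (simp add: set_Pi_pmf PiE_dflt_def)
  then show "\<omega> g i \<subseteq> {..<r}" using set_template(1)[OF t] by auto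
qed

text \<open>Birthday bound over ordered pairs of positions. One sample of the pair is redrawn, by
  resampling first its group and then its entry within the group.\<close>

lemma prob_samples_collide:
  assumes t: "1 \<le> t" "2 * t \<le> r"
  shows "measure_pmf.prob (samples_pmf t r G s) {\<omega>. \<not> inj_on (\<lambda>(g, i). \<omega> g i) ({..<G} \<times> {..<s})}
    \<le> (real G * real s)\<^sup>2 / real (r choose t)"
proof -
  let ?P = "samples_pmf t r G s" and ?T = "template_pmf t r"
  let ?I = "{..<G} \<times> {..<s}"
  let ?C = "\<lambda>((g, i), (g', i')). {\<omega> :: nat \<Rightarrow> nat \<Rightarrow> nat set. \<omega> g i = \<omega> g' i'}"
  have pair: "measure_pmf.prob ?P (?C z) \<le> 1 / real (r choose t)"
    if z: "z \<in> {(x, y). x \<in> ?I \<and> y \<in> ?I \<and> x \<noteq> y}" for z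
  proof -
    obtain g i g' i' where z_eq: "z = ((g, i), (g', i'))" by (metis surj_pair)
    have lt: "g < G" "i < s" "g' < G" "i' < s" and ne: "(g, i) \<noteq> (g', i')" using z z_eq by auto
    have single: "measure_pmf.prob ?T {\<tau>. \<tau> = c} \<le> 1 / real (r choose t)" for c
      using pmf_template_le[OF t, of c] by (simp add: pmf.rep_eq)
    have "measure_pmf.prob ?P {\<omega>. \<omega> g i = \<omega> g' i'} \<le> 1 / real (r choose t)"
      unfolding samples_pmf_def
    proof (rule prob_Pi_pmf_resample_le[where x = g])
      fix \<omega> :: "nat \<Rightarrow> nat \<Rightarrow> nat set"
      show "measure_pmf.prob (Pi_pmf {..<s} {} (\<lambda>_. ?T)) {\<theta>. fun_upd \<omega> g \<theta> \<in> {\<omega>. \<omega> g i = \<omega> g' i'}} \<le> 1 / real (r choose t)"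
      proof (rule prob_Pi_pmf_resample_le[where x = i])
        fix \<theta> :: "nat \<Rightarrow> nat set"
        \<comment> \<open>The other sample of the pair, which redrawing entry i of group g leaves
          unchanged; it may belong to the same group.\<close>
        define c where "c = (if g' = g then \<theta> i' else \<omega> g' i')"
        have "{\<tau>. fun_upd \<theta> i \<tau> \<in> {\<theta>. fun_upd \<omega> g \<theta> \<in> {\<omega>. \<omega> g i = \<omega> g' i'}}} = {\<tau>. \<tau> = c}"
          using ne by (auto simp: c_def)
        then show "measure_pmf.prob ?T {\<tau>. fun_upd \<theta> i \<tau> \<in> {\<theta>. fun_upd \<omega> g \<theta> \<in> {\<omega>. \<omega> g i = \<omega> g' i'}}} \<le> 1 / real (r choose t)"
          using single by simp
      qed (use lt in auto)
    qed (use lt in auto)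
    then show ?thesis by (simp add: z_eq)
  qed
  let ?Z = "{(x, y). x \<in> ?I \<and> y \<in> ?I \<and> x \<noteq> y}"
  have Z: "finite ?Z" "card ?Z \<le> (G * s)\<^sup>2"
  proof -
    have sub: "?Z \<subseteq> ?I \<times> ?I" by auto
    show "finite ?Z" by (rule finite_subset[OF sub]) simp
    show "card ?Z \<le> (G * s)\<^sup>2"
      using card_mono[OF _ sub] by (simp add: card_cartesian_product power2_eq_square)
  qed
  have "{\<omega>. \<not> inj_on (\<lambda>(g, i). \<omega> g i) ?I} \<subseteq> (\<Union>z\<in>?Z. ?C z)"
  proof
    fix \<omega> :: "nat \<Rightarrow> nat \<Rightarrow> nat set"
    assume "\<omega> \<in> {\<omega>. \<not> inj_on (\<lambda>(g, i). \<omega> g i) ?I}"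
    moreover define F where "F = (\<lambda>(g, i). \<omega> g i)"
    ultimately have "\<not> inj_on F ?I" by simp
    then obtain x y where "x \<in> ?I" "y \<in> ?I" "x \<noteq> y" "F x = F y"
      unfolding inj_on_def by blast
    then have "(x, y) \<in> ?Z" "\<omega> \<in> ?C (x, y)" by (auto simp: F_def split: prod.splits)
    then show "\<omega> \<in> (\<Union>z\<in>?Z. ?C z)" by blast
  qed
  then have "measure_pmf.prob ?P {\<omega>. \<not> inj_on (\<lambda>(g, i). \<omega> g i) ?I} \<le> measure_pmf.prob ?P (\<Union>z\<in>?Z. ?C z)"
    by (intro measure_pmf.finite_measure_mono) auto
  also have "\<dots> \<le> (\<Sum>z\<in>?Z. measure_pmf.prob ?P (?C z))"
    using Z(1) by (intro measure_pmf.finite_measure_subadditive_finite) auto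
  also have "\<dots> \<le> (\<Sum>z\<in>?Z. 1 / real (r choose t))" by (rule sum_mono[OF pair])
  also have "\<dots> = real (card ?Z) * (1 / real (r choose t))" by simp
  also have "\<dots> \<le> real ((G * s)\<^sup>2) * (1 / real (r choose t))"
    using Z(2) by (intro mult_right_mono) (simp_all only: of_nat_le_iff, simp)
  finally show ?thesis by simp
qed

lemma template_mean_error:
  assumes p: "finite (set_pmf p)" and y: "\<And>\<tau>. \<tau> \<in> set_pmf p \<Longrightarrow> 0 \<le> y \<tau> \<and> y \<tau> \<le> (V :: real)" and s: "s > 0"
  shows "measure_pmf.expectation (Pi_pmf {..<s} dflt (\<lambda>_. p))
      (\<lambda>\<theta>. ((\<Sum>i<s. y (\<theta> i)) / real s - measure_pmf.expectation p y)\<^sup>2) \<le> V\<^sup>2 / s"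
proof -
  let ?P = "Pi_pmf {..<s} dflt (\<lambda>_. p)" and ?m = "measure_pmf.expectation p y"
  have fin: "finite (set_pmf ?P)" using p by (intro finite_set_Pi_pmf) auto
  have comp: "measure_pmf.expectation ?P (\<lambda>\<theta>. h (\<theta> i)) = measure_pmf.expectation p h" if "i < s" for i and h :: "'a \<Rightarrow> real"
  proof -
    have "measure_pmf.expectation (map_pmf (\<lambda>\<theta>. \<theta> i) ?P) h = measure_pmf.expectation ?P (\<lambda>\<theta>. h (\<theta> i))" by simp
    then show ?thesis using that by (simp add: Pi_pmf_component)
  qed
  have int: "integrable (measure_pmf p) h" for h :: "'a \<Rightarrow> real" by (rule integrable_measure_pmf_finite[OF p])
  define Y where "Y i \<theta> = y (\<theta> i) - ?m" for i :: nat and \<theta>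
  have ind: "prob_space.indep_vars ?P (\<lambda>_. borel) Y {..<s}"
    unfolding Y_def
    by (rule prob_space.indep_vars_compose2[OF measure_pmf.prob_space_axioms indep_vars_Pi_pmf]) auto
  have mean: "measure_pmf.expectation ?P (Y i) = 0" if "i \<in> {..<s}" for i
  proof -
    have "measure_pmf.expectation ?P (Y i) = measure_pmf.expectation p (\<lambda>\<tau>. y \<tau> - ?m)"
      unfolding Y_def using that by (intro comp) auto
    also have "\<dots> = 0" using int by simp
    finally show ?thesis .
  qed
  have var: "measure_pmf.expectation ?P (\<lambda>\<theta>. (Y i \<theta>)\<^sup>2) \<le> V\<^sup>2" if "i \<in> {..<s}" for i
  proof -
    have "measure_pmf.expectation ?P (\<lambda>\<theta>. (Y i \<theta>)\<^sup>2) = measure_pmf.expectation p (\<lambda>\<tau>. (y \<tau> - ?m)\<^sup>2)"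
      unfolding Y_def using that comp[of i "\<lambda>\<tau>. (y \<tau> - ?m)\<^sup>2"] by auto
    also have "\<dots> = measure_pmf.expectation p (\<lambda>\<tau>. (y \<tau>)\<^sup>2) - ?m\<^sup>2"
      using measure_pmf.variance_eq[OF int int] .
    also have "\<dots> \<le> measure_pmf.expectation p (\<lambda>\<tau>. (y \<tau>)\<^sup>2)" by simp
    also have "\<dots> \<le> measure_pmf.expectation p (\<lambda>_. V\<^sup>2)"
      using y by (intro integral_mono_AE int AE_pmfI power_mono) auto
    finally show ?thesis by simp
  qed
  have eq: "(\<Sum>i<s. y (\<theta> i)) / real s - ?m = 0 + (\<Sum>i\<in>{..<s}. (1 / s) * Y i \<theta>)" for \<theta>
    using s by (simp add: Y_def sum_subtractf sum_divide_distrib[symmetric] diff_divide_distrib)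
  have "measure_pmf.expectation ?P (\<lambda>\<theta>. ((\<Sum>i<s. y (\<theta> i)) / real s - ?m)\<^sup>2) =
     0\<^sup>2 + (\<Sum>i\<in>{..<s}. (1 / s)\<^sup>2 * measure_pmf.expectation ?P (\<lambda>\<theta>. (Y i \<theta>)\<^sup>2))"
    unfolding eq
    by (rule measure_pmf.indep_sum_second_moment(2)[OF _ ind integrable_measure_pmf_finite[OF fin] mean]) auto
  also have "\<dots> \<le> 0\<^sup>2 + (\<Sum>i\<in>{..<s}. (1 / s)\<^sup>2 * V\<^sup>2)"
    by (intro add_left_mono sum_mono mult_left_mono var) auto
  also have "\<dots> = V\<^sup>2 / s" using s by (simp add: power2_eq_square)
  finally show ?thesis .
qed

text \<open>The noise and the drawing of templates each contribute a variance of order V^2 /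
  s.\<close>

lemma expected_mean_error_bound:
  assumes t: "1 \<le> t" "2 * t \<le> r" and B: "finite B" "card B = r" and s: "s > 0" and d: "d > 0"
    and f: "\<And>T. T \<subseteq> B \<Longrightarrow> 0 \<le> f T \<and> f T \<le> V"
  shows "measure_pmf.expectation (Pi_pmf {..<s} {} (\<lambda>_. template_pmf t r))
      (mean_error_bound D s V d f B (potential (weight t r) f B))
    \<le> (positive_moment D + (positive_mean D)\<^sup>2) * V\<^sup>2 / (s * d\<^sup>2)"
proof -
  let ?P = "Pi_pmf {..<s} {} (\<lambda>_. template_pmf t r)" and ?y = "\<lambda>\<tau>. f (from_nat_into B ` \<tau>)"
  let ?\<Phi> = "potential (weight t r) f B"
  have \<Phi>: "measure_pmf.expectation (template_pmf t r) ?y = ?\<Phi>" by (rule expectation_template[OF t B])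
  have fin: "finite (set_pmf ?P)" using set_template[OF t] by (intro finite_set_Pi_pmf) auto
  have le: "measure_pmf.expectation ?P (\<lambda>\<theta>. ((\<Sum>i<s. ?y (\<theta> i)) / real s - ?\<Phi>)\<^sup>2) \<le> V\<^sup>2 / s"
    unfolding \<Phi>[symmetric]
  proof (rule template_mean_error[OF set_template(2)[OF t] f s])
    fix \<tau> assume "\<tau> \<in> set_pmf (template_pmf t r)"
    then have "\<tau> \<subseteq> {..<card B}" using set_template(1)[OF t] B by auto
    then show "from_nat_into B ` \<tau> \<subseteq> B" by (rule inj_on_template_image(2)[OF B(1)])
  qed
  have "measure_pmf.expectation ?P (mean_error_bound D s V d f B ?\<Phi>) =
     (positive_moment D * V\<^sup>2 / s + (positive_mean D)\<^sup>2 *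
       measure_pmf.expectation ?P (\<lambda>\<theta>. ((\<Sum>i<s. ?y (\<theta> i)) / real s - ?\<Phi>)\<^sup>2)) / d\<^sup>2"
    unfolding mean_error_bound_def
    by (simp add: Bochner_Integration.integral_add[OF integrable_measure_pmf_finite[OF fin] integrable_measure_pmf_finite[OF fin]])
  also have "\<dots> \<le> (positive_moment D * V\<^sup>2 / s + (positive_mean D)\<^sup>2 * (V\<^sup>2 / s)) / d\<^sup>2"
    using le d by (intro divide_right_mono add_left_mono mult_left_mono) auto
  also have "\<dots> = (positive_moment D + (positive_mean D)\<^sup>2) * V\<^sup>2 / (s * d\<^sup>2)"
    by (simp add: add_divide_distrib[symmetric] algebra_simps)
  finally show ?thesis .
qed

text \<open>A majority contains at least m groups, whose factors are independent with mean at most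
  q, and there are at most 4^m majorities.\<close>

lemma expected_majority_bound:
  fixes h :: "'b \<Rightarrow> real"
  assumes h: "\<And>\<theta>. 0 \<le> h \<theta>" and p: "finite (set_pmf p)"
    and q: "measure_pmf.expectation p h \<le> q" "q \<le> 1"
  shows "measure_pmf.expectation (Pi_pmf {..<2 * m} dflt (\<lambda>_. p)) (\<lambda>\<omega>. \<Sum>J\<in>majorities (2 * m). \<Prod>g\<in>J. h (\<omega> g))
    \<le> (4 * q) ^ m"
proof -
  let ?G = "2 * m"
  let ?P = "Pi_pmf {..<?G} dflt (\<lambda>_. p)"
  have fin: "finite (set_pmf ?P)" using p by (intro finite_set_Pi_pmf) auto
  have E0: "0 \<le> measure_pmf.expectation p h" by (rule Bochner_Integration.integral_nonneg) (rule h)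
  have each: "measure_pmf.expectation ?P (\<lambda>\<omega>. \<Prod>g\<in>J. h (\<omega> g)) \<le> q ^ m" if J: "J \<in> majorities ?G" for J
  proof -
    have JG: "J \<subseteq> {..<?G}" "m \<le> card J" using J by (auto simp: majorities_def)
    \<comment> \<open>Padding with factors 1 makes the product run over all groups, as the product
      rule for the full family requires.\<close>
    have split: "(\<Prod>g\<in>J. k g) = (\<Prod>g\<in>{..<?G}. if g \<in> J then k g else 1)" for k :: "nat \<Rightarrow> real"
      using JG(1) by (simp add: prod.If_cases Int_absorb1)
    have "measure_pmf.expectation ?P (\<lambda>\<omega>. \<Prod>g\<in>J. h (\<omega> g)) =
       measure_pmf.expectation ?P (\<lambda>\<omega>. \<Prod>g\<in>{..<?G}. (if g \<in> J then h else (\<lambda>_. 1)) (\<omega> g))"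
      unfolding split by (intro Bochner_Integration.integral_cong prod.cong) auto
    also have "\<dots> = (\<Prod>g\<in>{..<?G}. measure_pmf.expectation p (if g \<in> J then h else (\<lambda>_. 1)))"
      using h by (intro expectation_prod_Pi_pmf integrable_measure_pmf_finite p) auto
    also have "\<dots> = (\<Prod>g\<in>J. measure_pmf.expectation p h)"
      unfolding split by (intro prod.cong) auto
    also have "\<dots> \<le> q ^ card J" using q(1) E0 by (simp add: power_mono)
    also have "\<dots> \<le> q ^ m" using JG(2) q E0 by (intro power_decreasing) auto
    finally show ?thesis .
  qed
  have "measure_pmf.expectation ?P (\<lambda>\<omega>. \<Sum>J\<in>majorities ?G. \<Prod>g\<in>J. h (\<omega> g)) =
     (\<Sum>J\<in>majorities ?G. measure_pmf.expectation ?P (\<lambda>\<omega>. \<Prod>g\<in>J. h (\<omega> g)))"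
    by (intro Bochner_Integration.integral_sum integrable_measure_pmf_finite fin)
  also have "\<dots> \<le> (\<Sum>J\<in>majorities ?G. q ^ m)" by (rule sum_mono[OF each])
  also have "\<dots> = real (card (majorities ?G)) * q ^ m" by simp
  also have "\<dots> \<le> 2 ^ ?G * q ^ m"
  proof (rule mult_right_mono)
    show "real (card (majorities ?G)) \<le> 2 ^ ?G"
      using majorities(2)[of ?G] by (metis of_nat_le_iff of_nat_numeral of_nat_power)
  qed (use E0 q in simp)
  also have "\<dots> = (4 * q) ^ m" by (simp add: power_mult power_mult_distrib)
  finally show ?thesis .
qed

section \<open>The approximation guarantee\<close>

lemma potential_bounds:
  assumes "1 \<le> t" "2 * t \<le> r" "finite B" "card B = r"
    and f: "\<And>T. T \<subseteq> B \<Longrightarrow> 0 \<le> f T \<and> f T \<le> V"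
  shows "0 \<le> potential (weight t r) f B" "potential (weight t r) f B \<le> V"
proof -
  show "0 \<le> potential (weight t r) f B"
    unfolding potential_def using f by (intro sum_nonneg mult_nonneg_nonneg weight_nonneg) auto
  have "potential (weight t r) f B \<le> (\<Sum>T\<in>Pow B. weight t r (card T) * V)"
    unfolding potential_def using f by (intro sum_mono mult_left_mono weight_nonneg) auto
  also have "\<dots> = V" using sum_weight[OF assms(1-4)] by (simp add: sum_distrib_right[symmetric])
  finally show "potential (weight t r) f B \<le> V" .
qed

lemma value_bounds:
  assumes m: "matroid N I" and f: "monotone_submodular N f" and B: "basis I B" and T: "T \<subseteq> B"
  shows "0 \<le> f T \<and> f T \<le> Max (f ` I)"
proof -
  have "T \<in> I" using m basis_in[OF B] T unfolding matroid_def by blast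
  then have "T \<subseteq> N" "f T \<le> Max (f ` I)"
    using matroid_subset[OF m] matroid_finite(2)[OF m] by auto
  then show ?thesis using f by (simp add: monotone_submodular_def)
qed

text \<open>The gains along the search path telescope, so the least of them is at most the average.\<close>

lemma search_result_approximates:
  assumes m: "matroid N I" "strongly_base_orderable I" "matroid_rank I = r"
    and f: "monotone_submodular N f" and t: "1 \<le> t" "2 * t \<le> r"
    and S: "basis I S" and J: "J > 0" and \<mu>: "\<mu> \<ge> 1" and d: "d \<ge> 0"
    and e: "\<And>B. basis I B \<Longrightarrow> \<bar>e B - \<mu> * potential (weight t r) f B\<bar> \<le> d"
  defines "V \<equiv> Max (f ` I)"
  shows "basis I (search_result N I J e S)"
    "(1 - 1 / exp 1 - 4 ^ t / real r) * V - f (search_result N I J e S)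
      \<le> exp 1 * real r * (1 + ln (real r)) * ((V + 2 * d) / J + 2 * d)"
proof -
  let ?\<Phi> = "potential (weight t r) f" and ?p = "search_path N I e S"
  have finN: "finite N" by (rule matroid_finite(1)[OF m(1)])
  have bN: "B \<subseteq> N" "B \<noteq> {}" "finite B" "card B = r" if "basis I B" for B
    using matroid_subset[OF m(1) basis_in[OF that]] basis_card[OF m(1) that] m(3) t finN finite_subset by auto
  have \<Phi>: "0 \<le> ?\<Phi> B" "?\<Phi> B \<le> V" if "basis I B" for B
    using potential_bounds[OF t bN(3,4)[OF that], of f V] value_bounds[OF m(1) f that]
    unfolding V_def by auto
  have p: "basis I (?p j)" for j
    using basis_search_path[OF m(1) _ S] m(3) t by simp
  have V0: "0 \<le> V" using \<Phi>[OF S] by linarith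
  define g where "g j = swap_gain N I e (?p j)" for j
  define k where "k = arg_min_on g {..<J}"
  have k: "k < J" "\<And>j. j < J \<Longrightarrow> g k \<le> g j"
    using arg_min_if_finite[of "{..<J}" g] J unfolding k_def by (auto simp: not_less)
  have res: "search_result N I J e S = ?p k"
    unfolding search_result_def k_def g_def ..
  show "basis I (search_result N I J e S)" unfolding res by (rule p)
  have g_eq: "g j = e (?p (Suc j)) - e (?p j)" for j
    by (simp add: g_def swap_gain_def search_path_Suc(1))
  have "real J * g k = (\<Sum>j<J. g k)" by simp
  also have "\<dots> \<le> (\<Sum>j<J. g j)" using k(2) by (intro sum_mono) auto
  also have "\<dots> = e (?p J) - e (?p 0)" unfolding g_eq by (rule sum_lessThan_telescope)
  also have "\<dots> \<le> \<mu> * ?\<Phi> (?p J) - \<mu> * ?\<Phi> (?p 0) + 2 * d"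
    using e[OF p[of J]] e[OF p[of 0]] by linarith
  also have "\<dots> \<le> \<mu> * V - \<mu> * 0 + 2 * d"
    using \<Phi>(2)[OF p[of J]] \<Phi>(1)[OF p[of 0]] \<mu> by (intro add_right_mono diff_mono mult_left_mono) auto
  \<comment> \<open>Since \<mu> \<ge> 1, the additive error is absorbed into the scale, and \<mu>
    can be cancelled at the end.\<close>
  also have "\<dots> \<le> \<mu> * (V + 2 * d)"
    using mult_right_mono[OF \<mu>, of "2 * d"] d by (simp add: algebra_simps)
  finally have gk: "g k \<le> \<mu> * ((V + 2 * d) / J)" using J by (simp add: field_simps)
  have "(1 - 1 / exp 1 - 4 ^ t / real r) * V - f (?p k)
      \<le> exp 1 * real r * (1 + ln (real r)) * ((V + 2 * d) / J + 2 * d)"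
  proof -
    obtain Opt where Opt: "basis I Opt" "f Opt = V" using optimal_basis[OF m(1) f] unfolding V_def by blast
    show ?thesis unfolding Opt(2)[symmetric]
    proof (rule potential_approx_local_optimum[OF m f t p Opt(1)])
      show "0 \<le> (f Opt + 2 * d) / real J + 2 * d" using V0 d Opt(2) by simp
      fix B assume B: "B \<in> neighbours N I (?p k)"
      then have bB: "basis I B" by (simp add: neighbours_def)
      have "e B \<le> e (?p (Suc k))" unfolding search_path_Suc(1)
        using best_swap(2)[OF finN bN(1)[OF p] p bN(2)[OF p] B] .
      then have "\<mu> * (?\<Phi> B - ?\<Phi> (?p k)) \<le> g k + 2 * d"
        using e[OF bB] e[OF p[of k]] unfolding g_eq right_diff_distrib by linarith
      also have "\<dots> \<le> \<mu> * ((V + 2 * d) / J + 2 * d)"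
        using gk mult_right_mono[OF \<mu>, of "2 * d"] d by (simp add: distrib_left)
      finally show "?\<Phi> B - ?\<Phi> (?p k) \<le> (f Opt + 2 * d) / real J + 2 * d"
        using \<mu> Opt(2) by (subst (asm) mult_le_cancel_left_pos) auto
    qed
  qed
  then show "(1 - 1 / exp 1 - 4 ^ t / real r) * V - f (search_result N I J e S)
      \<le> exp 1 * real r * (1 + ln (real r)) * ((V + 2 * d) / J + 2 * d)" unfolding res .
qed

section \<open>Success probability of the search\<close>

lemma success_prob_ge:
  assumes D: "noise_distribution D" and m: "matroid N I" and r: "matroid_rank I > 0"
    and J: "J > 0" and G: "G > 0" and P: "finite (set_pmf P)"
    and U: "\<And>\<omega>. \<omega> \<in> set_pmf P \<Longrightarrow> measure (noise_space N D) {\<xi> \<in> space (noise_space N D).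
      \<not> approximates I f \<beta> (search_result N I J (estimate G s \<omega> (noisy_oracle N f \<xi>)) (SOME B. basis I B))} \<le> U \<omega>"
  shows "success_prob N I f D \<beta> (noisy_local_search N J G s P) \<ge> 1 - measure_pmf.expectation P U"
proof -
  let ?M = "noise_space N D"
  interpret prob_space ?M by (rule noise_space_prob[OF D])
  have sD: "sets D = sets borel" using D by (simp add: noise_distribution_def)
  define res where "res \<omega> \<xi> = search_result N I J (estimate G s \<omega> (noisy_oracle N f \<xi>)) (SOME B. basis I B)" for \<omega> \<xi>
  define A where "A \<omega> = {\<xi> \<in> space ?M. approximates I f \<beta> (res \<omega> \<xi>)}" for \<omega>
  have A: "A \<omega> \<in> sets ?M" for \<omega>
  proof -
    have "res \<omega> \<in> measurable ?M (count_space {B. basis I B})"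
      unfolding res_def
      by (rule measurable_search_result[OF m r some_basis[OF m] J measurable_estimate[OF sD G]])
    then have "res \<omega> -` {B. basis I B \<and> approximates I f \<beta> B} \<inter> space ?M \<in> sets ?M"
      by (rule measurable_sets) auto
    moreover have "res \<omega> -` {B. basis I B \<and> approximates I f \<beta> B} \<inter> space ?M = A \<omega>"
      using measurable_space[OF \<open>res \<omega> \<in> _\<close>] by (auto simp: A_def)
    ultimately show ?thesis by simp
  qed
  have run: "measure_pmf.prob (run_noisy N I f (noisy_local_search N J G s P) \<xi>) {(S, q). approximates I f \<beta> S}
     = (\<Sum>\<omega>\<in>set_pmf P. indicator (A \<omega>) \<xi> * pmf P \<omega>)" if \<xi>: "\<xi> \<in> space ?M" for \<xi>
  proof -
    obtain q where q: "run (noisy_oracle N f \<xi>) (\<lambda>S. S \<in> I) (noisy_local_search N J G s P) =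
       map_pmf (\<lambda>\<omega>. (res \<omega> \<xi>, q \<omega>)) P"
      using run_noisy_local_search[OF m r J, of G s "noisy_oracle N f \<xi>" P] unfolding res_def by blast
    have "measure_pmf.prob (run_noisy N I f (noisy_local_search N J G s P) \<xi>) {(S, q). approximates I f \<beta> S}
       = measure_pmf.prob P {\<omega>. approximates I f \<beta> (res \<omega> \<xi>)}"
      unfolding run_noisy_def q by (simp add: vimage_def)
    also have "\<dots> = measure_pmf.expectation P (indicator {\<omega>. approximates I f \<beta> (res \<omega> \<xi>)})" by simp
    also have "\<dots> = (\<Sum>\<omega>\<in>set_pmf P. indicator {\<omega>. approximates I f \<beta> (res \<omega> \<xi>)} \<omega> * pmf P \<omega>)"
      by (rule integral_measure_pmf_real[OF P]) auto
    also have "\<dots> = (\<Sum>\<omega>\<in>set_pmf P. indicator (A \<omega>) \<xi> * pmf P \<omega>)"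
      using \<xi> by (intro sum.cong refl) (simp add: A_def indicator_def)
    finally show ?thesis .
  qed
  have "success_prob N I f D \<beta> (noisy_local_search N J G s P) =
     expectation (\<lambda>\<xi>. \<Sum>\<omega>\<in>set_pmf P. indicator (A \<omega>) \<xi> * pmf P \<omega>)"
    unfolding success_prob_def by (rule Bochner_Integration.integral_cong[OF refl run])
  \<comment> \<open>As \<open>P\<close> has finite support, exchanging the two expectations only
    exchanges a finite sum with an integral.\<close>
  also have "\<dots> = (\<Sum>\<omega>\<in>set_pmf P. expectation (\<lambda>\<xi>. indicator (A \<omega>) \<xi> * pmf P \<omega>))"
    using A by (intro Bochner_Integration.integral_sum integrable_mult_left) (simp add: less_top[symmetric])
  also have "\<dots> = (\<Sum>\<omega>\<in>set_pmf P. prob (A \<omega>) * pmf P \<omega>)"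
    using A by simp
  also have "\<dots> \<ge> (\<Sum>\<omega>\<in>set_pmf P. (1 - U \<omega>) * pmf P \<omega>)"
  proof (intro sum_mono mult_right_mono)
    fix \<omega> assume \<omega>: "\<omega> \<in> set_pmf P"
    have "{\<xi> \<in> space ?M. \<not> approximates I f \<beta> (res \<omega> \<xi>)} = space ?M - A \<omega>" by (auto simp: A_def)
    then show "1 - U \<omega> \<le> prob (A \<omega>)" using U[OF \<omega>] prob_compl[OF A] unfolding res_def[symmetric] by simp
  qed simp
  also have "(\<Sum>\<omega>\<in>set_pmf P. (1 - U \<omega>) * pmf P \<omega>) = measure_pmf.expectation P (\<lambda>\<omega>. 1 - U \<omega>)"
    by (rule integral_measure_pmf_real[OF P, symmetric]) auto
  also have "\<dots> = 1 - measure_pmf.expectation P U"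
    by (subst Bochner_Integration.integral_diff) (auto intro: integrable_measure_pmf_finite[OF P])
  finally show ?thesis .
qed

text \<open>With accuracy d = \<kappa> V / M, where V is the optimum, the factor 8 in \<kappa> makes
  the expected error bound of a group at most 1/8. The majority bound is then (1/2)^(2 n), which
  leaves 2^(-n) after a union over at most 2^n bases. Colliding templates, for which independence
  fails, are charged in full.\<close>

lemma success_prob_noisy_local_search:
  assumes D: "noise_distribution D" and m: "matroid N I" "strongly_base_orderable I" "matroid_rank I = r"
    and f: "monotone_submodular N f" and t: "1 \<le> t" "2 * t \<le> r" and M: "M > 0" and N: "N \<noteq> {}"
    and \<kappa>: "\<kappa> > 0" "\<kappa>\<^sup>2 = 8 * (positive_moment D + (positive_mean D)\<^sup>2)"
    and \<beta>: "\<beta> \<le> 1 - 1 / exp 1 - 4 ^ t / real r - exp 1 * real r * (1 + ln (real r)) * (1 + 4 * \<kappa>) / M"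
  defines "G \<equiv> 4 * card N"
  shows "success_prob N I f D \<beta> (noisy_local_search N M G (M\<^sup>2) (samples_pmf t r G (M\<^sup>2)))
     \<ge> 1 - ((real G * real (M\<^sup>2))\<^sup>2 / real (r choose t) + (1 / 2) ^ card N)"
proof -
  let ?n = "card N" and ?M = "noise_space N D" and ?s = "M\<^sup>2" and ?\<mu> = "positive_mean D"
  let ?P = "samples_pmf t r G ?s"
  let ?\<Phi> = "potential (weight t r) f"
  let ?S = "SOME B. basis I B"
  interpret prob_space ?M by (rule noise_space_prob[OF D])
  have finN: "finite N" by (rule matroid_finite(1)[OF m(1)])
  have n: "?n > 0" using N finN by (simp add: card_gt_0_iff)
  have G: "G > 0" using n by (simp add: G_def)
  have r: "r > 0" using t by simp
  have sD: "sets D = sets borel" using D by (simp add: noise_distribution_def)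
  have s: "?s > 0" using M by simp
  define V where "V = Max (f ` I)"
  define bases where "bases = {B. basis I B}"
  have bases: "finite bases" "card bases \<le> 2 ^ ?n"
  proof -
    have sub: "bases \<subseteq> Pow N" using matroid_subset[OF m(1) basis_in] by (auto simp: bases_def)
    show "finite bases" by (rule finite_subset[OF sub]) (simp add: finN)
    show "card bases \<le> 2 ^ ?n" using card_mono[OF _ sub] finN by (simp add: card_Pow)
  qed
  have bN: "B \<subseteq> N" "finite B" "card B = r" if "basis I B" for B
    using matroid_subset[OF m(1) basis_in[OF that]] basis_card[OF m(1) that] m(3) finN finite_subset by auto
  note fP = samples_pmf(1)[OF t, of G ?s]
  have \<mu>: "?\<mu> \<ge> 1" by (rule noise_positive_part(2)[OF D])
  have V0: "0 \<le> V" using value_bounds[OF m(1) f some_basis[OF m(1)], of "{}"] unfolding V_def by simp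
  have goal: "success_prob N I f D \<beta> (noisy_local_search N M G ?s ?P) \<ge> 1 - measure_pmf.expectation ?P U"
    if "\<And>\<omega>. \<omega> \<in> set_pmf ?P \<Longrightarrow> prob {\<xi> \<in> space ?M.
      \<not> approximates I f \<beta> (search_result N I M (estimate G ?s \<omega> (noisy_oracle N f \<xi>)) ?S)} \<le> U \<omega>" for U
    using success_prob_ge[OF D m(1) _ M G fP that] m(3) r by simp
  show ?thesis
  proof (cases "V = 0")
    \<comment> \<open>With optimum 0 every base is optimal, whereas d would be 0 and Chebyshev's
      inequality void.\<close>
    case True
    have "approximates I f \<beta> (search_result N I M e ?S)" for e
    proof -
      have "basis I (search_result N I M e ?S)"
        unfolding search_result_def using basis_search_path[OF m(1) _ some_basis[OF m(1)]] m(3) r by simp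
      then show ?thesis
        using True basis_in value_bounds[OF m(1) f, of "search_result N I M e ?S"] by (auto simp: approximates_def V_def)
    qed
    then have "success_prob N I f D \<beta> (noisy_local_search N M G ?s ?P) \<ge> 1 - measure_pmf.expectation ?P (\<lambda>_. 0)"
      by (intro goal) simp
    then have "success_prob N I f D \<beta> (noisy_local_search N M G ?s ?P) \<ge> 1" by simp
    moreover have "0 \<le> (real G * real ?s)\<^sup>2 / real (r choose t) + (1 / 2) ^ card N" by simp
    ultimately show ?thesis by linarith
  next
    case False
    then have V: "V > 0" using V0 by simp
    define d where "d = \<kappa> * V / M"
    have d: "d > 0" using \<kappa> V M by (simp add: d_def)
    define h where "h B = mean_error_bound D ?s V d f B (?\<Phi> B)" for B
    define col where "col = {\<omega> :: nat \<Rightarrow> nat \<Rightarrow> nat set. \<not> inj_on (\<lambda>(g, i). \<omega> g i) ({..<G} \<times> {..<?s})}"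
    define W where "W \<omega> = (\<Sum>B\<in>bases. \<Sum>J\<in>majorities G. \<Prod>g\<in>J. h B (\<omega> g))" for \<omega> :: "nat \<Rightarrow> nat \<Rightarrow> nat set"
    have h0: "0 \<le> h B \<theta>" for B \<theta>
      unfolding h_def mean_error_bound_def using noise_positive_part(3)[OF D] by simp
    have W0: "0 \<le> W \<omega>" for \<omega> unfolding W_def by (intro sum_nonneg prod_nonneg h0)
    have fb: "0 \<le> f T \<and> f T \<le> V" if "B \<in> bases" "T \<subseteq> B" for B T
      using value_bounds[OF m(1) f _ that(2)] that(1) unfolding V_def bases_def by simp
    have approx: "approximates I f \<beta> (search_result N I M e ?S)"
      if e: "\<And>B. basis I B \<Longrightarrow> \<bar>e B - ?\<mu> * ?\<Phi> B\<bar> \<le> d" for e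
    proof -
      note sr = search_result_approximates[OF m f t some_basis[OF m(1)] M \<mu> less_imp_le[OF d] e]
      have "(V + 2 * d) / M + 2 * d = ((V + 2 * \<kappa> * V / M) + 2 * \<kappa> * V) / M"
        by (simp add: d_def add_divide_distrib)
      also have "\<dots> \<le> ((V + 2 * \<kappa> * V) + 2 * \<kappa> * V) / M"
        using M \<kappa> V by (intro divide_right_mono add_right_mono add_left_mono) (auto simp: field_simps)
      also have "\<dots> = (1 + 4 * \<kappa>) / M * V" by (simp add: algebra_simps)
      finally have "exp 1 * real r * (1 + ln (real r)) * ((V + 2 * d) / M + 2 * d)
        \<le> exp 1 * real r * (1 + ln (real r)) * ((1 + 4 * \<kappa>) / M * V)"
        using r by (intro mult_left_mono) auto
      with sr(2) have "(1 - 1 / exp 1 - 4 ^ t / real r) * V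
          - exp 1 * real r * (1 + ln (real r)) * ((1 + 4 * \<kappa>) / M * V) \<le> f (search_result N I M e ?S)"
        unfolding V_def by linarith
      moreover have "\<beta> * V \<le> (1 - 1 / exp 1 - 4 ^ t / real r
          - exp 1 * real r * (1 + ln (real r)) * (1 + 4 * \<kappa>) / M) * V"
        using \<beta> V by (intro mult_right_mono) auto
      ultimately have "\<beta> * V \<le> f (search_result N I M e ?S)" by (simp add: left_diff_distrib)
      then show ?thesis using basis_in[OF sr(1)] by (simp add: approximates_def V_def)
    qed
    have "success_prob N I f D \<beta> (noisy_local_search N M G ?s ?P)
        \<ge> 1 - measure_pmf.expectation ?P (\<lambda>\<omega>. indicator col \<omega> + W \<omega>)"
    proof (rule goal)
      fix \<omega> assume \<omega>: "\<omega> \<in> set_pmf ?P"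
      define Z where "Z B = {\<xi> \<in> space ?M. \<bar>estimate G ?s \<omega> (noisy_oracle N f \<xi>) B - ?\<mu> * ?\<Phi> B\<bar> > d}" for B
      have Z: "Z B \<in> sets ?M" for B
      proof -
        have [measurable]: "(\<lambda>\<xi>. estimate G ?s \<omega> (noisy_oracle N f \<xi>) B) \<in> borel_measurable ?M"
          by (rule measurable_estimate[OF sD G])
        show ?thesis unfolding Z_def by measurable
      qed
      have sub: "{\<xi> \<in> space ?M. \<not> approximates I f \<beta>
          (search_result N I M (estimate G ?s \<omega> (noisy_oracle N f \<xi>)) ?S)} \<subseteq> (\<Union>B\<in>bases. Z B)"
      proof
        fix \<xi> assume \<xi>: "\<xi> \<in> {\<xi> \<in> space ?M. \<not> approximates I f \<beta>
          (search_result N I M (estimate G ?s \<omega> (noisy_oracle N f \<xi>)) ?S)}"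
        then obtain B where "basis I B" "\<not> \<bar>estimate G ?s \<omega> (noisy_oracle N f \<xi>) B - ?\<mu> * ?\<Phi> B\<bar> \<le> d"
          using approx[of "estimate G ?s \<omega> (noisy_oracle N f \<xi>)"] by blast
        then show "\<xi> \<in> (\<Union>B\<in>bases. Z B)" using \<xi> unfolding Z_def bases_def by auto
      qed
      have "prob {\<xi> \<in> space ?M. \<not> approximates I f \<beta>
          (search_result N I M (estimate G ?s \<omega> (noisy_oracle N f \<xi>)) ?S)} \<le> prob (\<Union>B\<in>bases. Z B)"
        using sub Z bases(1) by (intro finite_measure_mono sets.finite_UN) auto
      also have "\<dots> \<le> indicator col \<omega> + W \<omega>"
      proof (cases "\<omega> \<in> col")
        case True
        have "prob (\<Union>B\<in>bases. Z B) \<le> 1 + W \<omega>"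
          using W0[of \<omega>] prob_le_1[of "\<Union>B\<in>bases. Z B"] by linarith
        then show ?thesis using True by simp
      next
        case False
        then have inj: "inj_on (\<lambda>(g, i). \<omega> g i) ({..<G} \<times> {..<?s})" by (simp add: col_def)
        have "prob (\<Union>B\<in>bases. Z B) \<le> (\<Sum>B\<in>bases. prob (Z B))"
          using Z bases(1) by (intro finite_measure_subadditive_finite) auto
        also have "\<dots> \<le> W \<omega>"
          unfolding W_def
        proof (rule sum_mono)
          fix B assume B: "B \<in> bases"
          then have bB: "basis I B" by (simp add: bases_def)
          have sub: "\<omega> g i \<subseteq> {..<card B}" if "g < G" "i < ?s" for g i
            unfolding bN(3)[OF bB] by (rule samples_pmf(2)[OF t \<omega> that])
          show "prob (Z B) \<le> (\<Sum>J\<in>majorities G. \<Prod>g\<in>J. h B (\<omega> g))"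
            unfolding Z_def h_def
            by (rule estimate_deviation[OF D finN bN(1)[OF bB] inj sub s G d fb[OF B]])
        qed
        finally show ?thesis using False by simp
      qed
      finally show "prob {\<xi> \<in> space ?M. \<not> approximates I f \<beta>
          (search_result N I M (estimate G ?s \<omega> (noisy_oracle N f \<xi>)) ?S)} \<le> indicator col \<omega> + W \<omega>" .
    qed
    moreover have "measure_pmf.expectation ?P (\<lambda>\<omega>. indicator col \<omega> + W \<omega>) =
       measure_pmf.prob ?P col + (\<Sum>B\<in>bases. measure_pmf.expectation ?P (\<lambda>\<omega>. \<Sum>J\<in>majorities G. \<Prod>g\<in>J. h B (\<omega> g)))"
      unfolding W_def
      by (subst Bochner_Integration.integral_add, (rule integrable_measure_pmf_finite[OF fP])+)
        (simp add: Bochner_Integration.integral_sum integrable_measure_pmf_finite[OF fP])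
    moreover have "measure_pmf.prob ?P col \<le> (real G * real ?s)\<^sup>2 / real (r choose t)"
      unfolding col_def by (rule prob_samples_collide[OF t])
    moreover have "(\<Sum>B\<in>bases. measure_pmf.expectation ?P (\<lambda>\<omega>. \<Sum>J\<in>majorities G. \<Prod>g\<in>J. h B (\<omega> g)))
        \<le> (\<Sum>B\<in>bases. (4 * (1 / 8)) ^ (2 * ?n))"
    proof (rule sum_mono)
      fix B assume B: "B \<in> bases"
      then have bB: "basis I B" by (simp add: bases_def)
      have "measure_pmf.expectation (Pi_pmf {..<?s} {} (\<lambda>_. template_pmf t r)) (h B)
         \<le> (positive_moment D + ?\<mu>\<^sup>2) * V\<^sup>2 / (?s * d\<^sup>2)"
        unfolding h_def by (rule expected_mean_error_bound[OF t bN(2,3)[OF bB] s d fb[OF B]])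
      also have "positive_moment D + ?\<mu>\<^sup>2 = \<kappa>\<^sup>2 / 8" using \<kappa>(2) by simp
      also have "\<kappa>\<^sup>2 / 8 * V\<^sup>2 / (?s * d\<^sup>2) = 1 / 8"
        using M \<kappa>(1) V by (simp add: d_def power_divide power_mult_distrib)
      finally have q: "measure_pmf.expectation (Pi_pmf {..<?s} {} (\<lambda>_. template_pmf t r)) (h B) \<le> 1 / 8" .
      have fin: "finite (set_pmf (Pi_pmf {..<?s} {} (\<lambda>_. template_pmf t r)))"
        using set_template[OF t] by (intro finite_set_Pi_pmf) auto
      have G2: "G = 2 * (2 * ?n)" by (simp add: G_def)
      show "measure_pmf.expectation ?P (\<lambda>\<omega>. \<Sum>J\<in>majorities G. \<Prod>g\<in>J. h B (\<omega> g)) \<le> (4 * (1 / 8)) ^ (2 * ?n)"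
        unfolding samples_pmf_def G2 by (rule expected_majority_bound[OF h0 fin q]) simp
    qed
    moreover have "(\<Sum>B\<in>bases. (4 * (1 / 8)) ^ (2 * ?n)) \<le> (1 / 2 :: real) ^ ?n"
    proof -
      have "(\<Sum>B\<in>bases. (4 * (1 / 8)) ^ (2 * ?n)) = real (card bases) * (1 / 4) ^ ?n"
        by (simp add: power_mult power_one_over)
      also have "\<dots> \<le> 2 ^ ?n * (1 / 4) ^ ?n"
      proof (rule mult_right_mono)
        show "real (card bases) \<le> 2 ^ ?n" using bases(2) by (metis of_nat_le_iff of_nat_numeral of_nat_power)
      qed simp
      also have "\<dots> = (1 / 2 :: real) ^ ?n" by (simp add: power_mult_distrib[symmetric])
      finally show ?thesis .
    qed
    ultimately show ?thesis by linarith
  qed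
qed

section \<open>Choice of parameters\<close>

definition round_count :: "nat \<Rightarrow> nat" where
  "round_count n = nat \<lceil>real n powr (4 / 3)\<rceil>"

text \<open>The lower bound gives the accuracy, the cubic bound the query count (rounds times
  samples per group), and the cruder quadratic bound the collision probability.\<close>

lemma round_count:
  assumes "n \<ge> 1"
  shows "real n powr (4 / 3) \<le> round_count n" "round_count n \<ge> 1" "real (round_count n) ^ 3 \<le> 8 * real n ^ 4"
    "real (round_count n) \<le> 2 * real n ^ 2"
proof -
  let ?x = "real n powr (4 / 3)"
  have x1: "?x \<ge> 1" using assms by (simp add: ge_one_powr_ge_zero)
  show le: "?x \<le> round_count n" unfolding round_count_def by (rule real_nat_ceiling_ge)
  show "round_count n \<ge> 1" using le x1 by linarith
  have up: "real (round_count n) \<le> 2 * ?x" unfolding round_count_def using x1 by linarith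
  have "real (round_count n) ^ 3 \<le> (2 * ?x) ^ 3" using up by (intro power_mono) auto
  also have "\<dots> = 8 * real n powr 4" using assms by (simp add: power_mult_distrib powr_power)
  also have "real n powr 4 = real n ^ 4" using assms by (simp add: powr_numeral)
  finally show "real (round_count n) ^ 3 \<le> 8 * real n ^ 4" .
  have "?x \<le> real n powr 2" using assms by (intro powr_mono) auto
  then show "real (round_count n) \<le> 2 * real n ^ 2" using up assms by (simp add: powr_numeral)
qed

text \<open>Trimming by 33 is what makes coinciding samples unlikely: \<open>r choose 33\<close> is at least of order
  \<open>n ^ 11\<close> when \<open>r\<close> is at least of order \<open>n powr (1 / 3)\<close>. For \<open>\<epsilon> \<ge> 1\<close> the query bound may be below 1,
  but the required ratio can be made negative.\<close>

definition noisy_matroid_maximizer :: "real \<Rightarrow> 'a set \<Rightarrow> nat \<Rightarrow> 'a oracle_algorithm" where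
  "noisy_matroid_maximizer \<epsilon> N r = (if \<epsilon> \<ge> 1 then Return {} else
     let n = card N; M = round_count n; G = 4 * n
     in noisy_local_search N M G (M\<^sup>2) (samples_pmf 33 r G (M\<^sup>2)))"

text \<open>66 is twice the trimming 33. The error terms from accuracy and from trimming are
  compared with x^(-1/4), which x \<ge> \<epsilon>^(-4) bounds by \<epsilon>.\<close>

lemma large_enough:
  fixes c :: real
  assumes c: "c > 0"
  shows "\<forall>\<^sub>F x in at_top. c * x powr (1 / 3) \<ge> 66 \<and>
    exp 1 * (1 + ln x) * x powr (-1 / 3) \<le> x powr (-1 / 4) \<and>
    4 ^ 33 / (c * x powr (1 / 3)) \<le> x powr (-1 / 4) \<and> x \<ge> 1"
  using assms by (intro eventually_conj eventually_ge_at_top) real_asymp+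

lemma return_empty_approximates:
  assumes D: "noise_distribution D" and m: "matroid N I" and f: "monotone_submodular N f" and \<beta>: "\<beta> \<le> 0"
  shows "success_prob N I f D \<beta> (Return {}) = 1"
proof -
  interpret prob_space "noise_space N D" by (rule noise_space_prob[OF D])
  have "{} \<in> I" using m by (simp add: matroid_def)
  then have "f {} \<le> Max (f ` I)" using matroid_finite(2)[OF m] by (intro Max_ge) auto
  then have "0 \<le> Max (f ` I)" using f by (simp add: monotone_submodular_def)
  then have "approximates I f \<beta> {}"
    using \<open>{} \<in> I\<close> \<beta> f by (simp add: approximates_def monotone_submodular_def mult_nonpos_nonneg)
  then show ?thesis by (simp add: success_prob_def run_noisy_def prob_space)
qed

theorem theoremC2:
  fixes c :: real
  assumes "c > 0"
  shows "\<exists>alg :: real \<Rightarrow> 'a set \<Rightarrow> nat \<Rightarrow> 'a oracle_algorithm.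
    \<forall>D. noise_distribution D \<longrightarrow>
      (\<exists>n0 C K1 K2 K3 :: real. 0 < C \<and> 0 < K1 \<and> 0 < K2 \<and> 0 < K3 \<and>
        (\<forall>(\<epsilon>::real) (n::nat) (r::nat) (N::'a set).
          \<epsilon> > 0 \<and> finite N \<and> card N = n \<and> real n \<ge> n0 \<and> real n \<ge> C / \<epsilon> ^ 4 \<and>
          real r \<ge> c * real n powr (1 / 3) \<longrightarrow>
          (\<forall>I f. matroid N I \<and> loopless N I \<and> strongly_base_orderable I \<and> matroid_rank I = r \<and>
             monotone_submodular N f \<longrightarrow>
             success_prob N I f D (1 - 1 / exp 1 - K1 * \<epsilon>) (alg \<epsilon> N r) \<ge> 1 - K2 / real n \<and>
             queries_at_most N I f D (K3 * real n ^ 7 / \<epsilon>) (alg \<epsilon> N r))))"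
proof (intro exI[of _ noisy_matroid_maximizer] allI impI)
  fix D assume D: "noise_distribution D"
  obtain n0 where n0: "\<And>x. x \<ge> n0 \<Longrightarrow> c * x powr (1 / 3) \<ge> 66 \<and>
    exp 1 * (1 + ln x) * x powr (-1 / 3) \<le> x powr (-1 / 4) \<and>
    4 ^ 33 / (c * x powr (1 / 3)) \<le> x powr (-1 / 4) \<and> x \<ge> 1"
    using large_enough[OF assms] unfolding eventually_at_top_linorder by blast
  define \<kappa> where "\<kappa> = sqrt (8 * (positive_moment D + (positive_mean D)\<^sup>2))"
  have pos: "8 * (positive_moment D + (positive_mean D)\<^sup>2) > 0"
    using noise_positive_part(2,3)[OF D] by (intro mult_pos_pos add_nonneg_pos) auto
  then have \<kappa>: "\<kappa> > 0" "\<kappa>\<^sup>2 = 8 * (positive_moment D + (positive_mean D)\<^sup>2)"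
    unfolding \<kappa>_def by (simp_all only: real_sqrt_gt_0_iff real_sqrt_pow2 less_imp_le)
  \<comment> \<open>One \<epsilon> pays for the trimming and 1 + 4 \<kappa> of them for the
    accuracy. This is the only constant that depends on \<open>D\<close>; the algorithm itself does
    not.\<close>
  define K1 where "K1 = 2 + 4 * \<kappa>"
  \<comment> \<open>The number of samples is at most 4 n (2 n^2)^2 = 16 n^5; its square 256 n^10 is
    divided by the lower bound (c / 33)^33 n^11 of \<open>r choose 33\<close>. The summand 1 covers
    2^(-n) \<le> 1 / n.\<close>
  define K2 where "K2 = 256 * (33 / c) ^ 33 + 1"
  have main: "success_prob N I f D (1 - 1 / exp 1 - K1 * \<epsilon>) (noisy_matroid_maximizer \<epsilon> N r) \<ge> 1 - K2 / real n
      \<and> queries_at_most N I f D (32 * real n ^ 7 / \<epsilon>) (noisy_matroid_maximizer \<epsilon> N r)"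
    if \<epsilon>: "\<epsilon> > 0" and N: "finite N" "card N = n" "real n \<ge> n0" "real n \<ge> 1 / \<epsilon> ^ 4"
      and r: "real r \<ge> c * real n powr (1 / 3)"
      and m: "matroid N I" "strongly_base_orderable I" "matroid_rank I = r" and f: "monotone_submodular N f"
    for \<epsilon> :: real and n r :: nat and N :: "'a set" and I f
  proof -
    have K2: "K2 \<ge> 0" using assms by (simp add: K2_def)
    note large = n0[OF N(3)]
    have n1: "n \<ge> 1" using large by simp
    show ?thesis
    proof (cases "\<epsilon> \<ge> 1")
      case True
      have "1 * 1 \<le> K1 * \<epsilon>" using True \<kappa>(1) by (intro mult_mono) (auto simp: K1_def)
      moreover have "0 \<le> 1 / exp (1::real)" by simp
      ultimately have "1 - 1 / exp 1 - K1 * \<epsilon> \<le> 0" by linarith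
      then have "success_prob N I f D (1 - 1 / exp 1 - K1 * \<epsilon>) (Return {}) = 1"
        by (rule return_empty_approximates[OF D m(1) f])
      moreover have "queries_at_most N I f D (32 * real n ^ 7 / \<epsilon>) (Return {})"
        using \<epsilon> by (simp add: queries_at_most_def run_noisy_def)
      ultimately show ?thesis using True K2 by (simp add: noisy_matroid_maximizer_def)
    next
      case False
      define M G where "M = round_count n" and "G = 4 * n"
      note M = round_count[OF n1, folded M_def]
      have alg: "noisy_matroid_maximizer \<epsilon> N r = noisy_local_search N M G (M\<^sup>2) (samples_pmf 33 r G (M\<^sup>2))"
        using False N(2) by (simp add: noisy_matroid_maximizer_def M_def G_def Let_def)
      have r66: "real r \<ge> 66" using r large by linarith
      then have t: "(1::nat) \<le> 33" "2 * 33 \<le> r" by linarith+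
      have rn: "r \<le> n"
      proof -
        have "card (SOME B. basis I B) \<le> card N"
          using some_basis[OF m(1)] matroid_subset[OF m(1) basis_in] N(1) by (intro card_mono) auto
        then show ?thesis using basis_card[OF m(1) some_basis[OF m(1)]] m(3) N(2) by simp
      qed
      have nr0: "real n > 0" using n1 by simp
      have \<epsilon>n: "real n powr (-1 / 4) \<le> \<epsilon>"
      proof -
        have "1 / \<epsilon> ^ 4 > 0" using \<epsilon> by simp
        then have "real n powr (-1 / 4) \<le> (1 / \<epsilon> ^ 4) powr (-1 / 4)"
          using N(4) by (intro powr_mono2') auto
        also have "1 / \<epsilon> ^ 4 = \<epsilon> powr (-4)" using \<epsilon> by (simp add: powr_minus_divide powr_numeral)
        also have "(\<epsilon> powr (-4)) powr (-1 / 4) = \<epsilon>" using \<epsilon> by (simp add: powr_powr)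
        finally show ?thesis .
      qed
      have c0: "c * real n powr (1 / 3) > 0" using assms nr0 by simp
      have "4 ^ 33 / real r \<le> 4 ^ 33 / (c * real n powr (1 / 3))"
        using r c0 r66 by (intro divide_left_mono mult_pos_pos[OF _ c0]) auto
      then have trim: "4 ^ 33 / real r \<le> \<epsilon>" using large \<epsilon>n by linarith
      \<comment> \<open>With r \<le> n and M \<ge> n^(4/3) the factor r (1 + ln r) / M is at most
        n^(-1/3) (1 + ln n).\<close>
      have prec: "exp 1 * real r * (1 + ln (real r)) * (1 + 4 * \<kappa>) / M \<le> \<epsilon> * (1 + 4 * \<kappa>)"
      proof -
        have "exp 1 * real r * (1 + ln (real r)) / M \<le> exp 1 * real n * (1 + ln (real n)) / real n powr (4 / 3)"
          using rn r66 M(1) nr0 by (intro frac_le mult_mono add_left_mono) auto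
        also have "\<dots> = exp 1 * (1 + ln (real n)) * (real n powr 1 / real n powr (4 / 3))" using nr0 by simp
        also have "real n powr 1 / real n powr (4 / 3) = real n powr (-1 / 3)"
          by (subst powr_diff[symmetric]) simp
        also have "exp 1 * (1 + ln (real n)) * real n powr (-1 / 3) \<le> \<epsilon>" using large \<epsilon>n by linarith
        finally have "exp 1 * real r * (1 + ln (real r)) / M * (1 + 4 * \<kappa>) \<le> \<epsilon> * (1 + 4 * \<kappa>)"
          using \<kappa>(1) by (intro mult_right_mono) auto
        then show ?thesis by simp
      qed
      have \<beta>: "1 - 1 / exp 1 - K1 * \<epsilon> \<le> 1 - 1 / exp 1 - 4 ^ 33 / real r
          - exp 1 * real r * (1 + ln (real r)) * (1 + 4 * \<kappa>) / M"
        using trim prec unfolding K1_def by (simp add: algebra_simps)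
      have Nne: "N \<noteq> {}" using n1 N(2) by auto
      have M0: "M > 0" using M(2) by simp
      have "success_prob N I f D (1 - 1 / exp 1 - K1 * \<epsilon>) (noisy_matroid_maximizer \<epsilon> N r)
          \<ge> 1 - ((real G * real (M\<^sup>2))\<^sup>2 / real (r choose 33) + (1 / 2) ^ n)"
        using success_prob_noisy_local_search[OF D m f t M0 Nne \<kappa> \<beta>] unfolding alg N(2) G_def .
      moreover have "(1 / 2 :: real) ^ n \<le> 1 / real n"
      proof -
        have "real n \<le> 2 ^ n" using less_exp[of n] by (metis less_imp_le of_nat_le_iff of_nat_numeral of_nat_power)
        then show ?thesis using nr0 by (simp add: power_one_over frac_le)
      qed
      moreover have "(real G * real (M\<^sup>2))\<^sup>2 / real (r choose 33) \<le> 256 * (33 / c) ^ 33 / real n"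
      proof -
        have "(real M)\<^sup>2 \<le> (2 * real n ^ 2)\<^sup>2" using M(4) by (intro power_mono) auto
        then have "4 * real n * (real M)\<^sup>2 \<le> 4 * real n * (2 * real n ^ 2)\<^sup>2"
          by (rule mult_left_mono) simp
        then have "real G * real (M\<^sup>2) \<le> 4 * real n * (2 * real n ^ 2)\<^sup>2" by (simp add: G_def)
        also have "\<dots> = 16 * real n ^ 5" by (simp add: power_mult_distrib power_numeral_reduce)
        finally have num: "(real G * real (M\<^sup>2))\<^sup>2 \<le> (16 * real n ^ 5)\<^sup>2" by (intro power_mono) auto
        \<comment> \<open>The exponent 33 = 3 * 11 turns n^(1/3) into n^11, one power more than the
          order n^10 of the number of sample pairs.\<close>
        have "(c / 33) ^ 33 * real n ^ 11 = (c * real n powr (1 / 3) / 33) ^ 33"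
        proof -
          have "real n ^ 11 = (real n powr (1 / 3)) ^ 33"
            using nr0 by (simp add: powr_power powr_numeral)
          then show ?thesis by (simp add: power_divide power_mult_distrib)
        qed
        also have "\<dots> \<le> (real r / 33) ^ 33" using r c0 by (intro power_mono divide_right_mono) auto
        also have "\<dots> \<le> real (r choose 33)" using binomial_ge_n_over_k_pow_k[of 33 r, where 'a = real] t(2) by simp
        finally have den: "(c / 33) ^ 33 * real n ^ 11 \<le> real (r choose 33)" .
        have "(real G * real (M\<^sup>2))\<^sup>2 / real (r choose 33) \<le> (16 * real n ^ 5)\<^sup>2 / ((c / 33) ^ 33 * real n ^ 11)"
          using num den assms nr0 by (intro frac_le) auto
        also have "\<dots> = 256 * (33 / c) ^ 33 * (real n ^ 10 / real n ^ 11)"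
          by (simp add: power_divide power_mult_distrib flip: power_mult)
        also have "real n ^ 10 / real n ^ 11 = 1 / real n" using nr0 by (simp add: power_numeral_reduce)
        finally show ?thesis by simp
      qed
      moreover have "256 * (33 / c) ^ 33 / real n + 1 / real n = K2 / real n"
        by (simp add: K2_def add_divide_distrib)
      ultimately have "success_prob N I f D (1 - 1 / exp 1 - K1 * \<epsilon>) (noisy_matroid_maximizer \<epsilon> N r) \<ge> 1 - K2 / real n"
        by linarith
      moreover have "queries_at_most N I f D (32 * real n ^ 7 / \<epsilon>) (noisy_matroid_maximizer \<epsilon> N r)"
        unfolding queries_at_most_def
      proof (intro ballI, clarify)
        fix \<xi> S q assume q: "(S, q) \<in> set_pmf (run_noisy N I f (noisy_matroid_maximizer \<epsilon> N r) \<xi>)"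
        obtain Q where Q: "\<And>\<omega>. Q \<omega> \<le> M * (r * n * (G * M\<^sup>2))"
          "run (noisy_oracle N f \<xi>) (\<lambda>S. S \<in> I) (noisy_matroid_maximizer \<epsilon> N r) =
           map_pmf (\<lambda>\<omega>. (search_result N I M (estimate G (M\<^sup>2) \<omega> (noisy_oracle N f \<xi>)) (SOME B. basis I B), Q \<omega>))
             (samples_pmf 33 r G (M\<^sup>2))"
          using run_noisy_local_search[OF m(1) _ M0, of G "M\<^sup>2" "noisy_oracle N f \<xi>" "samples_pmf 33 r G (M\<^sup>2)"]
            m(3) t(2) N(2) unfolding alg by auto
        have "q \<le> M * (r * n * (G * M\<^sup>2))" using q Q(1) unfolding run_noisy_def Q(2) by auto
        also have "\<dots> \<le> M * (n * n * (G * M\<^sup>2))" using rn by (intro mult_left_mono mult_right_mono) auto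
        finally have "real q \<le> real (M * (n * n * (G * M\<^sup>2)))" by (simp only: of_nat_le_iff)
        also have "\<dots> = 4 * real n ^ 3 * real M ^ 3"
          by (simp add: G_def power2_eq_square power3_eq_cube)
        also have "\<dots> \<le> 4 * real n ^ 3 * (8 * real n ^ 4)" using M(3) by (intro mult_left_mono) auto
        also have "\<dots> = 32 * real n ^ 7" by (simp add: power_numeral_reduce)
        \<comment> \<open>In this case \<epsilon> < 1, so dividing by it only enlarges the
          bound.\<close>
        also have "\<dots> \<le> 32 * real n ^ 7 / \<epsilon>" using False \<epsilon> by (simp add: field_simps mult_left_le_one_le)
        finally show "real q \<le> 32 * real n ^ 7 / \<epsilon>" .
      qed
      ultimately show ?thesis by blast
    qed
  qed
  have "0 < K1" "0 < K2" using \<kappa>(1) assms by (auto simp: K1_def K2_def add_nonneg_pos)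
  then show "\<exists>n0 C K1 K2 K3 :: real. 0 < C \<and> 0 < K1 \<and> 0 < K2 \<and> 0 < K3 \<and>
        (\<forall>(\<epsilon>::real) (n::nat) (r::nat) (N::'a set).
          \<epsilon> > 0 \<and> finite N \<and> card N = n \<and> real n \<ge> n0 \<and> real n \<ge> C / \<epsilon> ^ 4 \<and>
          real r \<ge> c * real n powr (1 / 3) \<longrightarrow>
          (\<forall>I f. matroid N I \<and> loopless N I \<and> strongly_base_orderable I \<and> matroid_rank I = r \<and>
             monotone_submodular N f \<longrightarrow>
             success_prob N I f D (1 - 1 / exp 1 - K1 * \<epsilon>) (noisy_matroid_maximizer \<epsilon> N r) \<ge> 1 - K2 / real n \<and>
             queries_at_most N I f D (K3 * real n ^ 7 / \<epsilon>) (noisy_matroid_maximizer \<epsilon> N r)))"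
    by (intro exI[of _ n0] exI[of _ 1] exI[of _ K1] exI[of _ K2] exI[of _ 32]) (use main in auto)
qed

end
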